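(* Let $\mu\in\mathbb{R}$, let $W$ be a standard Brownian motion and $X_t=W_t+\mu t$, $t\ge 0$. Let $T>0$ and $c>0$. Put $$m^c_\mu=\begin{cases}\mu\coth(c\mu)&\text{if }\mu\ne0,\\ c^{-1}&\text{if }\mu=0,\end{cases}\qquad (\sigma^c_\mu)^2=\begin{cases}\dfrac{2-2c\mu\coth(c\mu)}{\sinh^2(c\mu)}+1&\text{if }\mu\neq0,\\ 1/3&\text{if }\mu=0,\end{cases}$$ with $\sigma^c_\mu>0$. Then, as $n\to+\infty$, the process $$\left(\frac{\mathrm{TV}^c(X,nt)-m^c_\mu\,nt}{\sigma^c_\mu\sqrt n}\right)_{t\in[0,T]}$$ converges in distribution, in the sense of weak convergence in $\mathcal{C}([0,T],\mathbb{R})$, to a standard Brownian motion $(B_t)_{t\in[0,T]}$.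
   Context: For $c\ge 0$ let $\phi_c(x)=\max\{x-c,0\}$. For a càdlàg function $f:[a,b]\to\mathbb{R}$ define the truncated variation by $$\mathrm{TV}^c(f,[a,b])=\sup_n\ \sup_{a\le t_1<t_2<\dots<t_n\le b}\ \sum_{i=1}^{n-1}\phi_c(|f(t_{i+1})-f(t_i)|)$$ (it is $0$ when $a=b$). For a càdlàg process $X$ put, pathwise, $\mathrm{TV}^c(X,t)=\mathrm{TV}^c(X,[0,t])$. $\mathcal{C}([0,T],\mathbb{R})$ is the space of continuous functions on $[0,T]$ with the supremum norm. *)

theory Defs
  imports "HOL-Probability.Probability"
begin

section \<open>Truncated variation\<close>

definition phi :: "real \<Rightarrow> real \<Rightarrow> real" where
  "phi c x = max (x - c) 0"

text \<open>The supremum is taken in \<open>[0, \<infinity>]\<close>, since it may be infinite for \<open>c = 0\<close>;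
  for \<open>c > 0\<close> and a regulated (in particular, a continuous) \<open>f\<close> it is finite.\<close>

definition truncated_variation :: "real \<Rightarrow> (real \<Rightarrow> real) \<Rightarrow> real \<Rightarrow> real \<Rightarrow> ennreal" where
  "truncated_variation c f a b =
     (SUP (n, t) \<in> {(n :: nat, t :: nat \<Rightarrow> real). strict_mono_on {1..n} t \<and> t ` {1..n} \<subseteq> {a..b}}.
        ennreal (\<Sum>i = 1..<n. phi c \<bar>f (t (i + 1)) - f (t i)\<bar>))"


section \<open>Brownian motion\<close>

text \<open>The time set \<open>I\<close> is meant to be an interval starting at \<open>0\<close>, such as \<open>[0, \<infinity>)\<close> or
  \<open>[0, T]\<close>. All paths are required to be continuous, so that the process takes its values in a
  space of continuous functions; no completeness of the probability space is assumed.\<close>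

locale standard_brownian_motion = prob_space M
  for M :: "'a measure" and I :: "real set" and W :: "real \<Rightarrow> 'a \<Rightarrow> real" +
  assumes measurable_at: "t \<in> I \<Longrightarrow> random_variable borel (W t)"
    and start: "AE \<omega> in M. W 0 \<omega> = 0"
    and indep_increments:
      "\<And>(n :: nat) t. strict_mono_on {..n} t \<Longrightarrow> t ` {..n} \<subseteq> I \<Longrightarrow>
         indep_vars (\<lambda>_. borel) (\<lambda>i \<omega>. W (t (i + 1)) \<omega> - W (t i) \<omega>) {..<n}"
    and normal_increments:
      "\<And>s t. s \<in> I \<Longrightarrow> t \<in> I \<Longrightarrow> s < t \<Longrightarrow>
         distributed M lborel (\<lambda>\<omega>. W t \<omega> - W s \<omega>) (normal_density 0 (sqrt (t - s)))"
    and continuous_paths: "\<omega> \<in> space M \<Longrightarrow> continuous_on I (\<lambda>t. W t \<omega>)"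


section \<open>Convergence in distribution in a topological space\<close>

definition borel_of_topology :: "'a topology \<Rightarrow> 'a measure" where
  "borel_of_topology X = sigma (topspace X) {U. openin X U}"

definition weakly_converges :: "'a topology \<Rightarrow> (nat \<Rightarrow> 'a measure) \<Rightarrow> 'a measure \<Rightarrow> bool" where
  "weakly_converges X \<mu>s \<mu> \<longleftrightarrow>
     (\<forall>F. continuous_map X euclideanreal F \<and> bounded (F ` topspace X) \<longrightarrow>
        (\<lambda>n. \<integral>x. F x \<partial>\<mu>s n) \<longlonglongrightarrow> (\<integral>x. F x \<partial>\<mu>))"

text \<open>Convergence in distribution of random elements \<open>Y n\<close>, defined on \<open>M\<close>, to a random element
  \<open>Z\<close>, defined on a possibly different \<open>N\<close>. Measurability is part of the notion: it includes that
  the \<open>Y n\<close> and \<open>Z\<close> take their values in the topological space.\<close>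

definition converges_in_distribution ::
  "'c topology \<Rightarrow> 'a measure \<Rightarrow> (nat \<Rightarrow> 'a \<Rightarrow> 'c) \<Rightarrow> 'b measure \<Rightarrow> ('b \<Rightarrow> 'c) \<Rightarrow> bool" where
  "converges_in_distribution X M Y N Z \<longleftrightarrow>
     (\<forall>n. Y n \<in> measurable M (borel_of_topology X)) \<and>
     Z \<in> measurable N (borel_of_topology X) \<and>
     weakly_converges X
       (\<lambda>n. distr M (borel_of_topology X) (Y n)) (distr N (borel_of_topology X) Z)"

text \<open>\<open>C([0, T], \<real>)\<close> with the topology of the supremum metric. Its points are the continuous
  functions on \<open>[0, T]\<close>, represented as functions that are \<open>undefined\<close> outside \<open>[0, T]\<close>.\<close>

definition C_space :: "real \<Rightarrow> (real \<Rightarrow> real) topology" where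
  "C_space T = mtopology_of (cfunspace (top_of_set {0..T}) euclidean_metric)"


section \<open>The constants\<close>

definition coth :: "real \<Rightarrow> real" where
  "coth x = cosh x / sinh x"

definition m_const :: "real \<Rightarrow> real \<Rightarrow> real" where
  "m_const c \<mu> = (if \<mu> \<noteq> 0 then \<mu> * coth (c * \<mu>) else 1 / c)"

definition sigma_sq :: "real \<Rightarrow> real \<Rightarrow> real" where
  "sigma_sq c \<mu> =
     (if \<mu> \<noteq> 0 then (2 - 2 * c * \<mu> * coth (c * \<mu>)) / (sinh (c * \<mu>))\<^sup>2 + 1 else 1 / 3)"

definition sigma_const :: "real \<Rightarrow> real \<Rightarrow> real" where
  "sigma_const c \<mu> = sqrt (sigma_sq c \<mu>)"

end

theory Submission
  imports Defs
begin

text \<open>Up to a bounded error, \<open>TV\<^sup>c(X, t)\<close> is the total variation of the pushing process that keeps \<open>X\<close>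
  in an interval of length \<open>c\<close>. On a fine grid the position in the interval is a reflected chain \<open>z\<close>.
  Let \<open>p\<close> solve \<open>p' / 2 + \<mu> p = m\<close> with \<open>p(0) = -1\<close> and \<open>p(c) = 1\<close>. A discrete Ito formula for a
  primitive of \<open>p\<close> turns the pushing process into \<open>m t\<close> plus the martingale
  \<open>\<Sum> p(z\<^sub>j) \<Delta>W\<^sub>j\<close> plus bounded terms. A second corrector, vanishing at both ends, shows that the clock
  \<open>\<Sum> p(z\<^sub>j)\<^sup>2 \<delta>\<close> of this martingale is \<open>\<sigma>\<^sup>2 t\<close> up to a martingale of smaller order. Split
  \<open>[0, n T]\<close> into \<open>K\<close> blocks. Since the martingale is conditionally Gaussian, stopping it in every
  block when its clock reaches the value \<open>\<sigma>\<^sup>2 n T / K\<close>, and filling up the missing variance with later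
  increments of \<open>W\<close>, makes the block sums exactly independent and Gaussian. So the normalised process
  is uniformly close to a polygon through values distributed as those of a Brownian motion. The mesh
  of the grid may depend on \<open>n\<close> and no rate is needed.\<close>

section \<open>Truncated variation of a continuous function\<close>

text \<open>The boundary values of \<open>p\<close> come from the reflection: the overshoot is
  positive at \<open>c\<close> and negative at \<open>0\<close>, so \<open>p\<close> at the barrier
  times the overshoot is its absolute value. Both constants are solvability conditions. Only for
  \<open>m_const c \<mu>\<close> can a first-order equation meet two boundary values, and only for
  \<open>sigma_sq c \<mu>\<close>, the mean of \<open>p\<^sup>2\<close> under the stationary density
  proportional to \<open>exp (2 * \<mu> * x)\<close>, does the second corrector exist. The obstacle
  is uniformity in time. The martingale has to be controlled inside all \<open>K\<close> blocks at
  once, and a second-moment inequality bounds the probability of a large oscillation in one block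
  only by a multiple of \<open>1 / K\<close>, which does not survive the union over the blocks.
  Hence the exponential martingale, fed by the bound \<open>\<bar>p\<bar> \<le> 1\<close>. As the
  block sums are exactly Gaussian, neither a martingale central limit theorem nor a tightness
  argument enters: the limit is compared with polygons of the same law, and Lipschitz functionals
  turn uniform closeness into convergence of integrals.\<close>

definition chain_sum :: "real \<Rightarrow> (real \<Rightarrow> real) \<Rightarrow> nat \<Rightarrow> (nat \<Rightarrow> real) \<Rightarrow> real" where
  "chain_sum c f n t = (\<Sum>i = 1..<n. phi c \<bar>f (t (i + 1)) - f (t i)\<bar>)"

lemma phi_nonneg [simp]: "0 \<le> phi c x"
  by (simp add: phi_def)

lemma phi_0 [simp]: "0 \<le> c \<Longrightarrow> phi c 0 = 0"
  by (simp add: phi_def)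

lemma phi_le: "x \<le> y + e \<Longrightarrow> 0 \<le> e \<Longrightarrow> phi c x \<le> phi c y + e"
  by (auto simp: phi_def)

lemma chain_sum_nonneg [simp]: "0 \<le> chain_sum c f n t"
  by (simp add: chain_sum_def sum_nonneg)

lemma chain_sum_Suc:
  "1 \<le> n \<Longrightarrow> chain_sum c f (Suc n) t = chain_sum c f n t + phi c \<bar>f (t (Suc n)) - f (t n)\<bar>"
  by (simp add: chain_sum_def)

lemma chain_sum_0 [simp]: "chain_sum c f 0 t = 0" "chain_sum c f (Suc 0) t = 0"
  by (simp_all add: chain_sum_def)

lemma chain_sum_cong:
  assumes "\<And>i. 1 \<le> i \<Longrightarrow> i \<le> n \<Longrightarrow> f (t i) = g (u i)"
  shows "chain_sum c f n t = chain_sum c g n u"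
  unfolding chain_sum_def using assms by (intro sum.cong) auto

lemma truncated_variation_upper:
  assumes "strict_mono_on {1..n} t" "t ` {1..n} \<subseteq> {a..b}"
  shows "ennreal (chain_sum c f n t) \<le> truncated_variation c f a b"
  unfolding truncated_variation_def chain_sum_def using assms
  by (intro SUP_upper2[of "(n, t)"]) auto

lemma truncated_variation_least:
  assumes "\<And>n t. strict_mono_on {1..n} t \<Longrightarrow> t ` {1..n} \<subseteq> {a..b} \<Longrightarrow> ennreal (chain_sum c f n t) \<le> B"
  shows "truncated_variation c f a b \<le> B"
  unfolding truncated_variation_def using assms[unfolded chain_sum_def]
  by (intro SUP_least) auto

lemma strict_chain_exists:
  assumes c: "0 \<le> c" and "1 \<le> n" and "mono_on {1..n} t" and "t ` {1..n} \<subseteq> {a..b}"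
  shows "\<exists>m u. 1 \<le> m \<and> strict_mono_on {1..m} u \<and> u ` {1..m} \<subseteq> {a..b} \<and> u m = t n \<and>
    chain_sum c f m u = chain_sum c f n t"
  using assms(2-)
proof (induction n rule: nat_induct_at_least)
  case base
  then show ?case
    by (intro exI[of _ 1] exI[of _ t]) (auto simp: strict_mono_on_def)
next
  case (Suc n)
  have "mono_on {1..n} t" "t ` {1..n} \<subseteq> {a..b}"
    using Suc.prems by (auto simp: mono_on_def)
  then obtain m u where u: "1 \<le> m" "strict_mono_on {1..m} u" "u ` {1..m} \<subseteq> {a..b}" "u m = t n"
    "chain_sum c f m u = chain_sum c f n t"
    using Suc.IH by blast
  have le: "t n \<le> t (Suc n)"
    using Suc.prems(1) Suc.hyps by (auto simp: mono_on_def)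
  show ?case
  proof (cases "t n = t (Suc n)")
    case True
    then show ?thesis
      using u Suc.hyps c by (intro exI[of _ m] exI[of _ u]) (auto simp: chain_sum_Suc)
  next
    case False
    define v where "v = u(Suc m := t (Suc n))"
    have "strict_mono_on {1..Suc m} v"
    proof (rule strict_mono_onI)
      fix r s assume rs: "r \<in> {1..Suc m}" "s \<in> {1..Suc m}" "r < s"
      have "u r \<le> u m" if "r \<le> m"
        using that rs u(1) strict_mono_on_leD[OF u(2)] by auto
      with rs False le u show "v r < v s"
        by (cases "s = Suc m") (auto simp: v_def strict_mono_on_def)
    qed
    moreover have "v ` {1..Suc m} \<subseteq> {a..b}"
    proof
      fix y assume "y \<in> v ` {1..Suc m}"
      then obtain i where i: "1 \<le> i" "i \<le> Suc m" "y = v i" by auto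
      show "y \<in> {a..b}"
      proof (cases "i = Suc m")
        case True
        have "t (Suc n) \<in> t ` {1..Suc n}" by (rule imageI) simp
        then have "t (Suc n) \<in> {a..b}" using Suc.prems(2) by blast
        then show ?thesis using i True by (simp add: v_def)
      next
        case False
        then have "i \<in> {1..m}" using i by auto
        then have "u i \<in> {a..b}" using u(3) by blast
        then show ?thesis using i False by (simp add: v_def)
      qed
    qed
    moreover have "chain_sum c f m v = chain_sum c f m u"
      by (rule chain_sum_cong) (auto simp: v_def)
    ultimately show ?thesis
      using u Suc.hyps by (intro exI[of _ "Suc m"] exI[of _ v] conjI) (simp_all add: chain_sum_Suc, simp_all add: v_def)
  qed
qed

lemma truncated_variation_upper_mono:
  assumes c: "0 \<le> c" and "mono_on {1..n} t" and "t ` {1..n} \<subseteq> {a..b}"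
  shows "ennreal (chain_sum c f n t) \<le> truncated_variation c f a b"
proof (cases "1 \<le> n")
  case True
  then show ?thesis
    using strict_chain_exists[OF c True assms(2,3), of f] truncated_variation_upper by metis
next
  case False
  then show ?thesis by (cases n) auto
qed

lemma truncated_variation_mono:
  "b \<le> b' \<Longrightarrow> truncated_variation c f a b \<le> truncated_variation c f a b'"
  by (rule truncated_variation_least) (force intro!: truncated_variation_upper)

text \<open>Replacing every point \<open>u > s\<close> of a chain by \<open>s\<close> costs at most \<open>\<epsilon>\<close>: steps inside \<open>[s, s']\<close>
  do not exceed \<open>c\<close>, and only one step crosses \<open>s\<close>.\<close>

lemma truncated_variation_step:
  assumes c: "0 \<le> c" and as: "a \<le> s" "s \<le> s'" and e: "0 \<le> \<epsilon>"
    and osc: "\<And>u. s \<le> u \<Longrightarrow> u \<le> s' \<Longrightarrow> \<bar>f u - f s\<bar> \<le> \<epsilon>"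
    and small: "\<And>u v. s \<le> u \<Longrightarrow> u \<le> s' \<Longrightarrow> s \<le> v \<Longrightarrow> v \<le> s' \<Longrightarrow> \<bar>f u - f v\<bar> \<le> c"
  shows "truncated_variation c f a s' \<le> truncated_variation c f a s + ennreal \<epsilon>"
proof (rule truncated_variation_least)
  fix n :: nat and t :: "nat \<Rightarrow> real"
  assume t: "strict_mono_on {1..n} t" "t ` {1..n} \<subseteq> {a..s'}"
  define u where "u i = min (t i) s" for i
  have mt: "t i \<le> t j" if "1 \<le> i" "i \<le> j" "j \<le> n" for i j
    using strict_mono_on_leD[OF t(1)] that by auto
  have mu: "mono_on {1..n} u"
    using mt by (auto simp: mono_on_def u_def min_def intro: order_trans)
  have "u ` {1..n} \<subseteq> {a..s}"
    using t(2) as by (auto simp: u_def min_def)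
  note U = truncated_variation_upper_mono[OF c mu this, of f]
  have main: "chain_sum c f k t \<le> chain_sum c f k u + (if s < t k then \<epsilon> else 0)" if "1 \<le> k" "k \<le> n" for k
    using that
  proof (induction k rule: nat_induct_at_least)
    case base
    then show ?case using e by simp
  next
    case (Suc k)
    have le: "t k \<le> t (Suc k)" using mt Suc by auto
    have in_s: "t i \<le> s'" if "1 \<le> i" "i \<le> n" for i
      using t(2) that by (auto simp: image_subset_iff)
    consider "t (Suc k) \<le> s" | "t k \<le> s" "s < t (Suc k)" | "s < t k" by linarith
    then show ?case
    proof cases
      case 1
      then show ?thesis using Suc le by (simp add: chain_sum_Suc u_def min_def)
    next
      case 2
      have "\<bar>f (t (Suc k)) - f s\<bar> \<le> \<epsilon>" using 2 in_s[of "Suc k"] Suc by (intro osc) auto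
      then have "phi c \<bar>f (t (Suc k)) - f (t k)\<bar> \<le> phi c \<bar>f s - f (t k)\<bar> + \<epsilon>"
        using e by (intro phi_le) auto
      then show ?thesis using Suc 2 by (simp add: chain_sum_Suc u_def min_def)
    next
      case 3
      have "\<bar>f (t (Suc k)) - f (t k)\<bar> \<le> c"
        using 3 in_s[of "Suc k"] in_s[of k] Suc le by (intro small) auto
      then have "phi c \<bar>f (t (Suc k)) - f (t k)\<bar> = 0" by (simp add: phi_def)
      then show ?thesis using Suc 3 le by (simp add: chain_sum_Suc) (metis add_increasing2 phi_nonneg add.commute add.left_commute)
    qed
  qed
  have "chain_sum c f n t \<le> chain_sum c f n u + \<epsilon>"
    using main[of n] e by (cases n) (auto split: if_splits)
  then have "ennreal (chain_sum c f n t) \<le> ennreal (chain_sum c f n u) + ennreal \<epsilon>"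
    using e by (simp flip: ennreal_plus)
  also have "\<dots> \<le> truncated_variation c f a s + ennreal \<epsilon>"
    by (intro add_right_mono U)
  finally show "ennreal (chain_sum c f n t) \<le> truncated_variation c f a s + ennreal \<epsilon>" .
qed

lemma truncated_variation_singleton: "truncated_variation c f a a = 0"
proof -
  have "ennreal (chain_sum c f n t) \<le> 0" if "strict_mono_on {1..n} t" "t ` {1..n} \<subseteq> {a..a}" for n and t :: "nat \<Rightarrow> real"
  proof (cases "n \<le> 1")
    case True
    then have "n = 0 \<or> n = Suc 0" by auto
    then show ?thesis by auto
  next
    case False
    then have "t 1 < t 2" using that(1) by (auto simp: strict_mono_on_def)
    moreover have "t 1 \<in> t ` {1..n}" "t 2 \<in> t ` {1..n}" using False by auto
    then have "t 1 \<in> {a..a}" "t 2 \<in> {a..a}" using that(2) by blast+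
    ultimately show ?thesis by auto
  qed
  then have "truncated_variation c f a a \<le> 0" by (rule truncated_variation_least)
  then show ?thesis by simp
qed

lemma continuous_grid_modulus:
  fixes f :: "real \<Rightarrow> real"
  assumes "continuous_on {0..R} f" "0 \<le> R" "0 < \<epsilon>"
  shows "\<forall>\<^sub>F Q in sequentially. \<forall>s t. 0 \<le> s \<longrightarrow> s \<le> R \<longrightarrow> 0 \<le> t \<longrightarrow> t \<le> R \<longrightarrow>
    \<bar>s - t\<bar> \<le> R / real Q \<longrightarrow> \<bar>f s - f t\<bar> < \<epsilon>"
proof -
  have "uniformly_continuous_on {0..R} f"
    using assms by (intro compact_uniformly_continuous) auto
  then obtain d where d: "d > 0"
    "\<And>s t. s \<in> {0..R} \<Longrightarrow> t \<in> {0..R} \<Longrightarrow> dist t s < d \<Longrightarrow> dist (f t) (f s) < \<epsilon>"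
    using assms(3) unfolding uniformly_continuous_on_def by metis
  have "(\<lambda>Q. R / real Q) \<longlonglongrightarrow> 0" by real_asymp
  then have "\<forall>\<^sub>F Q in sequentially. R / real Q < d"
    using d(1) by (rule order_tendstoD)
  then show ?thesis
    by eventually_elim (use d(2) in \<open>force simp: dist_real_def\<close>)
qed

text \<open>On a partition so fine that the oscillation in each cell is below \<open>c\<close>,
  \<open>truncated_variation_step\<close> adds at most \<open>c\<close> per cell.\<close>

lemma truncated_variation_finite:
  fixes f :: "real \<Rightarrow> real"
  assumes f: "continuous_on {0..R} f" and R: "0 \<le> R" and c: "0 < c"
  shows "truncated_variation c f 0 R < \<infinity>"
proof -
  from continuous_grid_modulus[OF f R c]
  have "\<forall>\<^sub>F Q in sequentially. 1 \<le> Q \<and> (\<forall>s t. 0 \<le> s \<longrightarrow> s \<le> R \<longrightarrow> 0 \<le> t \<longrightarrow> t \<le> R \<longrightarrow>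
    \<bar>s - t\<bar> \<le> R / real Q \<longrightarrow> \<bar>f s - f t\<bar> < c)"
    by (intro eventually_conj eventually_ge_at_top) auto
  from eventually_happens[OF this]
  obtain Q :: nat where Q: "1 \<le> Q" "\<And>s t. 0 \<le> s \<Longrightarrow> s \<le> R \<Longrightarrow> 0 \<le> t \<Longrightarrow> t \<le> R \<Longrightarrow>
    \<bar>s - t\<bar> \<le> R / real Q \<Longrightarrow> \<bar>f s - f t\<bar> < c"
    by auto
  have "truncated_variation c f 0 (real j * (R / Q)) \<le> ennreal (real j * c)" if "j \<le> Q" for j
    using that
  proof (induction j)
    case 0
    then show ?case by (simp add: truncated_variation_singleton)
  next
    case (Suc j)
    define s s' where "s = real j * (R / Q)" and "s' = real (Suc j) * (R / Q)"
    have "real (Suc j) * (R / Q) \<le> real Q * (R / Q)"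
      using Suc R Q(1) by (intro mult_right_mono) auto
    then have s': "s' \<le> R" using Q(1) by (simp add: s'_def)
    have diff: "s' - s = R / Q" "0 \<le> s" "s \<le> s'" using R by (auto simp: s_def s'_def algebra_simps add_divide_distrib)
    have "truncated_variation c f 0 s' \<le> truncated_variation c f 0 s + ennreal c"
      using c s' diff R by (intro truncated_variation_step less_imp_le[OF Q(2)]) auto
    also have "\<dots> \<le> ennreal (real j * c) + ennreal c"
      using Suc by (intro add_right_mono) (auto simp: s_def)
    also have "\<dots> = ennreal (real (Suc j) * c)"
      using c by (simp add: algebra_simps flip: ennreal_plus)
    finally show ?case by (simp add: s'_def)
  qed
  from this[of Q] Q(1) show ?thesis
    by (metis (no_types, lifting) ennreal_less_top infinity_ennreal_def le_less_trans less_numeral_extra(1)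
        nonzero_mult_div_cancel_left of_nat_0_less_iff order_less_le order_refl
        times_divide_eq_right zero_less_iff_neq_zero less_le_trans)
qed

text \<open>\<open>enn2real\<close> sends infinity to \<open>0\<close>, so this real version is
  faithful only where the supremum is finite, as it is for continuous \<open>f\<close> and
  \<open>c > 0\<close>.\<close>

definition tv :: "real \<Rightarrow> (real \<Rightarrow> real) \<Rightarrow> real \<Rightarrow> real" where
  "tv c f s = enn2real (truncated_variation c f 0 s)"

context
  fixes f :: "real \<Rightarrow> real" and c :: real
  assumes cont: "continuous_on {0..} f" and c: "0 < c"
begin

lemma ennreal_tv: "0 \<le> s \<Longrightarrow> ennreal (tv c f s) = truncated_variation c f 0 s"
  unfolding tv_def using truncated_variation_finite[of s f c] continuous_on_subset[OF cont] c
  by (intro ennreal_enn2real) auto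

lemma tv_nonneg [simp]: "0 \<le> tv c f s"
  by (simp add: tv_def)

lemma tv_mono: "0 \<le> s \<Longrightarrow> s \<le> s' \<Longrightarrow> tv c f s \<le> tv c f s'"
  using truncated_variation_mono[of s s' c f 0] ennreal_tv[of s] ennreal_tv[of s'] 
  by (metis ennreal_le_iff order_trans tv_nonneg)

lemma chain_sum_le_tv:
  assumes "0 \<le> s" "mono_on {1..n} t" "t ` {1..n} \<subseteq> {0..s}"
  shows "chain_sum c f n t \<le> tv c f s"
  using truncated_variation_upper_mono[of c n t 0 s f] assms c ennreal_tv[of s]
  by (metis ennreal_le_iff less_imp_le tv_nonneg)

lemma chain_approx:
  assumes s: "0 \<le> s" and e: "0 < \<epsilon>"
  shows "\<exists>n t. strict_mono_on {1..n} t \<and> t ` {1..n} \<subseteq> {0..s} \<and> tv c f s - \<epsilon> < chain_sum c f n t"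
proof (rule ccontr)
  assume neg: "\<not> ?thesis"
  \<comment> \<open>\<open>ennreal\<close> maps negative numbers to \<open>0\<close>, so the
    candidate bound is cut off at \<open>0\<close>; when the variation itself is \<open>0\<close>,
    the empty chain is the witness.\<close>
  have "truncated_variation c f 0 s \<le> ennreal (max 0 (tv c f s - \<epsilon>))"
    using neg by (intro truncated_variation_least ennreal_leI) (auto simp: not_less le_max_iff_disj)
  then have le: "tv c f s \<le> max 0 (tv c f s - \<epsilon>)"
    using ennreal_tv[OF s] by (metis ennreal_le_iff max.cobounded1)
  show False
  proof (cases "tv c f s = 0")
    case True
    then have "\<exists>n t. strict_mono_on {1..n} t \<and> t ` {1..n} \<subseteq> {0..s} \<and> tv c f s - \<epsilon> < chain_sum c f n t"
      using e s by (intro exI[of _ 0] exI[of _ "\<lambda>_. 0"]) (auto simp: strict_mono_on_def)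
    then show False using neg by blast
  next
    case False
    then have "tv c f s > 0" using tv_nonneg[of s] by linarith
    then show False using le e by (simp add: max_def split: if_splits)
  qed
qed

lemma tv_step:
  assumes "0 \<le> s" "s \<le> s'" "0 \<le> \<epsilon>" "\<epsilon> \<le> c"
    and "\<And>u v. s \<le> u \<Longrightarrow> u \<le> s' \<Longrightarrow> s \<le> v \<Longrightarrow> v \<le> s' \<Longrightarrow> \<bar>f u - f v\<bar> \<le> \<epsilon>"
  shows "tv c f s' \<le> tv c f s + \<epsilon>"
proof -
  have "truncated_variation c f 0 s' \<le> truncated_variation c f 0 s + ennreal \<epsilon>"
    using assms c by (intro truncated_variation_step) (auto intro: order_trans)
  then have "ennreal (tv c f s') \<le> ennreal (tv c f s + \<epsilon>)"
    using assms by (simp add: ennreal_tv)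
  then show ?thesis
    using assms by (subst (asm) ennreal_le_iff) auto
qed

text \<open>By \<open>tv_step\<close> the increment of \<open>tv c f\<close> over a short interval
  is at most the oscillation of \<open>f\<close> there, as long as that oscillation does not exceed
  \<open>c\<close>; hence the minimum with \<open>c\<close> in the choice of
  \<open>\<epsilon>\<close>.\<close>

lemma continuous_on_tv: "continuous_on {0..R} (tv c f)"
proof (cases "0 \<le> R")
  case R: True
  show ?thesis
    unfolding continuous_on_iff
  proof (intro ballI allI impI)
    fix s e :: real assume s: "s \<in> {0..R}" and e: "0 < e"
    define \<epsilon> where "\<epsilon> = min (e / 2) c"
    have ep: "0 < \<epsilon>" "\<epsilon> \<le> c" "\<epsilon> < e" using e c by (auto simp: \<epsilon>_def)
    have "uniformly_continuous_on {0..R} f"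
      using continuous_on_subset[OF cont] by (intro compact_uniformly_continuous) auto
    then obtain d where d: "d > 0"
      "\<And>s t. s \<in> {0..R} \<Longrightarrow> t \<in> {0..R} \<Longrightarrow> dist t s < d \<Longrightarrow> dist (f t) (f s) < \<epsilon>"
      using ep unfolding uniformly_continuous_on_def by metis
    have *: "tv c f v \<le> tv c f u + \<epsilon>" if "u \<in> {0..R}" "v \<in> {0..R}" "u \<le> v" "v - u < d" for u v
    proof (rule tv_step)
      fix a b assume "u \<le> a" "a \<le> v" "u \<le> b" "b \<le> v"
      with that d(2)[of a b] have "\<bar>f b - f a\<bar> < \<epsilon>" by (auto simp: dist_real_def)
      then show "\<bar>f a - f b\<bar> \<le> \<epsilon>" by linarith
    qed (use that ep in auto)
    show "\<exists>d>0. \<forall>x'\<in>{0..R}. dist x' s < d \<longrightarrow> dist (tv c f x') (tv c f s) < e"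
    proof (intro exI[of _ d] conjI ballI impI d(1))
      fix t assume t: "t \<in> {0..R}" "dist t s < d"
      show "dist (tv c f t) (tv c f s) < e"
        using *[of s t] *[of t s] tv_mono[of s t] tv_mono[of t s] s t ep
        by (cases "s \<le> t") (auto simp: dist_real_def)
    qed
  qed
qed auto

end

section \<open>The reflected chain\<close>

text \<open>The discrete two-sided Skorokhod reflection of a walk with steps \<open>e\<close>. The
  start in the middle of \<open>[0, c]\<close> is the source of the constant \<open>c / 2\<close> in
  the comparison with the truncated variation.\<close>

fun refl_chain :: "real \<Rightarrow> (nat \<Rightarrow> real) \<Rightarrow> nat \<Rightarrow> real" where
  "refl_chain c e 0 = c / 2"
| "refl_chain c e (Suc j) = max 0 (min c (refl_chain c e j + e j))"

definition overshoot :: "real \<Rightarrow> (nat \<Rightarrow> real) \<Rightarrow> nat \<Rightarrow> real" where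
  "overshoot c e j = refl_chain c e j + e j - refl_chain c e (Suc j)"

definition pushing :: "real \<Rightarrow> (nat \<Rightarrow> real) \<Rightarrow> nat \<Rightarrow> real" where
  "pushing c e N = (\<Sum>j<N. \<bar>overshoot c e j\<bar>)"

lemma refl_chain_bounds: "0 \<le> c \<Longrightarrow> 0 \<le> refl_chain c e j \<and> refl_chain c e j \<le> c"
  by (cases j) auto

lemma overshoot_le: "0 \<le> c \<Longrightarrow> \<bar>overshoot c e j\<bar> \<le> \<bar>e j\<bar>"
  using refl_chain_bounds[of c e j] by (auto simp: overshoot_def max_def min_def)

lemma pushing_Suc: "pushing c e (Suc N) = pushing c e N + \<bar>overshoot c e N\<bar>"
  by (simp add: pushing_def)

lemma pushing_mono: "m \<le> n \<Longrightarrow> pushing c e m \<le> pushing c e n"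
  unfolding pushing_def by (intro sum_mono2) auto

lemma pushing_nonneg: "0 \<le> pushing c e n"
  unfolding pushing_def by (intro sum_nonneg) auto

text \<open>The pushing process has bounded distance \<open>c/2\<close> to the path, so that a path increment exceeds
  the pushing increment by at most \<open>c\<close>.\<close>

lemma phi_increment_le_pushing:
  assumes c: "0 \<le> c" and "i \<le> j" and e: "\<And>k. e k = x (Suc k) - x k"
  shows "phi c \<bar>x j - x i\<bar> \<le> pushing c e j - pushing c e i"
proof -
  have "\<bar>(x j - refl_chain c e j) - (x i - refl_chain c e i)\<bar> \<le> pushing c e j - pushing c e i"
    using \<open>i \<le> j\<close>
  proof (induction j rule: dec_induct)
    case (step n)
    have "x (Suc n) - refl_chain c e (Suc n) = (x n - refl_chain c e n) + overshoot c e n"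
      by (simp add: overshoot_def e)
    then show ?case using step pushing_Suc[of c e n] by linarith
  qed simp
  then show ?thesis
    using refl_chain_bounds[OF c, of e i] refl_chain_bounds[OF c, of e j] pushing_mono[OF \<open>i \<le> j\<close>, of c e]
    by (auto simp: phi_def)
qed

lemma index_chain_le_pushing:
  fixes i :: "nat \<Rightarrow> nat"
  assumes c: "0 \<le> c" and e: "\<And>k. e k = x (Suc k) - x k" and "1 \<le> n" and "mono_on {1..n} i"
  shows "(\<Sum>k = 1..<n. phi c \<bar>x (i (Suc k)) - x (i k)\<bar>) \<le> pushing c e (i n)"
  using assms(3-)
proof (induction n rule: nat_induct_at_least)
  case base
  then show ?case by (simp add: pushing_nonneg)
next
  case (Suc n)
  then have "i n \<le> i (Suc n)" "mono_on {1..n} i" by (auto simp: mono_on_def)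
  then show ?case
    using Suc phi_increment_le_pushing[OF c, of "i n" "i (Suc n)" e x, OF _ e] by simp
qed

text \<open>The invariant: some chain of indices, extended by a hypothetical last value \<open>y\<close>, collects the
  pushing up to \<open>c/2\<close>, plus the amount by which \<open>y\<close> would push.\<close>

lemma pushing_le_index_chain:
  assumes c: "0 \<le> c" and e: "\<And>k. e k = x (Suc k) - x k"
  shows "\<exists>n i. 1 \<le> n \<and> mono_on {1..n} i \<and> i ` {1..n} \<subseteq> {..N} \<and>
    pushing c e N - c / 2 + max 0 (max (y - (x N - refl_chain c e N + c)) (x N - refl_chain c e N - y))
    \<le> (\<Sum>k = 1..<n. phi c \<bar>x (i (Suc k)) - x (i k)\<bar>) + phi c \<bar>y - x (i n)\<bar>"
proof (induction N arbitrary: y)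
  case 0
  show ?case using c
    by (intro exI[of _ 1] exI[of _ "\<lambda>_. 0"]) (auto simp: mono_on_def pushing_def phi_def)
next
  case (Suc N)
  \<comment> \<open>\<open>L\<close> is the lower end of the moving interval of length
    \<open>c\<close> that contains the path, \<open>L'\<close> the one after the next step, and
    \<open>d\<close> measures how far a value lies outside such an interval.\<close>
  define L where "L = x N - refl_chain c e N"
  define L' where "L' = x (Suc N) - refl_chain c e (Suc N)"
  define d where "d L y = max 0 (max (y - (L + c)) (L - y))" for L y :: real
  define G where "G n i y = (\<Sum>k = 1..<n. phi c \<bar>x (i (Suc k)) - x (i k)\<bar>) + phi c \<bar>y - x (i n)\<bar>"
    for n and i :: "nat \<Rightarrow> nat" and y
  have IH: "\<exists>n i. 1 \<le> n \<and> mono_on {1..n} i \<and> i ` {1..n} \<subseteq> {..N} \<and> pushing c e N - c / 2 + d L y \<le> G n i y" for y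
    using Suc unfolding L_def d_def G_def by blast
  have LL: "L' = L + overshoot c e N" by (simp add: L_def L'_def overshoot_def e)
  have xN: "x (Suc N) = x N + e N" by (simp add: e)
  have b: "0 \<le> refl_chain c e N" "refl_chain c e N \<le> c" using refl_chain_bounds[OF c] by auto
  have keep: "\<exists>n i. 1 \<le> n \<and> mono_on {1..n} i \<and> i ` {1..n} \<subseteq> {..Suc N} \<and> 
      pushing c e (Suc N) - c / 2 + d L' y \<le> G n i y"
    if "pushing c e (Suc N) + d L' y \<le> pushing c e N + d L y"
  proof -
    obtain n i where i: "1 \<le> n" "mono_on {1..n} i" "i ` {1..n} \<subseteq> {..N}"
      "pushing c e N - c / 2 + d L y \<le> G n i y"
      using IH by blast
    have "i ` {1..n} \<subseteq> {..Suc N}" using i(3) by (meson atMost_subset_iff le_SucI order_refl subset_trans)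
    then show ?thesis using i that by (intro exI[of _ n] exI[of _ i]) auto
  qed
  have app: "\<exists>n i. 1 \<le> n \<and> mono_on {1..n} i \<and> i ` {1..n} \<subseteq> {..Suc N} \<and> 
      pushing c e (Suc N) - c / 2 + d L' y \<le> G n i y"
    if le: "pushing c e (Suc N) + d L' y \<le> pushing c e N + d L (x (Suc N)) + phi c \<bar>y - x (Suc N)\<bar>"
  proof -
    obtain n i where i: "1 \<le> n" "mono_on {1..n} i" "i ` {1..n} \<subseteq> {..N}"
      "pushing c e N - c / 2 + d L (x (Suc N)) \<le> G n i (x (Suc N))"
      using IH by blast
    define j where "j = i(Suc n := Suc N)"
    have iN: "i k \<le> N" if "1 \<le> k" "k \<le> n" for k using i(3) that by force
    have "mono_on {1..Suc n} j"
      using i(2) iN by (auto simp: mono_on_def j_def le_Suc_eq)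
    moreover have "j ` {1..Suc n} \<subseteq> {..Suc N}" using iN by (auto simp: j_def le_Suc_eq)
    moreover have "G (Suc n) j y = G n i (x (Suc N)) + phi c \<bar>y - x (Suc N)\<bar>"
      using i(1) by (simp add: G_def j_def)
    ultimately show ?thesis using i le
      by (intro exI[of _ "Suc n"] exI[of _ j]) auto
  qed
  have "\<exists>n i. 1 \<le> n \<and> mono_on {1..n} i \<and> i ` {1..n} \<subseteq> {..Suc N} \<and> 
      pushing c e (Suc N) - c / 2 + d L' y \<le> G n i y"
  proof -
    \<comment> \<open>If a push occurs, the path ends at the pushed end of the new interval. When
      \<open>y\<close> lies at least as far out, the old chain with last value \<open>y\<close>
      already pays for the push; when \<open>y\<close> lies further in, the extreme value
      \<open>x (Suc N)\<close> becomes a point of the chain, and the induction hypothesis is used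
      with this value in place of \<open>y\<close>.\<close>
    consider "overshoot c e N = 0" | "overshoot c e N > 0" | "overshoot c e N < 0" by linarith
    then show ?thesis
    proof cases
      case 1
      then show ?thesis using LL by (intro keep) (simp add: pushing_Suc)
    next
      case 2
      have "refl_chain c e (Suc N) = c" using 2 b by (auto simp: overshoot_def max_def min_def split: if_splits)
      have "x (Suc N) = L' + c" using \<open>refl_chain c e (Suc N) = c\<close> by (simp add: L'_def)
      show ?thesis
      proof (cases "y \<ge> x (Suc N)")
        case True
        show ?thesis
          by (rule keep) (use True \<open>x (Suc N) = L' + c\<close> 2 LL c in \<open>auto simp: pushing_Suc d_def\<close>)
      next
        case False
        show ?thesis
          by (rule app) (use False \<open>x (Suc N) = L' + c\<close> 2 LL c in \<open>auto simp: pushing_Suc d_def phi_def\<close>)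
      qed
    next
      case 3
      have "refl_chain c e (Suc N) = 0" using 3 b by (auto simp: overshoot_def max_def min_def split: if_splits)
      have "x (Suc N) = L'" using \<open>refl_chain c e (Suc N) = 0\<close> by (simp add: L'_def)
      show ?thesis
      proof (cases "y \<le> x (Suc N)")
        case True
        show ?thesis
          by (rule keep) (use True \<open>x (Suc N) = L'\<close> 3 LL c in \<open>auto simp: pushing_Suc d_def\<close>)
      next
        case False
        show ?thesis
          by (rule app) (use False \<open>x (Suc N) = L'\<close> 3 LL c in \<open>auto simp: pushing_Suc d_def phi_def\<close>)
      qed
    qed
  qed
  then show ?case unfolding L'_def d_def G_def .
qed

section \<open>Comparison of pushing and truncated variation on a time grid\<close>

definition grid_increment :: "real \<Rightarrow> (real \<Rightarrow> real) \<Rightarrow> nat \<Rightarrow> real" where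
  "grid_increment \<delta> f j = f (real (Suc j) * \<delta>) - f (real j * \<delta>)"

context
  fixes f :: "real \<Rightarrow> real" and c :: real
  assumes cont: "continuous_on {0..} f" and c: "0 < c"
begin

lemma pushing_le_tv:
  assumes d: "0 \<le> \<delta>"
  shows "pushing c (grid_increment \<delta> f) N - c / 2 \<le> tv c f (real N * \<delta>)"
proof -
  define x where "x j = f (real j * \<delta>)" for j
  obtain n i where i: "1 \<le> n" "mono_on {1..n} i" "i ` {1..n} \<subseteq> {..N}" and
    le: "pushing c (grid_increment \<delta> f) N - c / 2 + 
       max 0 (max (x N - (x N - refl_chain c (grid_increment \<delta> f) N + c)) (x N - refl_chain c (grid_increment \<delta> f) N - x N))
      \<le> (\<Sum>k = 1..<n. phi c \<bar>x (i (Suc k)) - x (i k)\<bar>) + phi c \<bar>x N - x (i n)\<bar>"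
    using pushing_le_index_chain[of c "grid_increment \<delta> f" x N "x N"] c by (auto simp: x_def grid_increment_def)
  \<comment> \<open>The hypothetical last value is the true one, \<open>x N\<close>, which has
    distance \<open>0\<close> from the interval; it is appended to the chain at index
    \<open>Suc n\<close>.\<close>
  define t where "t k = (if k = Suc n then real N else real (i k)) * \<delta>" for k
  have iN: "i k \<le> N" if "1 \<le> k" "k \<le> n" for k using i(3) that by force
  have "mono_on {1..Suc n} t"
    using i(2) iN d by (auto simp: mono_on_def t_def le_Suc_eq intro!: mult_right_mono)
  moreover have "t ` {1..Suc n} \<subseteq> {0..real N * \<delta>}"
    using iN d by (auto simp: t_def le_Suc_eq intro!: mult_right_mono)
  ultimately have "chain_sum c f (Suc n) t \<le> tv c f (real N * \<delta>)"
    using d by (intro chain_sum_le_tv[OF cont c]) auto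
  moreover have "chain_sum c f (Suc n) t = (\<Sum>k = 1..<n. phi c \<bar>x (i (Suc k)) - x (i k)\<bar>) + phi c \<bar>x N - x (i n)\<bar>"
    using i(1) by (auto simp: chain_sum_def t_def x_def)
  ultimately show ?thesis using le by linarith
qed

text \<open>Rounding the times of a near-optimal chain down to the grid keeps them ordered and at
  most \<open>s\<close>, and moves each by at most \<open>R / Q\<close>. The chain has a fixed
  finite length, so continuity of \<open>f\<close> carries its sum over to the limit.\<close>

lemma grid_chain_approx:
  fixes R s \<epsilon> :: real
  assumes R: "0 < R" and s: "0 \<le> s" and e: "0 < \<epsilon>"
  shows "\<forall>\<^sub>F Q in sequentially. \<exists>n i. mono_on {1..n} i \<and> i ` {1..n} \<subseteq> {..nat \<lfloor>s * Q / R\<rfloor>} \<and>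
    tv c f s - \<epsilon> < chain_sum c f n (\<lambda>k. real (i k) * (R / Q))"
proof -
  obtain n t where t: "strict_mono_on {1..n} t" "t ` {1..n} \<subseteq> {0..s}" "tv c f s - \<epsilon> < chain_sum c f n t"
    using chain_approx[OF cont c s e] by auto
  define i where "i Q k = nat \<lfloor>t k * real Q / R\<rfloor>" for Q k
  define u where "u Q k = real (i Q k) * (R / Q)" for Q k
  have tk: "0 \<le> t k" "t k \<le> s" if "1 \<le> k" "k \<le> n" for k
    using t(2) that by (auto simp: image_subset_iff)
  have u: "0 \<le> u Q k" "t k - R / Q \<le> u Q k" "u Q k \<le> t k" if k: "1 \<le> k" "k \<le> n" and Q: "1 \<le> Q" for Q k
  proof -
    show "0 \<le> u Q k" using R by (auto simp: u_def)
    have nn: "0 \<le> t k * Q / R" using tk[OF k] R by auto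
    then have "real (i Q k) \<le> t k * Q / R" "t k * Q / R \<le> real (i Q k) + 1"
      unfolding i_def by linarith+
    then have "real (i Q k) * (R / Q) \<le> (t k * Q / R) * (R / Q)"
        "(t k * Q / R) * (R / Q) \<le> (real (i Q k) + 1) * (R / Q)"
      using R by (intro mult_right_mono; simp)+
    moreover have "(t k * Q / R) * (R / Q) = t k" using R Q by simp
    ultimately show "t k - R / Q \<le> u Q k" "u Q k \<le> t k"
      by (auto simp: u_def algebra_simps)
  qed
  have lim: "(\<lambda>Q. f (u Q k)) \<longlonglongrightarrow> f (t k)" if k: "1 \<le> k" "k \<le> n" for k
  proof -
    have "(\<lambda>Q. u Q k) \<longlonglongrightarrow> t k"
    proof (rule tendsto_sandwich)
      show "(\<lambda>Q. t k - R / real Q) \<longlonglongrightarrow> t k" by real_asymp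
      show "\<forall>\<^sub>F Q in sequentially. t k - R / real Q \<le> u Q k" "\<forall>\<^sub>F Q in sequentially. u Q k \<le> t k"
        using eventually_ge_at_top[of 1] by (eventually_elim; use u k in auto)+
    qed auto
    moreover have "\<forall>\<^sub>F Q in sequentially. u Q k \<in> {0..}"
      using eventually_ge_at_top[of 1] by eventually_elim (use u k in auto)
    ultimately show ?thesis
      using continuous_on_tendsto_compose[OF cont] tk[OF k] by auto
  qed
  have "(\<lambda>Q. chain_sum c f n (u Q)) \<longlonglongrightarrow> chain_sum c f n t"
    unfolding chain_sum_def phi_def by (intro tendsto_intros lim) auto
  from order_tendstoD(1)[OF this t(3)] eventually_ge_at_top[of 1] show ?thesis
  proof eventually_elim
    case (elim Q)
    have "mono_on {1..n} (i Q)"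
      using strict_mono_on_leD[OF t(1)] R
      by (auto simp: mono_on_def i_def intro!: nat_mono floor_mono divide_right_mono mult_right_mono)
    moreover have "i Q ` {1..n} \<subseteq> {..nat \<lfloor>s * Q / R\<rfloor>}"
      using tk R by (auto simp: i_def intro!: nat_mono floor_mono divide_right_mono mult_right_mono)
    ultimately show ?case using elim(1) by (intro exI[of _ n] exI[of _ "i Q"]) (simp add: u_def[abs_def])
  qed
qed

lemma tv_le_pushing_pointwise:
  fixes R s \<epsilon> :: real
  assumes R: "0 < R" and s: "0 \<le> s" and e: "0 < \<epsilon>"
  shows "\<forall>\<^sub>F Q in sequentially. tv c f s \<le> pushing c (grid_increment (R / Q) f) (nat \<lfloor>s * Q / R\<rfloor>) + \<epsilon>"
  using grid_chain_approx[OF assms]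
proof eventually_elim
  case (elim Q)
  let ?p = "pushing c (grid_increment (R / Q) f)"
  obtain n i where i: "mono_on {1..n} i" "i ` {1..n} \<subseteq> {..nat \<lfloor>s * Q / R\<rfloor>}"
    "tv c f s - \<epsilon> < chain_sum c f n (\<lambda>k. real (i k) * (R / Q))"
    using elim by blast
  have "chain_sum c f n (\<lambda>k. real (i k) * (R / Q)) \<le> ?p (nat \<lfloor>s * Q / R\<rfloor>)"
  proof (cases "1 \<le> n")
    case True
    have "chain_sum c f n (\<lambda>k. real (i k) * (R / Q)) \<le> ?p (i n)"
      using c True i(1) index_chain_le_pushing[of c "grid_increment (R / Q) f" "\<lambda>j. f (real j * (R / Q))" n i]
      by (simp add: grid_increment_def chain_sum_def)
    also have "\<dots> \<le> ?p (nat \<lfloor>s * Q / R\<rfloor>)" using i(2) True by (intro pushing_mono) (auto simp: image_subset_iff)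
    finally show ?thesis .
  next
    case False
    then show ?thesis by (cases n) (auto simp: pushing_nonneg)
  qed
  then show ?case using i(3) by linarith
qed

text \<open>The mesh needed in the pointwise statement depends on \<open>s\<close>. Uniformity comes
  from a fixed coarse grid of \<open>P\<close> cells: the pointwise bound at its finitely many
  points takes half of \<open>\<epsilon>\<close>, and \<open>tv_step\<close> inside a coarse cell
  takes the other half.\<close>

lemma tv_le_pushing:
  fixes R \<epsilon> :: real
  assumes R: "0 < R" and e: "0 < \<epsilon>"
  shows "\<forall>\<^sub>F Q in sequentially. \<forall>j\<le>Q. tv c f (real j * (R / Q)) \<le> pushing c (grid_increment (R / Q) f) j + \<epsilon>"
proof -
  define \<eta> where "\<eta> = min (\<epsilon> / 2) c"
  have eta: "0 < \<eta>" "\<eta> \<le> c" "\<eta> \<le> \<epsilon> / 2" using e c by (auto simp: \<eta>_def)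
  have "continuous_on {0..R} f" using cont by (rule continuous_on_subset) auto
  from eventually_happens[OF eventually_conj[OF eventually_ge_at_top[of "1::nat"] continuous_grid_modulus[OF this less_imp_le[OF R] eta(1)]]]
  obtain P :: nat where P: "1 \<le> P" "\<And>s t. 0 \<le> s \<Longrightarrow> s \<le> R \<Longrightarrow> 0 \<le> t \<Longrightarrow> t \<le> R \<Longrightarrow>
    \<bar>s - t\<bar> \<le> R / real P \<Longrightarrow> \<bar>f s - f t\<bar> < \<eta>"
    by auto
  have "\<forall>\<^sub>F Q in sequentially. \<forall>i\<in>{..P}. tv c f (real i * (R / P)) \<le> 
      pushing c (grid_increment (R / Q) f) (nat \<lfloor>real i * (R / P) * Q / R\<rfloor>) + \<epsilon> / 2"
    by (intro eventually_ball_finite ballI tv_le_pushing_pointwise) (use R e in auto)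
  with eventually_ge_at_top[of 1] show ?thesis
  proof eventually_elim
    case (elim Q)
    show ?case
    proof (intro allI impI)
      fix j assume j: "j \<le> Q"
      define s where "s = real j * (R / Q)"
      define i where "i = j * P div Q"
      have iP: "i \<le> P" using j elim(1) by (auto simp: i_def div_le_mono intro: order_trans[OF div_le_mono[of "j * P" "Q * P" Q]])
      have "i * Q \<le> j * P" "j * P \<le> i * Q + Q"
        by (auto simp: i_def) (metis add_le_mono1 div_mult_mod_eq elim(1) less_eq_Suc_le mod_less_divisor nat_add_left_cancel_le order_less_imp_le One_nat_def)
      then have r: "real i * Q \<le> real j * P" "real j * P \<le> real i * Q + Q"
        by (metis of_nat_le_iff of_nat_mult, metis of_nat_add of_nat_le_iff of_nat_mult)
      have si: "real i * (R / P) \<le> s" "s - real i * (R / P) \<le> R / P"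
      proof -
        have "real i * (R / P) = (real i * Q) * (R / (P * Q))" "s = (real j * P) * (R / (P * Q))" "R / P = Q * (R / (P * Q))"
          using P(1) elim(1) by (auto simp: s_def field_simps)
        moreover have "(real i * Q) * (R / (P * Q)) \<le> (real j * P) * (R / (P * Q))"
          using r R by (intro mult_right_mono) auto
        moreover have "(real j * P) * (R / (P * Q)) \<le> (real i * Q + Q) * (R / (P * Q))"
          using r R by (intro mult_right_mono) auto
        ultimately show "real i * (R / P) \<le> s" "s - real i * (R / P) \<le> R / P" by (auto simp: algebra_simps)
      qed
      have "s \<le> real Q * (R / Q)" unfolding s_def using j R by (intro mult_right_mono) auto
      then have sR: "s \<le> R" using elim(1) by simp
      have s0: "0 \<le> real i * (R / P)" using R by auto
      have "tv c f s \<le> tv c f (real i * (R / P)) + \<eta>"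
        using si sR s0 eta by (intro tv_step[OF cont c] less_imp_le[OF P(2)]) auto
      moreover have "real i * (R / P) * Q / R \<le> real j" using r R P(1) by (auto simp: field_simps)
      then have "nat \<lfloor>real i * (R / P) * Q / R\<rfloor> \<le> j"
        by (metis floor_mono floor_of_nat nat_int nat_mono)
      then have "pushing c (grid_increment (R / Q) f) (nat \<lfloor>real i * (R / P) * Q / R\<rfloor>) 
          \<le> pushing c (grid_increment (R / Q) f) j"
        by (rule pushing_mono)
      moreover have "tv c f (real i * (R / P)) \<le> pushing c (grid_increment (R / Q) f) (nat \<lfloor>real i * (R / P) * Q / R\<rfloor>) + \<epsilon> / 2"
        using elim(2) iP by auto
      ultimately show "tv c f (real j * (R / Q)) \<le> pushing c (grid_increment (R / Q) f) j + \<epsilon>"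
        using eta by (simp add: s_def)
    qed
  qed
qed

end

section \<open>A discrete Ito formula for the reflected chain\<close>

text \<open>\<open>F 0\<close> solves the Poisson equation with Neumann boundary conditions, and \<open>F i\<close> is its \<open>i\<close>-th
  derivative. The margin \<open>1\<close> around \<open>[0, c]\<close> leaves room for one step of the walk before it is
  reflected.\<close>

definition corrector :: "real \<Rightarrow> real \<Rightarrow> real \<Rightarrow> (real \<Rightarrow> real) \<Rightarrow> (nat \<Rightarrow> real \<Rightarrow> real) \<Rightarrow> real \<Rightarrow> bool" where
  "corrector c \<mu> \<kappa> q F C \<longleftrightarrow>
    (\<forall>i\<le>2. \<forall>x. (F i has_real_derivative F (Suc i) x) (at x)) \<and>
    (\<forall>i\<le>3. \<forall>x\<in>{-1..c+1}. \<bar>F i x\<bar> \<le> C) \<and>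
    F 1 c = \<kappa> \<and> F 1 0 = - \<kappa> \<and>
    (\<forall>x\<in>{0..c}. \<mu> * F 1 x + F 2 x / 2 = q x)"

lemma correctorI:
  assumes "\<And>x. (F 0 has_real_derivative F 1 x) (at x)" "\<And>x. (F 1 has_real_derivative F 2 x) (at x)"
    "\<And>x. (F 2 has_real_derivative F 3 x) (at x)" "continuous_on UNIV (F 3)"
    "F 1 c = \<kappa>" "F 1 0 = - \<kappa>" "\<And>x. \<mu> * F 1 x + F 2 x / 2 = q x"
  shows "\<exists>C. corrector c \<mu> \<kappa> q F C"
proof -
  have d: "(F i has_real_derivative F (Suc i) x) (at x)" if "i \<le> 2" for i x
  proof -
    have "i = 0 \<or> i = 1 \<or> i = 2" using that by auto
    then show ?thesis using assms(1,2,3) by (auto simp: numeral_2_eq_2 numeral_3_eq_3)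
  qed
  have cont: "continuous_on {-1..c+1} (F i)" if "i \<le> 3" for i
  proof (cases "i = 3")
    case True then show ?thesis using assms(4) continuous_on_subset by blast
  next
    case False
    then show ?thesis using d[of i] that
      by (intro continuous_at_imp_continuous_on ballI DERIV_isCont) auto
  qed
  have "\<exists>B. \<forall>x\<in>{-1..c+1}. \<bar>F i x\<bar> \<le> B" if "i \<le> 3" for i
    using compact_imp_bounded[OF compact_continuous_image[OF cont[OF that]]]
    by (auto simp: bounded_iff)
  then obtain B where B: "\<And>i x. i \<le> 3 \<Longrightarrow> x \<in> {-1..c+1} \<Longrightarrow> \<bar>F i x\<bar> \<le> B i" by metis
  have "\<bar>F i x\<bar> \<le> Max (B ` {..3})" if "i \<le> 3" "x \<in> {-1..c+1}" for i x
    using B[OF that] that by (intro order_trans[OF B[OF that]] Max_ge) auto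
  then show ?thesis unfolding corrector_def using d assms by blast
qed

lemma corrector_deriv: "corrector c \<mu> \<kappa> q F C \<Longrightarrow> i \<le> 2 \<Longrightarrow> (F i has_real_derivative F (Suc i) x) (at x)"
  by (simp add: corrector_def)

lemma corrector_bound: "corrector c \<mu> \<kappa> q F C \<Longrightarrow> i \<le> 3 \<Longrightarrow> -1 \<le> x \<Longrightarrow> x \<le> c + 1 \<Longrightarrow> \<bar>F i x\<bar> \<le> C"
  by (simp add: corrector_def)

lemma corrector_nonneg:
  assumes "corrector c \<mu> \<kappa> q F C" "0 \<le> c"
  shows "0 \<le> C"
proof -
  have "\<bar>F 0 0\<bar> \<le> C" using corrector_bound[OF assms(1), of 0 0] assms(2) by simp
  then show ?thesis by linarith
qed

lemma corrector_measurable: "corrector c \<mu> \<kappa> q F C \<Longrightarrow> i \<le> 2 \<Longrightarrow> F i \<in> borel_measurable borel"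
  by (intro borel_measurable_continuous_onI continuous_at_imp_continuous_on ballI) (rule DERIV_isCont[OF corrector_deriv])

lemma corrector_taylor2:
  assumes F: "corrector c \<mu> \<kappa> q F C" and x: "x \<in> {-1..c+1}" and y: "y \<in> {-1..c+1}"
  shows "\<bar>F 0 y - F 0 x - F 1 x * (y - x)\<bar> \<le> C * (y - x)\<^sup>2"
proof -
  have "norm (F 0 y - (\<Sum>i\<le>1. F i x * (y - x) ^ i / fact i)) \<le> C * norm (y - x) ^ Suc 1 / fact 1"
  proof (rule field_Taylor[of "{-1..c+1}"])
    fix i t assume "t \<in> {-1..c+1}" "i \<le> (1::nat)"
    then show "(F i has_field_derivative F (Suc i) t) (at t within {-1..c+1})"
      using corrector_deriv[OF F, of i t] by (auto intro: has_field_derivative_at_within)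
  next
    fix t assume "t \<in> {-1..c+1}"
    then show "norm (F (Suc 1) t) \<le> C" using corrector_bound[OF F, of "Suc 1" t] by simp
  qed (use x y in auto)
  then show ?thesis by (simp add: power2_eq_square abs_mult)
qed

lemma corrector_taylor3:
  assumes F: "corrector c \<mu> \<kappa> q F C" and x: "x \<in> {-1..c+1}" and y: "y \<in> {-1..c+1}"
  shows "\<bar>F 0 y - F 0 x - F 1 x * (y - x) - F 2 x * (y - x)\<^sup>2 / 2\<bar> \<le> C * \<bar>y - x\<bar> ^ 3"
proof -
  have C: "0 \<le> C" using corrector_bound[OF F, of 0 x] x by auto
  have "norm (F 0 y - (\<Sum>i\<le>2. F i x * (y - x) ^ i / fact i)) \<le> C * norm (y - x) ^ Suc 2 / fact 2"
  proof (rule field_Taylor[of "{-1..c+1}"])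
    fix i t assume "t \<in> {-1..c+1}" "i \<le> (2::nat)"
    then show "(F i has_field_derivative F (Suc i) t) (at t within {-1..c+1})"
      using corrector_deriv[OF F, of i t] by (auto intro: has_field_derivative_at_within)
  next
    fix t assume "t \<in> {-1..c+1}"
    then show "norm (F (Suc 2) t) \<le> C" using corrector_bound[OF F, of "Suc 2" t] by simp
  qed (use x y in auto)
  also have "C * norm (y - x) ^ Suc 2 / fact 2 = C * \<bar>y - x\<bar> ^ 3 / 2" by (simp add: eval_nat_numeral)
  also have "\<dots> \<le> C * \<bar>y - x\<bar> ^ 3" using mult_nonneg_nonneg[OF C, of "\<bar>y - x\<bar> ^ 3"] by simp
  finally show ?thesis by (simp add: numeral_2_eq_2 algebra_simps)
qed

text \<open>Each step is split at the unreflected position: a Taylor expansion of second order leads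
  there from the old state, one of first order connects it with the reflected state. In the latter
  the linear term is \<open>\<kappa>\<close> times the absolute overshoot by the Neumann values, and
  the remainder is at most \<open>C * \<eta>\<close> times it, because an overshoot never exceeds
  the step. The values of \<open>F 0\<close> telescope.\<close>

lemma discrete_ito:
  assumes F: "corrector c \<mu> \<kappa> q F C" and c: "0 < c" and eta: "\<eta> \<le> 1"
    and e: "\<And>j. j < N \<Longrightarrow> \<bar>e j\<bar> \<le> \<eta>"
  shows "\<bar>\<kappa> * pushing c e N - (\<Sum>j<N. F 1 (refl_chain c e j) * e j + F 2 (refl_chain c e j) * (e j)\<^sup>2 / 2)
     - (F 0 (refl_chain c e 0) - F 0 (refl_chain c e N))\<bar>
    \<le> C * (\<Sum>j<N. \<bar>e j\<bar> ^ 3) + C * \<eta> * pushing c e N"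
  using e
proof (induction N)
  case 0
  then show ?case by (simp add: pushing_def)
next
  case (Suc N)
  let ?z = "refl_chain c e" and ?o = "overshoot c e N"
  have C: "0 \<le> C" using corrector_nonneg[OF F] c by simp
  have z: "0 \<le> ?z N" "?z N \<le> c" "0 \<le> ?z (Suc N)" "?z (Suc N) \<le> c"
    using refl_chain_bounds[of c e N] refl_chain_bounds[of c e "Suc N"] c by auto
  have eN: "\<bar>e N\<bar> \<le> \<eta>" using Suc.prems by simp
  have y: "?z N + e N \<in> {-1..c+1}" using z eN eta by auto
  have oy: "?z N + e N - ?z (Suc N) = ?o" by (simp add: overshoot_def)
  have 1: "\<bar>F 0 (?z N + e N) - F 0 (?z N) - F 1 (?z N) * e N - F 2 (?z N) * (e N)\<^sup>2 / 2\<bar> \<le> C * \<bar>e N\<bar> ^ 3"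
    using corrector_taylor3[OF F _ y, of "?z N"] z by simp
  have "\<bar>F 0 (?z N + e N) - F 0 (?z (Suc N)) - F 1 (?z (Suc N)) * ?o\<bar> \<le> C * ?o\<^sup>2"
    using corrector_taylor2[OF F _ y, of "?z (Suc N)"] z unfolding oy by (simp del: refl_chain.simps)
  moreover have "F 1 (?z (Suc N)) * ?o = \<kappa> * \<bar>?o\<bar>"
  proof -
    have "?o = 0 \<or> (?o > 0 \<and> ?z (Suc N) = c) \<or> (?o < 0 \<and> ?z (Suc N) = 0)"
      using z by (auto simp: overshoot_def max_def min_def split: if_splits)
    then show ?thesis using F by (auto simp: corrector_def)
  qed
  moreover have "C * ?o\<^sup>2 \<le> C * \<eta> * \<bar>?o\<bar>"
  proof -
    have "\<bar>?o\<bar> * \<bar>?o\<bar> \<le> \<eta> * \<bar>?o\<bar>" using overshoot_le[of c e N] c eN by (intro mult_right_mono) auto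
    then show ?thesis using C by (simp add: power2_eq_square mult.assoc mult_left_mono)
  qed
  ultimately have 2: "\<bar>F 0 (?z N + e N) - F 0 (?z (Suc N)) - \<kappa> * \<bar>?o\<bar>\<bar> \<le> C * \<eta> * \<bar>?o\<bar>" by linarith
  have IH: "\<bar>\<kappa> * pushing c e N - (\<Sum>j<N. F 1 (?z j) * e j + F 2 (?z j) * (e j)\<^sup>2 / 2)
     - (F 0 (?z 0) - F 0 (?z N))\<bar> \<le> C * (\<Sum>j<N. \<bar>e j\<bar> ^ 3) + C * \<eta> * pushing c e N"
    using Suc by simp
  show ?case
    unfolding pushing_Suc sum.lessThan_Suc distrib_left using IH 1 2 by linarith
qed

text \<open>For \<open>e = \<mu>\<delta> + \<surd>\<delta> x\<close> the second-order term is \<open>\<delta>\<close> up to the martingale increment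
  \<open>\<delta> (x\<^sup>2 - 1)\<close> and terms of order \<open>\<delta> powr (3/2)\<close>.\<close>

lemma discrete_ito_normal:
  assumes F: "corrector c \<mu> \<kappa> q F C" and c: "0 < c" and eta: "\<eta> \<le> 1"
    and d: "0 < \<delta>" "\<delta> \<le> 1" and NQ: "N \<le> Q"
    and e: "\<And>j. e j = \<mu> * \<delta> + sqrt \<delta> * x j" and small: "\<And>j. j < Q \<Longrightarrow> \<bar>e j\<bar> \<le> \<eta>"
  shows "\<bar>\<kappa> * pushing c e N - \<delta> * (\<Sum>j<N. q (refl_chain c e j)) - (\<Sum>j<N. sqrt \<delta> * F 1 (refl_chain c e j) * x j)
      - (\<Sum>j<N. \<delta> / 2 * F 2 (refl_chain c e j) * ((x j)\<^sup>2 - 1))\<bar>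
    \<le> 2 * C + C * (4 * \<bar>\<mu>\<bar> ^ 3 + 4 + \<bar>\<mu>\<bar> + \<mu>\<^sup>2) * (\<Sum>j<Q. \<delta> * sqrt \<delta> * (1 + \<bar>x j\<bar> ^ 3)) + C * \<eta> * pushing c e N"
proof -
  let ?z = "refl_chain c e"
  define s where "s = sqrt \<delta>"
  have s: "0 < s" "s \<le> 1" "s * s = \<delta>" using d by (auto simp: s_def)
  have C: "0 \<le> C" using corrector_nonneg[OF F] c by simp
  have z: "0 \<le> ?z j" "?z j \<le> c" for j using refl_chain_bounds[of c e j] c by auto
  \<comment> \<open>The first two summands bound the cubic Ito remainder through
    \<open>(a + b) ^ 3 \<le> 4 * (a ^ 3 + b ^ 3)\<close>; the last two bound the cross term and the
    squared drift contained in \<open>(e j)\<^sup>2\<close>.\<close>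
  define D where "D = 4 * \<bar>\<mu>\<bar> ^ 3 + 4 + \<bar>\<mu>\<bar> + \<mu>\<^sup>2"
  have I: "\<bar>\<kappa> * pushing c e N - (\<Sum>j<N. F 1 (?z j) * e j + F 2 (?z j) * (e j)\<^sup>2 / 2)
     - (F 0 (?z 0) - F 0 (?z N))\<bar> \<le> C * (\<Sum>j<N. \<bar>e j\<bar> ^ 3) + C * \<eta> * pushing c e N"
    using discrete_ito[OF F c eta, of N e] small NQ by simp
  have F0: "\<bar>F 0 (?z 0) - F 0 (?z N)\<bar> \<le> 2 * C"
    using corrector_bound[OF F, of 0 "?z 0"] corrector_bound[OF F, of 0 "?z N"] z[of 0] z[of N] by linarith
  have expand: "F 1 (?z j) * e j + F 2 (?z j) * (e j)\<^sup>2 / 2 =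
      \<delta> * q (?z j) + sqrt \<delta> * F 1 (?z j) * x j + \<delta> / 2 * F 2 (?z j) * ((x j)\<^sup>2 - 1)
      + F 2 (?z j) * (\<mu> * \<delta> * s * x j + \<mu>\<^sup>2 * \<delta>\<^sup>2 / 2)" for j
  proof -
    have "q (?z j) = \<mu> * F 1 (?z j) + F 2 (?z j) / 2" using F z[of j] by (simp add: corrector_def)
    moreover have ej: "e j = \<mu> * \<delta> + s * x j" by (simp add: e s_def)
    have "(e j)\<^sup>2 = \<mu>\<^sup>2 * \<delta>\<^sup>2 + 2 * (\<mu> * \<delta> * s * x j) + (s * s) * (x j)\<^sup>2"
      unfolding ej by (simp add: power2_eq_square algebra_simps)
    then have "(e j)\<^sup>2 = \<mu>\<^sup>2 * \<delta>\<^sup>2 + 2 * (\<mu> * \<delta> * s * x j) + \<delta> * (x j)\<^sup>2"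
      unfolding s(3) .
    ultimately show ?thesis unfolding s_def[symmetric] by (simp add: ej field_simps)
  qed
  define r where "r j = F 2 (?z j) * (\<mu> * \<delta> * s * x j + \<mu>\<^sup>2 * \<delta>\<^sup>2 / 2)" for j
  have x1: "\<bar>x j\<bar> \<le> 1 + \<bar>x j\<bar> ^ 3" for j
  proof (cases "\<bar>x j\<bar> \<le> 1")
    case False
    then have "\<bar>x j\<bar> ^ 1 \<le> \<bar>x j\<bar> ^ 3" by (intro power_increasing) auto
    then show ?thesis by simp
  qed (auto intro: order_trans)
  have re: "\<bar>r j\<bar> + C * \<bar>e j\<bar> ^ 3 \<le> C * D * (\<delta> * s * (1 + \<bar>x j\<bar> ^ 3))" for j
  proof -
    have ds: "\<delta>\<^sup>2 \<le> \<delta> * s" "\<delta> ^ 3 \<le> \<delta> * s"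
    proof -
      have "s ^ 4 \<le> s ^ 3" "s ^ 6 \<le> s ^ 3" using s by (auto intro!: power_decreasing)
      moreover have "\<delta>\<^sup>2 = s ^ 4" "\<delta> ^ 3 = s ^ 6" "\<delta> * s = s ^ 3"
        by (simp_all add: eval_nat_numeral flip: s(3))
      ultimately show "\<delta>\<^sup>2 \<le> \<delta> * s" "\<delta> ^ 3 \<le> \<delta> * s" by simp_all
    qed
    have ds0: "0 \<le> \<delta> * s" using s d by simp
    have "\<bar>\<mu> * \<delta> * s * x j + \<mu>\<^sup>2 * \<delta>\<^sup>2 / 2\<bar> \<le> \<bar>\<mu>\<bar> * (\<delta> * s) * \<bar>x j\<bar> + \<mu>\<^sup>2 * \<delta>\<^sup>2"
      using s d by (intro order_trans[OF abs_triangle_ineq]) (auto simp: abs_mult)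
    also have "\<dots> \<le> \<bar>\<mu>\<bar> * (\<delta> * s) * (1 + \<bar>x j\<bar> ^ 3) + \<mu>\<^sup>2 * ((\<delta> * s) * (1 + \<bar>x j\<bar> ^ 3))"
    proof (intro add_mono mult_left_mono x1)
      have "(\<delta> * s) * 1 \<le> (\<delta> * s) * (1 + \<bar>x j\<bar> ^ 3)" by (intro mult_left_mono ds0) auto
      then show "\<delta>\<^sup>2 \<le> (\<delta> * s) * (1 + \<bar>x j\<bar> ^ 3)" using ds by simp
    qed (use ds0 in auto)
    also have "\<dots> = (\<bar>\<mu>\<bar> + \<mu>\<^sup>2) * (\<delta> * s * (1 + \<bar>x j\<bar> ^ 3))" by (simp add: algebra_simps)
    finally have 1: "\<bar>\<mu> * \<delta> * s * x j + \<mu>\<^sup>2 * \<delta>\<^sup>2 / 2\<bar> \<le> (\<bar>\<mu>\<bar> + \<mu>\<^sup>2) * (\<delta> * s * (1 + \<bar>x j\<bar> ^ 3))" .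
    have r1: "\<bar>r j\<bar> \<le> C * ((\<bar>\<mu>\<bar> + \<mu>\<^sup>2) * (\<delta> * s * (1 + \<bar>x j\<bar> ^ 3)))"
      unfolding r_def abs_mult[of "F 2 _"] using corrector_bound[OF F, of 2 "?z j"] z[of j] C
      by (intro mult_mono 1) auto
    have "\<bar>e j\<bar> ^ 3 \<le> 4 * ((\<bar>\<mu>\<bar> * \<delta>) ^ 3 + (s * \<bar>x j\<bar>) ^ 3)"
    proof -
      have "\<bar>e j\<bar> \<le> \<bar>\<mu>\<bar> * \<delta> + s * \<bar>x j\<bar>"
        using s d unfolding e s_def[symmetric] by (intro order_trans[OF abs_triangle_ineq]) (auto simp: abs_mult)
      then have "\<bar>e j\<bar> ^ 3 \<le> (\<bar>\<mu>\<bar> * \<delta> + s * \<bar>x j\<bar>) ^ 3" by (intro power_mono) auto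
      also have "\<dots> \<le> 4 * ((\<bar>\<mu>\<bar> * \<delta>) ^ 3 + (s * \<bar>x j\<bar>) ^ 3)"
      proof -
        have *: "(a + b) ^ 3 \<le> 4 * (a ^ 3 + b ^ 3)" if "0 \<le> a" "0 \<le> b" for a b :: real
        proof -
          have "4 * (a ^ 3 + b ^ 3) - (a + b) ^ 3 = 3 * ((a + b) * (a - b)\<^sup>2)"
            by (simp add: power2_eq_square power3_eq_cube algebra_simps)
          moreover have "0 \<le> (a + b) * (a - b)\<^sup>2" using that by simp
          ultimately show ?thesis by linarith
        qed
        show ?thesis using s d by (intro *) auto
      qed
      finally show ?thesis .
    qed
    then have "\<bar>e j\<bar> ^ 3 \<le> 4 * \<bar>\<mu>\<bar> ^ 3 * \<delta> ^ 3 + 4 * (\<delta> * s * \<bar>x j\<bar> ^ 3)"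
      by (simp add: power_mult_distrib algebra_simps flip: s(3)) (simp add: power3_eq_cube algebra_simps)
    also have "\<dots> \<le> 4 * \<bar>\<mu>\<bar> ^ 3 * ((\<delta> * s) * (1 + \<bar>x j\<bar> ^ 3)) + 4 * ((\<delta> * s) * (1 + \<bar>x j\<bar> ^ 3))"
    proof (intro add_mono mult_left_mono)
      have "(\<delta> * s) * 1 \<le> (\<delta> * s) * (1 + \<bar>x j\<bar> ^ 3)" by (intro mult_left_mono ds0) auto
      then show "\<delta> ^ 3 \<le> (\<delta> * s) * (1 + \<bar>x j\<bar> ^ 3)" using ds by simp
    qed (use s d in auto)
    finally have "C * \<bar>e j\<bar> ^ 3 \<le> C * (4 * \<bar>\<mu>\<bar> ^ 3 * ((\<delta> * s) * (1 + \<bar>x j\<bar> ^ 3)) + 4 * ((\<delta> * s) * (1 + \<bar>x j\<bar> ^ 3)))"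
      using C by (intro mult_left_mono)
    with r1 show ?thesis by (simp add: D_def algebra_simps)
  qed
  have "\<bar>\<Sum>j<N. r j\<bar> + C * (\<Sum>j<N. \<bar>e j\<bar> ^ 3) \<le> (\<Sum>j<N. \<bar>r j\<bar> + C * \<bar>e j\<bar> ^ 3)"
    using sum_abs[of r "{..<N}"] by (simp add: sum.distrib sum_distrib_left)
  also have "\<dots> \<le> (\<Sum>j<N. C * D * (\<delta> * s * (1 + \<bar>x j\<bar> ^ 3)))" by (intro sum_mono re)
  also have "\<dots> \<le> (\<Sum>j<Q. C * D * (\<delta> * s * (1 + \<bar>x j\<bar> ^ 3)))"
    using NQ C s d by (intro sum_mono2) (auto simp: D_def)
  also have "\<dots> = C * D * (\<Sum>j<Q. \<delta> * sqrt \<delta> * (1 + \<bar>x j\<bar> ^ 3))" by (simp add: sum_distrib_left s_def)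
  finally have R: "\<bar>\<Sum>j<N. r j\<bar> + C * (\<Sum>j<N. \<bar>e j\<bar> ^ 3) \<le> C * D * (\<Sum>j<Q. \<delta> * sqrt \<delta> * (1 + \<bar>x j\<bar> ^ 3))" .
  have "(\<Sum>j<N. F 1 (?z j) * e j + F 2 (?z j) * (e j)\<^sup>2 / 2) =
      \<delta> * (\<Sum>j<N. q (?z j)) + (\<Sum>j<N. sqrt \<delta> * F 1 (?z j) * x j)
      + (\<Sum>j<N. \<delta> / 2 * F 2 (?z j) * ((x j)\<^sup>2 - 1)) + (\<Sum>j<N. r j)"
    unfolding expand r_def[symmetric] sum.distrib by (simp add: sum_distrib_left)
  with I F0 R show ?thesis unfolding D_def[symmetric] by linarith
qed

section \<open>The correctors\<close>

lemma exp_double_sinh: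
  fixes a :: real
  shows "1 - exp (- 2 * a) = 2 * exp (- a) * sinh a" "1 + exp (- 2 * a) = 2 * exp (- a) * cosh a"
proof -
  have "exp (- a) * exp a = 1" "exp (- a) * exp (- a) = exp (- 2 * a)" by (simp_all flip: exp_add)
  then show "1 - exp (- 2 * a) = 2 * exp (- a) * sinh a" "1 + exp (- 2 * a) = 2 * exp (- a) * cosh a"
    by (simp_all add: sinh_field_def cosh_field_def algebra_simps)
qed

text \<open>With \<open>a = c * \<mu>\<close> the quantity is even in \<open>a\<close>, and for
  \<open>a > 0\<close> it equals \<open>k a / sinh a ^ 3\<close>. The numerator \<open>k\<close>
  vanishes at \<open>0\<close> and has derivative
  \<open>sinh x * (3 * sinh x * cosh x - 2 * x)\<close>, which is positive because
  \<open>sinh x > x\<close>.\<close>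

lemma sigma_sq_pos:
  assumes c: "0 < c"
  shows "0 < sigma_sq c \<mu>"
proof (cases "\<mu> = 0")
  case True then show ?thesis by (simp add: sigma_sq_def)
next
  case False
  define k :: "real \<Rightarrow> real" where "k a = sinh a ^ 3 + 2 * sinh a - 2 * a * cosh a" for a
  have pos: "0 < k a" if a: "0 < a" for a
  proof -
    have "k 0 < k a"
    proof (rule DERIV_pos_imp_increasing_open[OF a])
      fix x :: real assume x: "0 < x" "x < a"
      have D: "(k has_real_derivative sinh x * (3 * sinh x * cosh x - 2 * x)) (at x)"
        unfolding k_def by (rule derivative_eq_intros refl | simp add: power2_eq_square algebra_simps)+
      have "sinh 0 - 0 < sinh x - x"
      proof (rule DERIV_pos_imp_increasing_open[OF x(1)])
        fix y :: real assume y: "0 < y" "y < x"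
        have "((\<lambda>y. sinh y - y) has_real_derivative cosh y - 1) (at y)" by (rule derivative_eq_intros refl | simp)+
        moreover have "1 < cosh y" using y cosh_real_strict_mono[of 0 y] by simp
        ultimately show "\<exists>z. ((\<lambda>y. sinh y - y) has_real_derivative z) (at y) \<and> 0 < z" by (intro exI conjI) auto
      qed (intro continuous_intros)
      then have s: "x < sinh x" by simp
      have "3 * sinh x * 1 \<le> 3 * sinh x * cosh x"
        using s x cosh_real_ge_1[of x] by (intro mult_left_mono) auto
      then have "0 < 3 * sinh x * cosh x - 2 * x" using s x by linarith
      then have "0 < sinh x * (3 * sinh x * cosh x - 2 * x)" using s x by (intro mult_pos_pos) auto
      with D show "\<exists>z. (k has_real_derivative z) (at x) \<and> 0 < z" by blast
    next
      show "continuous_on {0..a} k" unfolding k_def by (intro continuous_intros)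
    qed
    then show ?thesis by (simp add: k_def)
  qed
  have *: "0 < (2 - 2 * a * coth a) / (sinh a)\<^sup>2 + 1" if "0 < a" for a
  proof -
    have s: "0 < sinh a" using that by simp
    have "(2 - 2 * a * coth a) / (sinh a)\<^sup>2 + 1 = k a / sinh a ^ 3"
      using s by (simp add: coth_def k_def divide_simps power2_eq_square power3_eq_cube algebra_simps)
    then show ?thesis using s pos[OF that] by simp
  qed
  show ?thesis
  proof (cases "0 < c * \<mu>")
    case True
    then show ?thesis using False *[of "c * \<mu>"] by (simp add: sigma_sq_def mult.assoc)
  next
    case neg: False
    then have "0 < - (c * \<mu>)" using False c by (simp add: not_less mult_le_0_iff) (simp add: mult_pos_neg)
    from *[OF this] show ?thesis using False by (simp add: sigma_sq_def coth_def mult.assoc)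
  qed
qed

text \<open>\<open>F 1\<close> is the solution \<open>p\<close>, and it stays in
  \<open>[-1, 1]\<close> because it runs monotonically from \<open>-1\<close> to \<open>1\<close>.
  \<open>G\<close> exists because \<open>(F 1)\<^sup>2 - sigma_sq c \<mu>\<close> has integral zero
  over \<open>[0, c]\<close> against the weight \<open>exp (2 * \<mu> * x)\<close>.\<close>

lemma correctors_exist:
  assumes c: "0 < c"
  obtains F G C where "corrector c \<mu> 1 (\<lambda>_. m_const c \<mu>) F C"
    "corrector c \<mu> 0 (\<lambda>x. (F 1 x)\<^sup>2 - sigma_sq c \<mu>) G C"
    "\<And>x. 0 \<le> x \<Longrightarrow> x \<le> c \<Longrightarrow> \<bar>F 1 x\<bar> \<le> 1"
proof -
  have "\<exists>F G C1 C2. corrector c \<mu> 1 (\<lambda>_. m_const c \<mu>) F C1 \<and>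
    corrector c \<mu> 0 (\<lambda>x. (F 1 x)\<^sup>2 - sigma_sq c \<mu>) G C2 \<and> (\<forall>x. 0 \<le> x \<longrightarrow> x \<le> c \<longrightarrow> \<bar>F 1 x\<bar> \<le> 1)"
  proof (cases "\<mu> = 0")
    case True
    define F :: "nat \<Rightarrow> real \<Rightarrow> real" where
      "F = (\<lambda>_ _. 0)(0 := \<lambda>x. - x + x\<^sup>2 / c, 1 := \<lambda>x. - 1 + 2 * x / c, 2 := \<lambda>x. 2 / c)"
    \<comment> \<open>Without drift \<open>G 1\<close> is twice the primitive of
      \<open>(F 1)\<^sup>2 - 1 / 3\<close> that vanishes at \<open>0\<close>; it vanishes at
      \<open>c\<close> because \<open>1 / 3\<close> is the mean of
      \<open>(F 1)\<^sup>2\<close>.\<close>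
    define G :: "nat \<Rightarrow> real \<Rightarrow> real" where
      "G = (\<lambda>_ _. 0)(0 := \<lambda>x. 2 * x\<^sup>2 / 3 - 4 * x ^ 3 / (3 * c) + 2 * x ^ 4 / (3 * c\<^sup>2),
         1 := \<lambda>x. 4 * x / 3 - 4 * x\<^sup>2 / c + 8 * x ^ 3 / (3 * c\<^sup>2),
         2 := \<lambda>x. 4 / 3 - 8 * x / c + 8 * x\<^sup>2 / c\<^sup>2, 3 := \<lambda>x. - 8 / c + 16 * x / c\<^sup>2)"
    have "\<exists>C1. corrector c \<mu> 1 (\<lambda>_. m_const c \<mu>) F C1"
      by (rule correctorI) (use c True in \<open>auto simp: F_def m_const_def field_simps intro!: derivative_eq_intros continuous_intros\<close>)
    moreover have "\<exists>C2. corrector c \<mu> 0 (\<lambda>x. (F 1 x)\<^sup>2 - sigma_sq c \<mu>) G C2"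
      by (rule correctorI) (use c True in \<open>auto simp: F_def G_def sigma_sq_def field_simps power2_eq_square eval_nat_numeral intro!: derivative_eq_intros continuous_intros\<close>)
    moreover have "\<bar>F 1 x\<bar> \<le> 1" if "0 \<le> x" "x \<le> c" for x
      using that c by (auto simp: F_def abs_le_iff field_simps)
    ultimately show ?thesis by blast
  next
    case mu: False
    \<comment> \<open>\<open>y\<close> solves the homogeneous equation
      \<open>\<mu> * p + p' / 2 = 0\<close>, so \<open>p = P + A * y\<close>, with the constants
      fixed by the values \<open>-1\<close> and \<open>1\<close> at the two ends;
      \<open>P = coth (c * \<mu>)\<close> is how the hyperbolic cotangent enters.\<close>
    define y where "y x = exp (- 2 * \<mu> * x)" for x
    define D where "D = 1 - y c"
    define a where "a = c * \<mu>"
    have a: "a \<noteq> 0" "sinh a \<noteq> 0" using mu c by (auto simp: a_def)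
    have yc: "y c = exp (- 2 * a)" by (simp add: y_def a_def mult.commute mult.left_commute)
    have D: "D = 2 * exp (- a) * sinh a" "2 - D = 2 * exp (- a) * cosh a"
      using exp_double_sinh[of a] by (simp_all add: D_def yc)
    have D0: "D \<noteq> 0" using a by (simp add: D(1))
    have dy: "(y has_real_derivative - 2 * \<mu> * y x) (at x)" for x
      unfolding y_def by (auto intro!: derivative_eq_intros)
    note [derivative_intros] = DERIV_chain2[OF dy]
    have y0: "y 0 = 1" by (simp add: y_def)
    define P where "P = - 1 + 2 / D"
    define A where "A = - 2 / D"
    define F :: "nat \<Rightarrow> real \<Rightarrow> real" where
      "F = (\<lambda>_ _. 0)(0 := \<lambda>x. P * x - A * y x / (2 * \<mu>), 1 := \<lambda>x. P + A * y x,
          2 := \<lambda>x. - 2 * \<mu> * A * y x, 3 := \<lambda>x. 4 * \<mu>\<^sup>2 * A * y x)"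
    have F1: "F 1 x = P + A * y x" "F (Suc 0) x = P + A * y x" for x by (simp_all add: F_def)
    have "P = (2 - D) / D" using D0 by (simp add: P_def divide_simps)
    then have P: "P = coth a" unfolding D(2) by (simp add: D(1) coth_def)
    have PA: "P + A = - 1" "P + A * y c = 1"
      using D0 by (simp_all add: P_def A_def D_def divide_simps)
    have cy: "continuous_on UNIV y" unfolding y_def by (intro continuous_intros)
    \<comment> \<open>Undetermined coefficients for the right-hand side
      \<open>(P + A * y)\<^sup>2 - sigma_sq c \<mu>\<close>. The mixed term is resonant with the
      homogeneous solution \<open>y\<close>, which forces the ansatz \<open>x * y\<close>;
      \<open>\<kappa>\<close> is chosen for \<open>G 1 0 = 0\<close>. \<open>G 2\<close> is defined
      by the equation itself, so what remains to be checked is that it is the derivative of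
      \<open>G 1\<close>.\<close>
    define \<alpha> where "\<alpha> = (P\<^sup>2 - sigma_sq c \<mu>) / \<mu>"
    define \<beta> where "\<beta> = 4 * P * A"
    define \<gamma> where "\<gamma> = - A\<^sup>2 / \<mu>"
    define \<kappa> where "\<kappa> = - \<alpha> - \<gamma>"
    define G :: "nat \<Rightarrow> real \<Rightarrow> real" where
      "G = (\<lambda>_ _. 0)
        (0 := \<lambda>x. \<alpha> * x - \<beta> * (x / (2 * \<mu>) + 1 / (4 * \<mu>\<^sup>2)) * y x - \<gamma> / (4 * \<mu>) * (y x)\<^sup>2 - \<kappa> / (2 * \<mu>) * y x,
         1 := \<lambda>x. \<alpha> + \<beta> * x * y x + \<gamma> * (y x)\<^sup>2 + \<kappa> * y x,
         2 := \<lambda>x. 2 * ((F 1 x)\<^sup>2 - sigma_sq c \<mu>) - 2 * \<mu> * (\<alpha> + \<beta> * x * y x + \<gamma> * (y x)\<^sup>2 + \<kappa> * y x),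
         3 := \<lambda>x. 4 * F 1 x * F 2 x - 2 * \<mu> * (2 * ((F 1 x)\<^sup>2 - sigma_sq c \<mu>) - 2 * \<mu> * (\<alpha> + \<beta> * x * y x + \<gamma> * (y x)\<^sup>2 + \<kappa> * y x)))"
    \<comment> \<open>This form of \<open>sigma_sq\<close> is exactly the condition for
      \<open>G 1 c = 0\<close>.\<close>
    have sig: "sigma_sq c \<mu> = P\<^sup>2 + A\<^sup>2 * y c + 4 * a * P * A * y c / D"
    proof -
      have "exp (- a) * exp (- a) = y c" unfolding yc by (simp flip: exp_add)
      then have "D\<^sup>2 = 4 * y c * (sinh a)\<^sup>2" by (simp add: D(1) power2_eq_square algebra_simps)
      then have q: "y c / D\<^sup>2 = 1 / (4 * (sinh a)\<^sup>2)" using a by (simp add: y_def divide_simps)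
      have "A\<^sup>2 * y c = 4 * (y c / D\<^sup>2)" "4 * a * P * A * y c / D = - 8 * a * P * (y c / D\<^sup>2)"
        by (simp_all add: A_def power2_eq_square)
      moreover have "P\<^sup>2 = 1 + 1 / (sinh a)\<^sup>2"
        using a cosh_square_eq[of a] by (simp add: P coth_def power_divide divide_simps)
      moreover have "sigma_sq c \<mu> = (2 - 2 * a * P) / (sinh a)\<^sup>2 + 1"
        using mu by (simp add: sigma_sq_def P a_def mult.assoc)
      ultimately show ?thesis unfolding q by (simp add: diff_divide_distrib)
    qed
    have "\<exists>C1. corrector c \<mu> 1 (\<lambda>_. m_const c \<mu>) F C1"
    proof (rule correctorI)
      show "\<mu> * F 1 x + F 2 x / 2 = m_const c \<mu>" for x
        using mu by (simp add: F_def m_const_def P a_def algebra_simps)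
      show "continuous_on UNIV (F 3)" unfolding F_def using cy by (auto intro!: continuous_intros)
    qed (use mu PA y0 in \<open>auto simp: F_def power2_eq_square intro!: derivative_eq_intros\<close>)
    moreover have "\<exists>C2. corrector c \<mu> 0 (\<lambda>x. (F 1 x)\<^sup>2 - sigma_sq c \<mu>) G C2"
    proof (rule correctorI)
      show "\<mu> * G 1 x + G 2 x / 2 = (F 1 x)\<^sup>2 - sigma_sq c \<mu>" for x
        by (simp add: G_def diff_divide_distrib algebra_simps)
      show "continuous_on UNIV (G 3)" unfolding G_def F_def using cy by (auto intro!: continuous_intros)
      show "G 1 c = 0"
      proof -
        have "G 1 c = D * (\<alpha> - \<gamma> * y c) + \<beta> * c * y c" by (simp add: G_def \<kappa>_def D_def power2_eq_square algebra_simps)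
        also have "\<dots> = (D * (P\<^sup>2 + A\<^sup>2 * y c - sigma_sq c \<mu>) + 4 * a * P * A * y c) / \<mu>"
          using mu by (simp add: \<alpha>_def \<beta>_def \<gamma>_def a_def divide_simps) ((simp add: algebra_simps)?)
        also have "\<dots> = 0" unfolding sig using D0 by (simp add: divide_simps)
        finally show ?thesis .
      qed
      show "(G 0 has_real_derivative G 1 x) (at x)" for x
        using mu by (auto simp: G_def divide_simps power2_eq_square intro!: derivative_eq_intros) ((simp add: algebra_simps)?)
      show "(G 1 has_real_derivative G 2 x) (at x)" for x
        using mu by (auto simp: G_def F1 \<alpha>_def \<gamma>_def \<beta>_def divide_simps power2_eq_square intro!: derivative_eq_intros) ((simp add: algebra_simps)?)
      show "(G 2 has_real_derivative G 3 x) (at x)" for x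
        using mu by (auto simp: G_def F_def \<alpha>_def \<gamma>_def \<beta>_def divide_simps power2_eq_square intro!: derivative_eq_intros) ((simp add: algebra_simps)?)
    qed (simp add: G_def \<kappa>_def y0)
    moreover have "\<bar>F 1 x\<bar> \<le> 1" if "0 \<le> x" "x \<le> c" for x
    proof -
      \<comment> \<open>\<open>F 1 x\<close> is the convex combination of \<open>-1\<close> and
        \<open>1\<close> with weight \<open>t\<close> on \<open>1\<close>; numerator and denominator
        of \<open>t\<close> change sign together with \<open>\<mu>\<close>.\<close>
      define t where "t = (1 - y x) / D"
      have t: "0 \<le> t \<and> t \<le> 1"
      proof (cases "0 < \<mu>")
        case True
        then have "y c \<le> y x" "y x \<le> 1" "y c < 1" using that c by (auto simp: y_def)
        then show ?thesis by (simp add: t_def D_def divide_simps)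
      next
        case False
        then have "\<mu> < 0" using mu by simp
        then have "y x \<le> y c" "1 \<le> y x" "1 < y c" using that c by (auto simp: y_def mult_less_0_iff mult_nonpos_nonneg)
        then show ?thesis by (simp add: t_def D_def divide_simps)
      qed
      have "F 1 x = - 1 + 2 * t" using D0 by (simp add: F1 P_def A_def t_def divide_simps)
      then show ?thesis using t by auto
    qed
    ultimately show ?thesis by blast
  qed
  then obtain F G C1 C2 where *: "corrector c \<mu> 1 (\<lambda>_. m_const c \<mu>) F C1"
    "corrector c \<mu> 0 (\<lambda>x. (F 1 x)\<^sup>2 - sigma_sq c \<mu>) G C2" "\<forall>x. 0 \<le> x \<longrightarrow> x \<le> c \<longrightarrow> \<bar>F 1 x\<bar> \<le> 1"
    by blast
  have "corrector c \<mu> 1 (\<lambda>_. m_const c \<mu>) F (max C1 C2)"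
    "corrector c \<mu> 0 (\<lambda>x. (F 1 x)\<^sup>2 - sigma_sq c \<mu>) G (max C1 C2)"
    using * by (auto simp: corrector_def le_max_iff_disj)
  then show thesis using that * by blast
qed

section \<open>Martingale transforms of a standard normal sequence\<close>

lemma std_normal_exp_moment:
  fixes t :: real
  shows "integrable std_normal_distribution (\<lambda>x. exp (t * x))"
    and "(\<integral>x. exp (t * x) \<partial>std_normal_distribution) = exp (t\<^sup>2 / 2)"
proof -
  have eq: "std_normal_density x * exp (t * x) = exp (t\<^sup>2 / 2) * normal_density t 1 x" for x
    by (simp add: normal_density_def mult_exp_exp field_simps power2_eq_square flip: exp_add)
  have "integrable lborel (\<lambda>x. std_normal_density x * exp (t * x))"
    unfolding eq by (intro integrable_mult_right integrable_normal_density) auto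
  then show "integrable std_normal_distribution (\<lambda>x. exp (t * x))"
    by (subst integrable_density) auto
  have "(\<integral>x. exp (t * x) \<partial>std_normal_distribution) = (\<integral>x. std_normal_density x * exp (t * x) \<partial>lborel)"
    by (subst integral_density) auto
  also have "\<dots> = exp (t\<^sup>2 / 2) * (\<integral>x. normal_density t 1 x \<partial>lborel)"
    unfolding eq by simp
  also have "\<dots> = exp (t\<^sup>2 / 2)" by simp
  finally show "(\<integral>x. exp (t * x) \<partial>std_normal_distribution) = exp (t\<^sup>2 / 2)" .
qed

section \<open>The filtration of an independent normal sequence\<close>

locale std_normal_sequence = prob_space M for M :: "'a measure" +
  fixes \<zeta> :: "nat \<Rightarrow> 'a \<Rightarrow> real" and N :: nat
  assumes indep: "indep_vars (\<lambda>_. borel) \<zeta> {..<N}"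
    and distr_zeta: "\<And>i. i < N \<Longrightarrow> distr M borel (\<zeta> i) = std_normal_distribution"
begin

text \<open>The indices stop before \<open>i\<close>, so a coefficient measurable for
  \<open>past i\<close> is predictable: it is known before \<open>\<zeta> i\<close> is revealed. In
  a preimage algebra every event is itself a preimage, with no generated closure to handle.\<close>

definition past :: "nat \<Rightarrow> 'a measure" where
  "past i = vimage_algebra (space M) (\<lambda>\<omega>. \<lambda>l\<in>{..<i}. \<zeta> l \<omega>) (\<Pi>\<^sub>M l\<in>{..<i}. borel)"

lemma measurable_zeta: "i < N \<Longrightarrow> \<zeta> i \<in> borel_measurable M"
  using indep by (auto simp: indep_vars_def)

lemma space_past [simp]: "space (past i) = space M"
  by (simp add: past_def)

lemma sets_past: "sets (past i) = {(\<lambda>\<omega>. \<lambda>l\<in>{..<i}. \<zeta> l \<omega>) -` A \<inter> space M | A. A \<in> sets (\<Pi>\<^sub>M l\<in>{..<i}. borel)}"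
  unfolding past_def by (rule sets_vimage_algebra2) (auto simp: space_PiM)

lemma zeta_past: "l < i \<Longrightarrow> \<zeta> l \<in> borel_measurable (past i)"
proof -
  assume l: "l < i"
  have "(\<lambda>\<omega>. \<lambda>l\<in>{..<i}. \<zeta> l \<omega>) \<in> measurable (past i) (\<Pi>\<^sub>M l\<in>{..<i}. borel)"
    unfolding past_def by (rule measurable_vimage_algebra1) (auto simp: space_PiM)
  from measurable_compose[OF this measurable_component_singleton[of l]] l
  show ?thesis by simp
qed

lemma subalgebra_past: "i \<le> N \<Longrightarrow> subalgebra M (past i)"
  unfolding subalgebra_def sets_past
  by (auto intro!: measurable_sets[OF measurable_restrict] measurable_zeta)

lemma past_mono: "i \<le> j \<Longrightarrow> subalgebra (past j) (past i)"
proof -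
  assume "i \<le> j"
  then have "(\<lambda>\<omega>. \<lambda>l\<in>{..<i}. \<zeta> l \<omega>) \<in> measurable (past j) (\<Pi>\<^sub>M l\<in>{..<i}. borel)"
    by (intro measurable_restrict zeta_past) auto
  from measurable_sets[OF this] show ?thesis
    unfolding subalgebra_def sets_past[of i] by auto
qed

lemma past_imp: "f \<in> measurable (past i) S \<Longrightarrow> i \<le> N \<Longrightarrow> f \<in> measurable M S"
  by (rule measurable_from_subalg[OF subalgebra_past])

lemma past_le: "f \<in> measurable (past i) S \<Longrightarrow> i \<le> j \<Longrightarrow> f \<in> measurable (past j) S"
  by (rule measurable_from_subalg[OF past_mono])

lemma sets_past_imp: "A \<in> sets (past i) \<Longrightarrow> i \<le> N \<Longrightarrow> A \<in> sets M"
  using subalgebra_past by (auto simp: subalgebra_def)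

lemma indep_set_past:
  assumes i: "i < N"
  shows "indep_set (sets (past i)) (sigma_sets (space M) {\<zeta> i -` A \<inter> space M |A. A \<in> sets borel})"
proof -
  let ?P = "\<lambda>I :: nat set. \<Pi>\<^sub>M l\<in>I. (borel :: real measure)" and ?V = "\<lambda>I \<omega>. \<lambda>l\<in>I. \<zeta> l \<omega>"
  have "indep_var (?P {..<i}) (?V {..<i}) (?P {i}) (?V {i})"
    using i by (intro indep_var_restrict[OF indep]) auto
  then have V: "indep_set (sigma_sets (space M) {?V {..<i} -` A \<inter> space M |A. A \<in> sets (?P {..<i})})
      (sigma_sets (space M) {?V {i} -` A \<inter> space M |A. A \<in> sets (?P {i})})"
    by (simp add: indep_var_eq)
  have 1: "sets (past i) \<subseteq> sigma_sets (space M) {?V {..<i} -` A \<inter> space M |A. A \<in> sets (?P {..<i})}"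
    by (auto simp: sets_past)
  have "\<zeta> i -` A \<inter> space M = ?V {i} -` ((\<lambda>x. x i) -` A \<inter> space (?P {i})) \<inter> space M" for A
    by (auto simp: space_PiM)
  moreover have "(\<lambda>x. x i) -` A \<inter> space (?P {i}) \<in> sets (?P {i})" if "A \<in> sets borel" for A
    using that by (intro measurable_sets[OF measurable_component_singleton]) auto
  ultimately have "\<exists>B. \<zeta> i -` A \<inter> space M = ?V {i} -` B \<inter> space M \<and> B \<in> sets (?P {i})" if "A \<in> sets borel" for A
    using that by (intro exI[of _ "(\<lambda>x. x i) -` A \<inter> space (?P {i})"] conjI)
  then have "{\<zeta> i -` A \<inter> space M |A. A \<in> sets borel} \<subseteq> {?V {i} -` A \<inter> space M |A. A \<in> sets (?P {i})}"
    by (simp only: subset_iff mem_Collect_eq) metis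
  then have 2: "sigma_sets (space M) {\<zeta> i -` A \<inter> space M |A. A \<in> sets borel}
      \<subseteq> sigma_sets (space M) {?V {i} -` A \<inter> space M |A. A \<in> sets (?P {i})}"
    by (rule sigma_sets_subseteq)
  show ?thesis
    using V unfolding indep_set_def
  proof (rule indep_sets_mono_sets)
    fix l :: bool assume "l \<in> UNIV"
    show "case_bool (sets (past i)) (sigma_sets (space M) {\<zeta> i -` A \<inter> space M |A. A \<in> sets borel}) l
      \<subseteq> case_bool (sigma_sets (space M) {?V {..<i} -` A \<inter> space M |A. A \<in> sets (?P {..<i})})
      (sigma_sets (space M) {?V {i} -` A \<inter> space M |A. A \<in> sets (?P {i})}) l"
      using 1 2 by (cases l) simp_all
  qed
qed

lemma indep_past:
  assumes i: "i < N" and X: "X \<in> measurable (past i) S" and f: "f \<in> measurable borel T"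
  shows "indep_var S X T (\<lambda>\<omega>. f (\<zeta> i \<omega>))"
proof -
  have 1: "sigma_sets (space M) {X -` A \<inter> space M | A. A \<in> sets S} \<subseteq> sets (past i)"
    using sets.sigma_sets_subset[of "{X -` A \<inter> space M | A. A \<in> sets S}" "past i"] measurable_sets[OF X] by auto
  have "(\<lambda>\<omega>. f (\<zeta> i \<omega>)) -` A \<inter> space M = \<zeta> i -` (f -` A \<inter> space borel) \<inter> space M" for A
    by auto
  then have "\<exists>B. (\<lambda>\<omega>. f (\<zeta> i \<omega>)) -` A \<inter> space M = \<zeta> i -` B \<inter> space M \<and> B \<in> sets borel" if "A \<in> sets T" for A
    using measurable_sets[OF f that] by (intro exI[of _ "f -` A \<inter> space borel"] conjI)
  then have "{(\<lambda>\<omega>. f (\<zeta> i \<omega>)) -` A \<inter> space M |A. A \<in> sets T} \<subseteq> {\<zeta> i -` A \<inter> space M |A. A \<in> sets borel}"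
    by (simp only: subset_iff mem_Collect_eq) metis
  then have 2: "sigma_sets (space M) {(\<lambda>\<omega>. f (\<zeta> i \<omega>)) -` A \<inter> space M |A. A \<in> sets T}
      \<subseteq> sigma_sets (space M) {\<zeta> i -` A \<inter> space M |A. A \<in> sets borel}"
    by (rule sigma_sets_subseteq)
  have "indep_set (sigma_sets (space M) {X -` A \<inter> space M | A. A \<in> sets S})
      (sigma_sets (space M) {(\<lambda>\<omega>. f (\<zeta> i \<omega>)) -` A \<inter> space M |A. A \<in> sets T})"
    using indep_set_past[OF i] unfolding indep_set_def
  proof (rule indep_sets_mono_sets)
    fix l :: bool assume "l \<in> UNIV"
    show "case_bool (sigma_sets (space M) {X -` A \<inter> space M | A. A \<in> sets S})
      (sigma_sets (space M) {(\<lambda>\<omega>. f (\<zeta> i \<omega>)) -` A \<inter> space M |A. A \<in> sets T}) l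
      \<subseteq> case_bool (sets (past i)) (sigma_sets (space M) {\<zeta> i -` A \<inter> space M |A. A \<in> sets borel}) l"
      using 1 2 by (cases l) simp_all
  qed
  then show ?thesis
    using past_imp[OF X] measurable_compose[OF measurable_zeta f] i by (auto simp: indep_var_eq)
qed

text \<open>Independence of \<open>\<zeta> i\<close> from its past, in the form that Fubini's
  theorem consumes.\<close>

lemma distr_past_zeta:
  assumes i: "i < N" and X: "X \<in> measurable (past i) S"
  shows "distr M S X \<Otimes>\<^sub>M std_normal_distribution = distr M (S \<Otimes>\<^sub>M borel) (\<lambda>\<omega>. (X \<omega>, \<zeta> i \<omega>))"
proof -
  note [measurable] = past_imp[OF X less_imp_le[OF i]] measurable_zeta[OF i]
  interpret X: prob_space "distr M S X" by (rule prob_space_distr) measurable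
  interpret G: prob_space std_normal_distribution
    using real_dist_normal_dist by (simp add: real_distribution_def)
  show ?thesis
  proof (rule pair_measure_eqI)
    fix A B assume A: "A \<in> sets (distr M S X)" and B: "B \<in> sets std_normal_distribution"
    have "X -` A \<inter> space M \<in> sets (past i)" using measurable_sets[OF X] A by auto
    moreover have "\<zeta> i -` B \<inter> space M \<in> sigma_sets (space M) {\<zeta> i -` A \<inter> space M |A. A \<in> sets borel}"
      using B by auto
    ultimately have "prob ((X -` A \<inter> space M) \<inter> (\<zeta> i -` B \<inter> space M)) = prob (X -` A \<inter> space M) * prob (\<zeta> i -` B \<inter> space M)"
      by (rule indep_setD[OF indep_set_past[OF i]])
    moreover have "(\<lambda>\<omega>. (X \<omega>, \<zeta> i \<omega>)) -` (A \<times> B) \<inter> space M = (X -` A \<inter> space M) \<inter> (\<zeta> i -` B \<inter> space M)"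
      by auto
    moreover have "emeasure std_normal_distribution B = emeasure M (\<zeta> i -` B \<inter> space M)"
      using B by (simp flip: distr_zeta[OF i] add: emeasure_distr)
    ultimately show "emeasure (distr M S X) A * emeasure std_normal_distribution B =
        emeasure (distr M (S \<Otimes>\<^sub>M borel) (\<lambda>\<omega>. (X \<omega>, \<zeta> i \<omega>))) (A \<times> B)"
      using A B by (simp add: emeasure_distr emeasure_eq_measure ennreal_mult)
  qed (auto intro: X.sigma_finite_measure G.sigma_finite_measure sets_pair_measure_cong)
qed

lemma integrable_indicator_mult:
  fixes f :: "'a \<Rightarrow> real"
  shows "A \<in> sets M \<Longrightarrow> integrable M f \<Longrightarrow> integrable M (\<lambda>\<omega>. indicator A \<omega> * f \<omega>)"
  using integrable_mult_indicator[of A M f] by simp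

lemma integral_zeta:
  fixes f :: "real \<Rightarrow> 'b::{banach, second_countable_topology}"
  assumes "i < N" "f \<in> borel_measurable borel"
  shows "(\<integral>\<omega>. f (\<zeta> i \<omega>) \<partial>M) = (\<integral>x. f x \<partial>std_normal_distribution)"
    and "integrable M (\<lambda>\<omega>. f (\<zeta> i \<omega>)) \<longleftrightarrow> integrable std_normal_distribution f"
  using assms by (simp_all flip: distr_zeta add: integral_distr integrable_distr_eq measurable_zeta)

lemma expectation_mult_zeta:
  fixes H :: "'a \<Rightarrow> 'b::{real_normed_field, banach, second_countable_topology}"
  assumes i: "i < N" and H: "H \<in> borel_measurable (past i)" "integrable M H"
    and f: "f \<in> borel_measurable borel" "integrable std_normal_distribution f"
  shows "integrable M (\<lambda>\<omega>. H \<omega> * f (\<zeta> i \<omega>))"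
    and "(\<integral>\<omega>. H \<omega> * f (\<zeta> i \<omega>) \<partial>M) = (\<integral>\<omega>. H \<omega> \<partial>M) * (\<integral>x. f x \<partial>std_normal_distribution)"
proof -
  have "indep_var borel H borel (\<lambda>\<omega>. f (\<zeta> i \<omega>))" by (rule indep_past[OF i H(1) f(1)])
  moreover have "integrable M (\<lambda>\<omega>. f (\<zeta> i \<omega>))" using integral_zeta(2)[OF i f(1)] f by simp
  ultimately show "integrable M (\<lambda>\<omega>. H \<omega> * f (\<zeta> i \<omega>))"
    "(\<integral>\<omega>. H \<omega> * f (\<zeta> i \<omega>) \<partial>M) = (\<integral>\<omega>. H \<omega> \<partial>M) * (\<integral>x. f x \<partial>std_normal_distribution)"
    using indep_var_integrable[OF _ H(2)] indep_var_lebesgue_integral[OF _ H(2)] integral_zeta(1)[OF i f(1)]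
    by auto
qed

text \<open>The freezing lemma: a quantity of the past is held fixed while the next normal variable
  is integrated out. It takes the place of conditional expectations in the exponential one-step
  computations below.\<close>

lemma expectation_fun_zeta:
  fixes f :: "_ \<Rightarrow> 'b::{banach, second_countable_topology}"
  assumes i: "i < N" and X: "X \<in> measurable (past i) S"
    and f: "f \<in> borel_measurable (S \<Otimes>\<^sub>M borel)" "integrable M (\<lambda>\<omega>. f (X \<omega>, \<zeta> i \<omega>))"
  shows "(\<integral>\<omega>. f (X \<omega>, \<zeta> i \<omega>) \<partial>M) = (\<integral>\<omega>. (\<integral>x. f (X \<omega>, x) \<partial>std_normal_distribution) \<partial>M)"
proof -
  note XM = past_imp[OF X less_imp_le[OF i]] and zM = measurable_zeta[OF i]
  interpret X: prob_space "distr M S X" by (rule prob_space_distr[OF XM])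
  interpret G: prob_space std_normal_distribution
    using real_dist_normal_dist by (simp add: real_distribution_def)
  interpret P: pair_sigma_finite "distr M S X" std_normal_distribution ..
  have D: "distr M (S \<Otimes>\<^sub>M borel) (\<lambda>\<omega>. (X \<omega>, \<zeta> i \<omega>)) = distr M S X \<Otimes>\<^sub>M std_normal_distribution"
    using distr_past_zeta[OF i X] by simp
  have int: "integrable (distr M S X \<Otimes>\<^sub>M std_normal_distribution) f"
    using f XM zM by (simp flip: D add: integrable_distr_eq)
  have "(\<integral>\<omega>. f (X \<omega>, \<zeta> i \<omega>) \<partial>M) = (\<integral>z. f z \<partial>(distr M S X \<Otimes>\<^sub>M std_normal_distribution))"
    using f XM zM by (simp flip: D add: integral_distr)
  also have "\<dots> = (\<integral>y. (\<integral>x. f (y, x) \<partial>std_normal_distribution) \<partial>distr M S X)"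
    using P.integral_fst'[OF int] by simp
  also have "\<dots> = (\<integral>\<omega>. (\<integral>x. f (X \<omega>, x) \<partial>std_normal_distribution) \<partial>M)"
  proof (rule integral_distr[OF XM])
    show "(\<lambda>y. \<integral>x. f (y, x) \<partial>std_normal_distribution) \<in> borel_measurable S"
      using f(1) by (intro G.borel_measurable_lebesgue_integral) 
        (simp add: case_prod_beta' cong: measurable_cong_sets)
  qed
  finally show ?thesis .
qed

section \<open>Transforms with predictable coefficients and maximal inequalities\<close>

definition transform :: "(nat \<Rightarrow> 'a \<Rightarrow> real) \<Rightarrow> (real \<Rightarrow> real) \<Rightarrow> nat \<Rightarrow> 'a \<Rightarrow> real" where
  "transform a f j \<omega> = (\<Sum>i<j. a i \<omega> * f (\<zeta> i \<omega>))"

lemma transform_Suc: "transform a f (Suc j) \<omega> = transform a f j \<omega> + a j \<omega> * f (\<zeta> j \<omega>)"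
  by (simp add: transform_def)

lemma transform_past:
  assumes "\<And>i. i < j \<Longrightarrow> a i \<in> borel_measurable (past i)" "f \<in> borel_measurable borel"
  shows "transform a f j \<in> borel_measurable (past j)"
  unfolding transform_def
  by (intro borel_measurable_sum borel_measurable_times measurable_compose[OF zeta_past assms(2)] past_le[OF assms(1)]) auto

text \<open>The submartingale property is phrased through integrals over events of the past. The
  induction carries a stronger inequality, with the integral restricted to \<open>E k\<close>:
  passing to \<open>Suc k\<close> adds only the part \<open>D\<close> where the level is first
  reached, and there \<open>U (Suc k)\<close> itself is at least \<open>l\<close>.\<close>

lemma doob_maximal:
  assumes U: "\<And>j. j \<le> n \<Longrightarrow> U j \<in> borel_measurable (past j)" "\<And>j. j \<le> n \<Longrightarrow> integrable M (U j)"
    and nn: "\<And>j \<omega>. 0 \<le> U j \<omega>" and n: "n \<le> N"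
    and step: "\<And>j A. j < n \<Longrightarrow> A \<in> sets (past j) \<Longrightarrow>
      (\<integral>\<omega>. indicator A \<omega> * U j \<omega> \<partial>M) \<le> (\<integral>\<omega>. indicator A \<omega> * U (Suc j) \<omega> \<partial>M)"
  shows "l * prob {\<omega> \<in> space M. \<exists>j\<le>n. l \<le> U j \<omega>} \<le> (\<integral>\<omega>. U n \<omega> \<partial>M)"
proof -
  define E where "E k = {\<omega> \<in> space M. \<exists>j\<le>k. l \<le> U j \<omega>}" for k
  define B where "B k = {\<omega> \<in> space M. l \<le> U k \<omega>}" for k
  have Bs: "B k \<in> sets (past k)" if "k \<le> n" for k
    using borel_measurable_le[OF borel_measurable_const U(1)[OF that], of l] by (simp add: B_def)
  have Es: "E k \<in> sets (past k)" if "k \<le> n" for k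
  proof -
    have "E k = (\<Union>j\<le>k. B j)" by (auto simp: E_def B_def)
    moreover have "B j \<in> sets (past k)" if "j \<le> k" for j
      using Bs[of j] past_mono[OF that] that \<open>k \<le> n\<close> by (auto simp: subalgebra_def)
    ultimately show ?thesis by auto
  qed
  have int: "integrable M (\<lambda>\<omega>. indicator A \<omega> * U k \<omega>)" if "A \<in> sets M" "k \<le> n" for A k
    using that U(2)[of k] by (intro integrable_indicator_mult)
  have cheb: "l * prob A \<le> (\<integral>\<omega>. indicator A \<omega> * U k \<omega> \<partial>M)"
    if A: "A \<in> sets M" "A \<subseteq> B k" "k \<le> n" for A k
  proof -
    have "(\<integral>\<omega>. l * indicator A \<omega> \<partial>M) \<le> (\<integral>\<omega>. indicator A \<omega> * U k \<omega> \<partial>M)"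
    proof (rule integral_mono)
      show "integrable M (\<lambda>\<omega>. l * indicator A \<omega>)"
        using A by (intro integrable_mult_right integrable_real_indicator) (auto simp: less_top[symmetric])
    qed (use A int[OF A(1,3)] in \<open>auto simp: B_def indicator_def\<close>)
    then show ?thesis using A by simp
  qed
  have "l * prob (E k) \<le> (\<integral>\<omega>. indicator (E k) \<omega> * U k \<omega> \<partial>M)" if "k \<le> n" for k
    using that
  proof (induction k)
    case 0
    have "E 0 = B 0" by (auto simp: E_def B_def)
    then show ?case using cheb[of "E 0" 0] Es[of 0] sets_past_imp n by auto
  next
    case (Suc k)
    define D where "D = B (Suc k) - E k"
    have EM: "E k \<in> sets M" "D \<in> sets M"
      using Es[of k] Bs[of "Suc k"] Suc.prems n sets_past_imp[of _ k] sets_past_imp[of _ "Suc k"] by (auto simp: D_def)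
    have un: "E (Suc k) = E k \<union> D" "E k \<inter> D = {}"
      by (auto simp: E_def B_def D_def le_Suc_eq)
    have "l * prob (E (Suc k)) = l * prob (E k) + l * prob D"
      using un EM by (simp add: finite_measure_Union distrib_left)
    also have "\<dots> \<le> (\<integral>\<omega>. indicator (E k) \<omega> * U k \<omega> \<partial>M) + (\<integral>\<omega>. indicator D \<omega> * U (Suc k) \<omega> \<partial>M)"
      using Suc cheb[of D "Suc k"] EM by (intro add_mono) (auto simp: D_def)
    also have "\<dots> \<le> (\<integral>\<omega>. indicator (E k) \<omega> * U (Suc k) \<omega> \<partial>M) + (\<integral>\<omega>. indicator D \<omega> * U (Suc k) \<omega> \<partial>M)"
      using Suc Es[of k] by (intro add_right_mono step) auto
    also have "\<dots> = (\<integral>\<omega>. indicator (E k) \<omega> * U (Suc k) \<omega> + indicator D \<omega> * U (Suc k) \<omega> \<partial>M)"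
      using Suc EM by (intro Bochner_Integration.integral_add[symmetric] int) auto
    also have "\<dots> = (\<integral>\<omega>. indicator (E (Suc k)) \<omega> * U (Suc k) \<omega> \<partial>M)"
      using un by (intro Bochner_Integration.integral_cong) (auto simp: indicator_def)
    finally show ?case .
  qed
  from this[of n] have "l * prob (E n) \<le> (\<integral>\<omega>. indicator (E n) \<omega> * U n \<omega> \<partial>M)" by simp
  also have "\<dots> \<le> (\<integral>\<omega>. U n \<omega> \<partial>M)"
    using int[of "E n" n] Es[of n] sets_past_imp n U(2)[of n] nn
    by (intro integral_mono) (auto simp: indicator_def)
  finally show ?thesis by (simp add: E_def)
qed

lemma bounded_integrable:
  fixes f :: "'a \<Rightarrow> 'b::{banach, second_countable_topology}"
  assumes "f \<in> borel_measurable M" "\<And>\<omega>. norm (f \<omega>) \<le> B"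
  shows "integrable M f"
  using assms by (intro integrable_const_bound[where B=B]) auto

context
  fixes a :: "nat \<Rightarrow> 'a \<Rightarrow> real" and b :: "nat \<Rightarrow> real"
  assumes a_past: "\<And>i. i < N \<Longrightarrow> a i \<in> borel_measurable (past i)"
    and a_bound: "\<And>i \<omega>. \<bar>a i \<omega>\<bar> \<le> b i"
begin

lemma b_nonneg: "0 \<le> b i"
  using a_bound[of i undefined] by linarith

context
  fixes f :: "real \<Rightarrow> real" and w :: real
  assumes f: "f \<in> borel_measurable borel" "integrable std_normal_distribution f"
      "integrable std_normal_distribution (\<lambda>x. (f x)\<^sup>2)"
    and f0: "(\<integral>x. f x \<partial>std_normal_distribution) = 0"
    and fw: "(\<integral>x. (f x)\<^sup>2 \<partial>std_normal_distribution) = w"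
begin

text \<open>In the expanded square the cross term has mean zero, since \<open>\<zeta> j\<close> is
  independent of the other factors and \<open>f\<close> is centred. The indicator of a past event is
  carried along so that the identity also yields the submartingale property.\<close>

lemma transform_sq_step:
  assumes "j < N" and S: "integrable M (\<lambda>\<omega>. (transform a f j \<omega>)\<^sup>2)"
  shows "integrable M (\<lambda>\<omega>. (transform a f (Suc j) \<omega>)\<^sup>2)"
    and "A \<in> sets (past j) \<Longrightarrow> (\<integral>\<omega>. indicator A \<omega> * (transform a f (Suc j) \<omega>)\<^sup>2 \<partial>M)
      = (\<integral>\<omega>. indicator A \<omega> * (transform a f j \<omega>)\<^sup>2 \<partial>M) + w * (\<integral>\<omega>. indicator A \<omega> * (a j \<omega>)\<^sup>2 \<partial>M)"
proof -
  let ?S = "transform a f j"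
  have Sp: "?S \<in> borel_measurable (past j)"
    using assms f a_past by (intro transform_past) auto
  have SM: "?S \<in> borel_measurable M" using past_imp[OF Sp] assms by auto
  have aM: "a j \<in> borel_measurable M" using past_imp[OF a_past] assms by auto
  have iS: "integrable M ?S"
    using S SM by (rule square_integrable_imp_integrable[rotated])
  have ia: "integrable M (\<lambda>\<omega>. indicator A \<omega> * (?S \<omega> * a j \<omega>))"
    and iaa: "integrable M (\<lambda>\<omega>. indicator A \<omega> * (a j \<omega>)\<^sup>2)"
    and iSS: "integrable M (\<lambda>\<omega>. indicator A \<omega> * (?S \<omega>)\<^sup>2)"
    if "A \<in> sets M" for A
  proof -
    have "integrable M (\<lambda>\<omega>. a j \<omega> * ?S \<omega>)"
    proof (rule Bochner_Integration.integrable_bound[OF integrable_mult_right[OF integrable_abs[OF iS]]])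
      show "AE x in M. norm (a j x * ?S x) \<le> norm (b j * \<bar>?S x\<bar>)"
        using a_bound b_nonneg by (auto simp: abs_mult intro!: mult_right_mono)
    qed (use aM SM in auto)
    then show "integrable M (\<lambda>\<omega>. indicator A \<omega> * (?S \<omega> * a j \<omega>))"
      using integrable_indicator_mult[OF that, of "\<lambda>\<omega>. a j \<omega> * ?S \<omega>"] by (simp add: ac_simps)
    have "(a j \<omega>)\<^sup>2 \<le> (b j)\<^sup>2" for \<omega>
      using a_bound[of j \<omega>] b_nonneg[of j] by (simp add: abs_le_square_iff[symmetric])
    then show "integrable M (\<lambda>\<omega>. indicator A \<omega> * (a j \<omega>)\<^sup>2)"
      using aM that by (intro bounded_integrable[where B="(b j)\<^sup>2"]) (auto simp: indicator_def)
    show "integrable M (\<lambda>\<omega>. indicator A \<omega> * (?S \<omega>)\<^sup>2)"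
      using integrable_indicator_mult[OF that S] .
  qed
  have eq: "indicator A \<omega> * (transform a f (Suc j) \<omega>)\<^sup>2 =
      indicator A \<omega> * (?S \<omega>)\<^sup>2 + 2 * (indicator A \<omega> * (?S \<omega> * a j \<omega>) * f (\<zeta> j \<omega>))
        + indicator A \<omega> * (a j \<omega>)\<^sup>2 * (f (\<zeta> j \<omega>))\<^sup>2" for A \<omega>
    by (simp add: transform_Suc power2_eq_square algebra_simps)
  have main: "integrable M (\<lambda>\<omega>. indicator A \<omega> * (transform a f (Suc j) \<omega>)\<^sup>2) \<and>
    (\<integral>\<omega>. indicator A \<omega> * (transform a f (Suc j) \<omega>)\<^sup>2 \<partial>M)
      = (\<integral>\<omega>. indicator A \<omega> * (?S \<omega>)\<^sup>2 \<partial>M) + w * (\<integral>\<omega>. indicator A \<omega> * (a j \<omega>)\<^sup>2 \<partial>M)"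
    if A: "A \<in> sets (past j)" for A
  proof -
    have AM: "A \<in> sets M" using sets_past_imp[OF A] assms by auto
    have "(\<lambda>\<omega>. indicator A \<omega> * (?S \<omega> * a j \<omega>)) \<in> borel_measurable (past j)"
      using A Sp a_past[OF assms(1)] by measurable
    note 1 = expectation_mult_zeta[OF assms(1) this ia[OF AM] f(1,2)]
    have "(\<lambda>\<omega>. indicator A \<omega> * (a j \<omega>)\<^sup>2) \<in> borel_measurable (past j)"
      using A a_past[OF assms(1)] by measurable
    note 2 = expectation_mult_zeta[OF assms(1) this iaa[OF AM] _ f(3)]
    show ?thesis
      unfolding eq using 1 2 iSS[OF AM] f(1) by (auto simp: f0 fw)
  qed
  show "A \<in> sets (past j) \<Longrightarrow> (\<integral>\<omega>. indicator A \<omega> * (transform a f (Suc j) \<omega>)\<^sup>2 \<partial>M)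
      = (\<integral>\<omega>. indicator A \<omega> * (transform a f j \<omega>)\<^sup>2 \<partial>M) + w * (\<integral>\<omega>. indicator A \<omega> * (a j \<omega>)\<^sup>2 \<partial>M)"
    using main by blast
  have "space M \<in> sets (past j)" using sets.top[of "past j"] by simp
  from main[OF this] show "integrable M (\<lambda>\<omega>. (transform a f (Suc j) \<omega>)\<^sup>2)"
    by (simp cong: Bochner_Integration.integrable_cong)
qed

lemma transform_sq_integrable: "j \<le> N \<Longrightarrow> integrable M (\<lambda>\<omega>. (transform a f j \<omega>)\<^sup>2)"
proof (induction j)
  case 0 then show ?case by (simp add: transform_def)
next
  case (Suc j) then show ?case using transform_sq_step(1)[of j] by simp
qed

lemma transform_sq_expectation:
  "j \<le> N \<Longrightarrow> (\<integral>\<omega>. (transform a f j \<omega>)\<^sup>2 \<partial>M) = w * (\<Sum>i<j. \<integral>\<omega>. (a i \<omega>)\<^sup>2 \<partial>M)"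
proof (induction j)
  case 0 then show ?case by (simp add: transform_def)
next
  case (Suc j)
  have "space M \<in> sets (past j)" using sets.top[of "past j"] by simp
  from transform_sq_step(2)[OF _ transform_sq_integrable this] Suc show ?case
    by (simp add: distrib_left cong: Bochner_Integration.integral_cong)
qed

lemma kolmogorov_maximal:
  assumes l: "0 < l" and n: "n \<le> N"
  shows "prob {\<omega> \<in> space M. \<exists>j\<le>n. l \<le> \<bar>transform a f j \<omega>\<bar>} \<le> w * (\<Sum>i<n. (b i)\<^sup>2) / l\<^sup>2"
proof -
  have w: "0 \<le> w" unfolding fw[symmetric] by (intro Bochner_Integration.integral_nonneg) auto
  have "l\<^sup>2 * prob {\<omega> \<in> space M. \<exists>j\<le>n. l\<^sup>2 \<le> (transform a f j \<omega>)\<^sup>2} \<le> (\<integral>\<omega>. (transform a f n \<omega>)\<^sup>2 \<partial>M)"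
  proof (rule doob_maximal[OF _ _ _ n])
    fix j A assume "j < n" "A \<in> sets (past j)"
    then show "(\<integral>\<omega>. indicator A \<omega> * (transform a f j \<omega>)\<^sup>2 \<partial>M) \<le> (\<integral>\<omega>. indicator A \<omega> * (transform a f (Suc j) \<omega>)\<^sup>2 \<partial>M)"
      using transform_sq_step(2)[of j A] transform_sq_integrable[of j] n w by (auto intro!: mult_nonneg_nonneg Bochner_Integration.integral_nonneg)
  qed (use n transform_sq_integrable a_past f in \<open>auto intro!: borel_measurable_power transform_past\<close>)
  also have "\<dots> = w * (\<Sum>i<n. \<integral>\<omega>. (a i \<omega>)\<^sup>2 \<partial>M)" by (rule transform_sq_expectation[OF n])
  also have "\<dots> \<le> w * (\<Sum>i<n. (b i)\<^sup>2)"
  proof (intro mult_left_mono sum_mono w)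
    fix i assume "i \<in> {..<n}"
    then have "a i \<in> borel_measurable M" using past_imp[OF a_past] n by auto
    moreover have "(a i \<omega>)\<^sup>2 \<le> (b i)\<^sup>2" for \<omega>
      using a_bound[of i \<omega>] b_nonneg[of i] by (simp add: abs_le_square_iff[symmetric])
    ultimately show "(\<integral>\<omega>. (a i \<omega>)\<^sup>2 \<partial>M) \<le> (b i)\<^sup>2"
      by (intro integral_le_const bounded_integrable[where B="(b i)\<^sup>2"]) auto
  qed
  finally show ?thesis
    using l by (simp add: abs_le_square_iff[symmetric] field_simps)
qed

end

text \<open>Freezing the past turns the factor
  \<open>exp (\<theta> * a j \<omega> * \<zeta> j \<omega>)\<close> into
  \<open>exp ((\<theta> * a j \<omega>)\<^sup>2 / 2)\<close>. This is at least \<open>1\<close>,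
  which gives a submartingale, and at most its value for the deterministic bound \<open>b j\<close>,
  which gives a moment bound.\<close>

lemma exp_transform_step:
  assumes "j < N" and S: "integrable M (\<lambda>\<omega>. exp (\<theta> * transform a (\<lambda>x. x) j \<omega>))"
  shows "integrable M (\<lambda>\<omega>. exp (\<theta> * transform a (\<lambda>x. x) (Suc j) \<omega>))"
    and "A \<in> sets (past j) \<Longrightarrow> (\<integral>\<omega>. indicator A \<omega> * exp (\<theta> * transform a (\<lambda>x. x) (Suc j) \<omega>) \<partial>M)
      = (\<integral>\<omega>. indicator A \<omega> * exp (\<theta> * transform a (\<lambda>x. x) j \<omega>) * exp ((\<theta> * a j \<omega>)\<^sup>2 / 2) \<partial>M)"
proof -
  let ?S = "transform a (\<lambda>x. x) j"
  have Sp: "?S \<in> borel_measurable (past j)"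
    using assms a_past by (intro transform_past) auto
  have ap: "a j \<in> borel_measurable (past j)" using a_past assms by auto
  have eS: "(\<lambda>\<omega>. exp (\<theta> * ?S \<omega>)) \<in> borel_measurable (past j)"
    using Sp by measurable
  have M: "?S \<in> borel_measurable M" "a j \<in> borel_measurable M" "\<zeta> j \<in> borel_measurable M"
    using past_imp[OF Sp] past_imp[OF ap] assms measurable_zeta by auto
  note I = expectation_mult_zeta(1)[OF assms(1) eS S _ std_normal_exp_moment(1)]
  \<comment> \<open>The random coefficient is removed by the bound \<open>b j\<close>: depending on
    the sign of \<open>\<zeta> j \<omega>\<close>, one of two exponentials with deterministic rates
    dominates.\<close>
  have int: "integrable M (\<lambda>\<omega>. exp (\<theta> * ?S \<omega>) * exp (\<theta> * a j \<omega> * \<zeta> j \<omega>))"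
  proof (rule Bochner_Integration.integrable_bound)
    show "integrable M (\<lambda>\<omega>. exp (\<theta> * ?S \<omega>) * exp ((\<bar>\<theta>\<bar> * b j) * \<zeta> j \<omega>) + exp (\<theta> * ?S \<omega>) * exp ((- (\<bar>\<theta>\<bar> * b j)) * \<zeta> j \<omega>))"
      by (intro Bochner_Integration.integrable_add I) auto
    have "exp (\<theta> * a j \<omega> * \<zeta> j \<omega>) \<le> exp ((\<bar>\<theta>\<bar> * b j) * \<zeta> j \<omega>) + exp ((- (\<bar>\<theta>\<bar> * b j)) * \<zeta> j \<omega>)" for \<omega>
    proof -
      have "\<theta> * a j \<omega> * \<zeta> j \<omega> \<le> \<bar>\<theta>\<bar> * b j * \<bar>\<zeta> j \<omega>\<bar>"
      proof (rule order_trans[OF abs_ge_self])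
        show "\<bar>\<theta> * a j \<omega> * \<zeta> j \<omega>\<bar> \<le> \<bar>\<theta>\<bar> * b j * \<bar>\<zeta> j \<omega>\<bar>"
          unfolding abs_mult using a_bound[of j \<omega>] b_nonneg[of j] by (intro mult_mono) auto
      qed
      then have "\<theta> * a j \<omega> * \<zeta> j \<omega> \<le> (\<bar>\<theta>\<bar> * b j) * \<zeta> j \<omega> \<or> \<theta> * a j \<omega> * \<zeta> j \<omega> \<le> (- (\<bar>\<theta>\<bar> * b j)) * \<zeta> j \<omega>"
        by (cases "\<zeta> j \<omega> \<ge> 0") auto
      then show ?thesis
        by (smt (verit, best) exp_ge_zero exp_le_cancel_iff)
    qed
    then show "AE x in M. norm (exp (\<theta> * ?S x) * exp (\<theta> * a j x * \<zeta> j x))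
         \<le> norm (exp (\<theta> * ?S x) * exp (\<bar>\<theta>\<bar> * b j * \<zeta> j x) + exp (\<theta> * ?S x) * exp (- (\<bar>\<theta>\<bar> * b j) * \<zeta> j x))"
      by (intro AE_I2) (simp only: real_norm_def abs_mult abs_exp_cancel distrib_left[symmetric], simp)
  qed (use M in measurable)
  have eq: "exp (\<theta> * transform a (\<lambda>x. x) (Suc j) \<omega>) = exp (\<theta> * ?S \<omega>) * exp (\<theta> * a j \<omega> * \<zeta> j \<omega>)" for \<omega>
    by (simp add: transform_Suc algebra_simps flip: exp_add)
  show "integrable M (\<lambda>\<omega>. exp (\<theta> * transform a (\<lambda>x. x) (Suc j) \<omega>))"
    unfolding eq by (rule int)
  assume A: "A \<in> sets (past j)"
  have AM: "A \<in> sets M" using sets_past_imp[OF A] assms by auto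
  define X where "X \<omega> = (indicator A \<omega> * exp (\<theta> * ?S \<omega>), \<theta> * a j \<omega>)" for \<omega>
  define g :: "(real \<times> real) \<times> real \<Rightarrow> real" where "g = (\<lambda>z. fst (fst z) * exp (snd (fst z) * snd z))"
  have X: "X \<in> measurable (past j) (borel \<Otimes>\<^sub>M borel)"
    unfolding X_def using A Sp ap by measurable
  have g: "g \<in> borel_measurable ((borel \<Otimes>\<^sub>M borel) \<Otimes>\<^sub>M borel)"
    unfolding g_def by measurable
  have "integrable M (\<lambda>\<omega>. g (X \<omega>, \<zeta> j \<omega>))"
    using integrable_indicator_mult[OF AM int] by (simp add: g_def X_def mult_ac)
  from expectation_fun_zeta[OF assms(1) X g this]
  have "(\<integral>\<omega>. g (X \<omega>, \<zeta> j \<omega>) \<partial>M) = (\<integral>\<omega>. indicator A \<omega> * exp (\<theta> * ?S \<omega>) * exp ((\<theta> * a j \<omega>)\<^sup>2 / 2) \<partial>M)"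
    by (simp add: g_def X_def std_normal_exp_moment)
  then show "(\<integral>\<omega>. indicator A \<omega> * exp (\<theta> * transform a (\<lambda>x. x) (Suc j) \<omega>) \<partial>M)
      = (\<integral>\<omega>. indicator A \<omega> * exp (\<theta> * transform a (\<lambda>x. x) j \<omega>) * exp ((\<theta> * a j \<omega>)\<^sup>2 / 2) \<partial>M)"
    by (simp add: g_def X_def eq mult.assoc)
qed

lemma exp_transform_integrable: "j \<le> N \<Longrightarrow> integrable M (\<lambda>\<omega>. exp (\<theta> * transform a (\<lambda>x. x) j \<omega>))"
proof (induction j)
  case 0 then show ?case by (simp add: transform_def)
next
  case (Suc j) then show ?case using exp_transform_step(1)[of j] by simp
qed

lemma integrable_exp_transform_weight:
  assumes "j < N" "A \<in> sets (past j)"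
  shows "integrable M (\<lambda>\<omega>. indicator A \<omega> * exp (\<theta> * transform a (\<lambda>x. x) j \<omega>) * exp ((\<theta> * a j \<omega>)\<^sup>2 / 2))"
proof (rule Bochner_Integration.integrable_bound)
  let ?S = "transform a (\<lambda>x. x) j"
  have Sp: "?S \<in> borel_measurable (past j)"
    using assms a_past by (intro transform_past) auto
  have [measurable]: "?S \<in> borel_measurable M" "a j \<in> borel_measurable M" "A \<in> sets M"
    using past_imp[OF Sp] past_imp[OF a_past] assms sets_past_imp by auto
  show "integrable M (\<lambda>\<omega>. exp ((\<theta> * b j)\<^sup>2 / 2) * exp (\<theta> * ?S \<omega>))"
    using exp_transform_integrable[of j] assms by auto
  show "(\<lambda>\<omega>. indicator A \<omega> * exp (\<theta> * ?S \<omega>) * exp ((\<theta> * a j \<omega>)\<^sup>2 / 2)) \<in> borel_measurable M"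
    by measurable
  have "(\<theta> * a j \<omega>)\<^sup>2 \<le> (\<theta> * b j)\<^sup>2" for \<omega>
    using a_bound[of j \<omega>] b_nonneg[of j] by (auto simp: power_mult_distrib abs_le_square_iff[symmetric] intro!: mult_left_mono)
  then show "AE x in M. norm (indicator A x * exp (\<theta> * ?S x) * exp ((\<theta> * a j x)\<^sup>2 / 2))
     \<le> norm (exp ((\<theta> * b j)\<^sup>2 / 2) * exp (\<theta> * ?S x))"
    by (auto simp: indicator_def abs_mult)
qed

lemma exp_transform_expectation:
  "j \<le> N \<Longrightarrow> (\<integral>\<omega>. exp (\<theta> * transform a (\<lambda>x. x) j \<omega>) \<partial>M) \<le> exp (\<theta>\<^sup>2 / 2 * (\<Sum>i<j. (b i)\<^sup>2))"
proof (induction j)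
  case 0 then show ?case by (simp add: transform_def prob_space)
next
  case (Suc j)
  let ?S = "transform a (\<lambda>x. x) j"
  have sp: "space M \<in> sets (past j)" using sets.top[of "past j"] by simp
  have "(\<integral>\<omega>. exp (\<theta> * transform a (\<lambda>x. x) (Suc j) \<omega>) \<partial>M) = 
    (\<integral>\<omega>. indicator (space M) \<omega> * exp (\<theta> * ?S \<omega>) * exp ((\<theta> * a j \<omega>)\<^sup>2 / 2) \<partial>M)"
    using exp_transform_step(2)[OF _ exp_transform_integrable sp, of \<theta>] Suc.prems
    by (simp cong: Bochner_Integration.integral_cong)
  also have "\<dots> \<le> (\<integral>\<omega>. exp ((\<theta> * b j)\<^sup>2 / 2) * exp (\<theta> * ?S \<omega>) \<partial>M)"
  proof (rule integral_mono)
    have "(\<theta> * a j \<omega>)\<^sup>2 \<le> (\<theta> * b j)\<^sup>2" for \<omega>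
      using a_bound[of j \<omega>] b_nonneg[of j] by (auto simp: power_mult_distrib abs_le_square_iff[symmetric] intro!: mult_left_mono)
    then show "indicator (space M) \<omega> * exp (\<theta> * ?S \<omega>) * exp ((\<theta> * a j \<omega>)\<^sup>2 / 2) \<le> exp ((\<theta> * b j)\<^sup>2 / 2) * exp (\<theta> * ?S \<omega>)" for \<omega>
      by (auto simp: indicator_def)
  qed (use Suc.prems integrable_exp_transform_weight[OF _ sp] exp_transform_integrable[of j] in auto)
  also have "\<dots> = exp ((\<theta> * b j)\<^sup>2 / 2) * (\<integral>\<omega>. exp (\<theta> * ?S \<omega>) \<partial>M)" by simp
  also have "\<dots> \<le> exp ((\<theta> * b j)\<^sup>2 / 2) * exp (\<theta>\<^sup>2 / 2 * (\<Sum>i<j. (b i)\<^sup>2))"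
    using Suc by (intro mult_left_mono) auto
  also have "\<dots> = exp (\<theta>\<^sup>2 / 2 * (\<Sum>i<Suc j. (b i)\<^sup>2))"
    by (simp add: power_mult_distrib algebra_simps flip: exp_add)
  finally show ?case .
qed

lemma exp_maximal_one_sided:
  assumes "n \<le> N"
  shows "prob {\<omega> \<in> space M. \<exists>j\<le>n. l \<le> \<theta> * transform a (\<lambda>x. x) j \<omega>} \<le> exp (\<theta>\<^sup>2 / 2 * (\<Sum>i<n. (b i)\<^sup>2) - l)"
proof -
  let ?S = "transform a (\<lambda>x. x)"
  have "exp l * prob {\<omega> \<in> space M. \<exists>j\<le>n. exp l \<le> exp (\<theta> * ?S j \<omega>)} \<le> (\<integral>\<omega>. exp (\<theta> * ?S n \<omega>) \<partial>M)"
  proof (rule doob_maximal[OF _ _ _ assms])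
    fix j A assume j: "j < n" "A \<in> sets (past j)"
    have AM: "A \<in> sets M" using sets_past_imp[OF j(2)] j assms by auto
    have "(\<integral>\<omega>. indicator A \<omega> * exp (\<theta> * ?S j \<omega>) \<partial>M) \<le> 
       (\<integral>\<omega>. indicator A \<omega> * exp (\<theta> * ?S j \<omega>) * exp ((\<theta> * a j \<omega>)\<^sup>2 / 2) \<partial>M)"
      using j assms integrable_exp_transform_weight[OF _ j(2)] integrable_indicator_mult[OF AM exp_transform_integrable[of j]]
      by (intro integral_mono) (auto simp: indicator_def)
    then show "(\<integral>\<omega>. indicator A \<omega> * exp (\<theta> * ?S j \<omega>) \<partial>M) \<le> (\<integral>\<omega>. indicator A \<omega> * exp (\<theta> * ?S (Suc j) \<omega>) \<partial>M)"
      using exp_transform_step(2)[OF _ exp_transform_integrable j(2)] j assms by simp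
  next
    fix j assume "j \<le> n"
    then have "?S j \<in> borel_measurable (past j)"
      using assms a_past by (intro transform_past) auto
    then show "(\<lambda>\<omega>. exp (\<theta> * ?S j \<omega>)) \<in> borel_measurable (past j)" by measurable
  qed (use exp_transform_integrable assms in auto)
  also have "\<dots> \<le> exp (\<theta>\<^sup>2 / 2 * (\<Sum>i<n. (b i)\<^sup>2))"
    by (rule exp_transform_expectation[OF assms])
  finally have "exp (- l) * (exp l * prob {\<omega> \<in> space M. \<exists>j\<le>n. exp l \<le> exp (\<theta> * ?S j \<omega>)})
      \<le> exp (- l) * exp (\<theta>\<^sup>2 / 2 * (\<Sum>i<n. (b i)\<^sup>2))"
    by (intro mult_left_mono) auto
  moreover have "exp (- l) * (exp l * x) = x" for x by (simp flip: mult.assoc exp_add)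
  moreover have "exp (- l) * exp (\<theta>\<^sup>2 / 2 * (\<Sum>i<n. (b i)\<^sup>2)) = exp (\<theta>\<^sup>2 / 2 * (\<Sum>i<n. (b i)\<^sup>2) - l)"
    by (simp flip: exp_add)
  ultimately show ?thesis by (simp only: exp_le_cancel_iff)
qed

text \<open>Chernoff's argument for both signs with \<open>\<theta> = l / v\<close>, the minimiser
  of \<open>\<theta>\<^sup>2 * v / 2 - \<theta> * l\<close>. The exponential rate is what survives a
  union over many blocks.\<close>

lemma gaussian_maximal:
  assumes "n \<le> N" "0 < l" and v: "(\<Sum>i<n. (b i)\<^sup>2) \<le> v" "0 < v"
  shows "prob {\<omega> \<in> space M. \<exists>j\<le>n. l \<le> \<bar>transform a (\<lambda>x. x) j \<omega>\<bar>} \<le> 2 * exp (- l\<^sup>2 / (2 * v))"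
proof -
  let ?S = "transform a (\<lambda>x. x)"
  define E where "E s = {\<omega> \<in> space M. \<exists>j\<le>n. l\<^sup>2 / v \<le> (s * l / v) * ?S j \<omega>}" for s :: real
  have S: "?S j \<in> borel_measurable M" if "j \<le> n" for j
    using past_imp[OF transform_past[OF a_past, of j "\<lambda>x. x"]] that assms by auto
  have ES: "E s \<in> sets M" for s
  proof -
    have "E s = (\<Union>j\<in>{..n}. {\<omega> \<in> space M. l\<^sup>2 / v \<le> (s * l / v) * ?S j \<omega>})" by (auto simp: E_def)
    also have "\<dots> \<in> sets M" using S by (intro sets.finite_UN) auto
    finally show ?thesis .
  qed
  have P: "prob (E s) \<le> exp (- l\<^sup>2 / (2 * v))" if "s\<^sup>2 = 1" for s
  proof -
    have "prob (E s) \<le> exp ((s * l / v)\<^sup>2 / 2 * (\<Sum>i<n. (b i)\<^sup>2) - l\<^sup>2 / v)"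
      unfolding E_def by (rule exp_maximal_one_sided[OF assms(1)])
    also have "(s * l / v)\<^sup>2 / 2 * (\<Sum>i<n. (b i)\<^sup>2) \<le> (s * l / v)\<^sup>2 / 2 * v"
      using v by (intro mult_left_mono) auto
    then have "exp ((s * l / v)\<^sup>2 / 2 * (\<Sum>i<n. (b i)\<^sup>2) - l\<^sup>2 / v) \<le> exp ((s * l / v)\<^sup>2 / 2 * v - l\<^sup>2 / v)" by simp
    also have "(s * l / v)\<^sup>2 / 2 * v - l\<^sup>2 / v = - l\<^sup>2 / (2 * v)"
      using v that by (simp add: power2_eq_square field_simps)
    finally show ?thesis by simp
  qed
  have "{\<omega> \<in> space M. \<exists>j\<le>n. l \<le> \<bar>?S j \<omega>\<bar>} \<subseteq> E 1 \<union> E (-1)"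
  proof
    fix \<omega> assume "\<omega> \<in> {\<omega> \<in> space M. \<exists>j\<le>n. l \<le> \<bar>?S j \<omega>\<bar>}"
    then obtain j where j: "\<omega> \<in> space M" "j \<le> n" "l \<le> \<bar>?S j \<omega>\<bar>" by auto
    then have jj: "l \<le> ?S j \<omega> \<or> l \<le> - ?S j \<omega>" by linarith
    have "l / v * l \<le> l / v * x" if "l \<le> x" for x using that assms by (intro mult_left_mono) auto
    then have "l\<^sup>2 / v \<le> l / v * x" if "l \<le> x" for x using that by (simp add: power2_eq_square)
    from jj this[of "?S j \<omega>"] this[of "- ?S j \<omega>"] show "\<omega> \<in> E 1 \<union> E (-1)"
      using j(1,2) by (auto simp: E_def)
  qed
  then have "prob {\<omega> \<in> space M. \<exists>j\<le>n. l \<le> \<bar>?S j \<omega>\<bar>} \<le> prob (E 1 \<union> E (-1))"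
    using ES by (intro finite_measure_mono) auto
  also have "\<dots> \<le> prob (E 1) + prob (E (-1))" using ES by (intro measure_Un_le)
  also have "\<dots> \<le> 2 * exp (- l\<^sup>2 / (2 * v))" using P[of 1] P[of "-1"] by simp
  finally show ?thesis .
qed

end

section \<open>Exact normality of transforms with unit variance\<close>

context
  fixes a :: "nat \<Rightarrow> 'a \<Rightarrow> real" and b :: "nat \<Rightarrow> real"
  assumes a_past: "\<And>i. i < N \<Longrightarrow> a i \<in> borel_measurable (past i)"
    and a_bound: "\<And>i \<omega>. \<bar>a i \<omega>\<bar> \<le> b i"
begin

text \<open>With the compensator in the exponent the conditional characteristic function is exactly \<open>1\<close>.\<close>

lemma char_transform:
  fixes \<theta> :: real
  assumes A: "A \<in> sets (past k)" and kj: "k \<le> j" "j \<le> N" and zero: "\<And>i \<omega>. i < k \<Longrightarrow> a i \<omega> = 0"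
  shows "(\<integral>\<omega>. indicator A \<omega> * (iexp (\<theta> * transform a (\<lambda>x. x) j \<omega>)
    * of_real (exp (\<theta>\<^sup>2 / 2 * (\<Sum>i<j. (a i \<omega>)\<^sup>2)))) \<partial>M) = prob A"
  using kj
proof (induction j rule: dec_induct)
  case base
  have "A \<in> sets M" using sets_past_imp[OF A] kj by auto
  have "(\<integral>\<omega>. indicator A \<omega> * (iexp (\<theta> * transform a (\<lambda>x. x) k \<omega>)
    * of_real (exp (\<theta>\<^sup>2 / 2 * (\<Sum>i<k. (a i \<omega>)\<^sup>2)))) \<partial>M) = (\<integral>\<omega>. complex_of_real (indicator A \<omega>) \<partial>M)"
    using zero by (intro Bochner_Integration.integral_cong) (auto simp: transform_def indicator_def)
  also have "\<dots> = prob A"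
    using \<open>A \<in> sets M\<close> by (subst integral_complex_of_real) simp
  finally show ?case .
next
  case (step j)
  let ?S = "transform a (\<lambda>x. x)" and ?Q = "\<lambda>j \<omega>. \<Sum>i<j. (a i \<omega>)\<^sup>2"
  have j: "j < N" using step by simp
  have [measurable]: "a i \<in> borel_measurable (past j)" if "i \<le> j" for i
    using past_le[OF a_past that] that j by auto
  have [measurable]: "?S j \<in> borel_measurable (past j)"
    using j a_past by (intro transform_past) auto
  have [measurable]: "A \<in> sets (past j)"
    using A past_mono[OF step(1)] by (auto simp: subalgebra_def)
  have [measurable]: "(\<lambda>\<omega>. ?Q (Suc j) \<omega>) \<in> borel_measurable (past j)"
    by (intro borel_measurable_sum borel_measurable_power) auto
  \<comment> \<open>The compensator up to \<open>Suc j\<close> belongs to \<open>past j\<close>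
    because \<open>a j\<close> is predictable, so a single factor remains random once the past is
    frozen.\<close>
  define X where "X \<omega> = (indicator A \<omega> * (iexp (\<theta> * ?S j \<omega>) * of_real (exp (\<theta>\<^sup>2 / 2 * ?Q (Suc j) \<omega>))) :: complex, \<theta> * a j \<omega>)" for \<omega>
  define g :: "(complex \<times> real) \<times> real \<Rightarrow> complex" where "g = (\<lambda>z. fst (fst z) * iexp (snd (fst z) * snd z))"
  have X: "X \<in> measurable (past j) (borel \<Otimes>\<^sub>M borel)"
    unfolding X_def by measurable
  have g: "g \<in> borel_measurable ((borel \<Otimes>\<^sub>M borel) \<Otimes>\<^sub>M borel)"
    unfolding g_def by measurable
  have eq: "g (X \<omega>, \<zeta> j \<omega>) = indicator A \<omega> * (iexp (\<theta> * ?S (Suc j) \<omega>) * of_real (exp (\<theta>\<^sup>2 / 2 * ?Q (Suc j) \<omega>)))" for \<omega>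
    by (simp add: g_def X_def transform_Suc algebra_simps flip: exp_add)
  have [measurable]: "(\<lambda>\<omega>. g (X \<omega>, \<zeta> j \<omega>)) \<in> borel_measurable M"
    using past_imp[OF X] j measurable_zeta[OF j] by (intro measurable_compose[OF _ g] measurable_Pair) auto
  have int: "integrable M (\<lambda>\<omega>. g (X \<omega>, \<zeta> j \<omega>))"
  proof (rule bounded_integrable[where B = "exp (\<theta>\<^sup>2 / 2 * (\<Sum>i<Suc j. (b i)\<^sup>2))"])
    fix \<omega>
    have "(a i \<omega>)\<^sup>2 \<le> (b i)\<^sup>2" for i
      using a_bound[of i \<omega>] abs_le_square_iff[of "a i \<omega>" "b i"] by linarith
    then have "?Q (Suc j) \<omega> \<le> (\<Sum>i<Suc j. (b i)\<^sup>2)" by (intro sum_mono) auto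
    then have "exp (\<theta>\<^sup>2 / 2 * ?Q (Suc j) \<omega>) \<le> exp (\<theta>\<^sup>2 / 2 * (\<Sum>i<Suc j. (b i)\<^sup>2))"
      by (subst exp_le_cancel_iff, intro mult_left_mono) auto
    then show "norm (g (X \<omega>, \<zeta> j \<omega>)) \<le> exp (\<theta>\<^sup>2 / 2 * (\<Sum>i<Suc j. (b i)\<^sup>2))"
      unfolding eq by (simp add: norm_mult indicator_def del: sum.lessThan_Suc)
  qed simp
  have chi: "(\<integral>x. iexp (t * x) \<partial>std_normal_distribution) = complex_of_real (exp (- t\<^sup>2 / 2))" for t :: real
    using fun_cong[OF char_std_normal_distribution, of t] by (simp add: char_def)
  have "(\<integral>\<omega>. indicator A \<omega> * (iexp (\<theta> * ?S (Suc j) \<omega>) * of_real (exp (\<theta>\<^sup>2 / 2 * ?Q (Suc j) \<omega>))) \<partial>M)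
     = (\<integral>\<omega>. (\<integral>x. g (X \<omega>, x) \<partial>std_normal_distribution) \<partial>M)"
    unfolding eq[symmetric] by (rule expectation_fun_zeta[OF j X g int])
  also have "\<dots> = (\<integral>\<omega>. indicator A \<omega> * (iexp (\<theta> * ?S j \<omega>) * of_real (exp (\<theta>\<^sup>2 / 2 * ?Q j \<omega>))) \<partial>M)"
  proof (rule Bochner_Integration.integral_cong)
    fix \<omega>
    have "exp (\<theta>\<^sup>2 / 2 * ?Q (Suc j) \<omega>) * exp (- (\<theta> * a j \<omega>)\<^sup>2 / 2) = exp (\<theta>\<^sup>2 / 2 * ?Q j \<omega>)"
      by (simp add: power_mult_distrib algebra_simps add_divide_distrib flip: exp_add)
    then have E: "complex_of_real (exp (\<theta>\<^sup>2 / 2 * ?Q (Suc j) \<omega>)) * complex_of_real (exp (- (\<theta> * a j \<omega>)\<^sup>2 / 2))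
        = complex_of_real (exp (\<theta>\<^sup>2 / 2 * ?Q j \<omega>))"
      by (metis of_real_mult)
    have "(\<integral>x. g (X \<omega>, x) \<partial>std_normal_distribution) = fst (X \<omega>) * (\<integral>x. iexp (snd (X \<omega>) * x) \<partial>std_normal_distribution)"
      by (simp add: g_def case_prod_beta')
    also have "\<dots> = indicator A \<omega> * iexp (\<theta> * ?S j \<omega>) * (complex_of_real (exp (\<theta>\<^sup>2 / 2 * ?Q (Suc j) \<omega>)) * complex_of_real (exp (- (\<theta> * a j \<omega>)\<^sup>2 / 2)))"
      unfolding chi by (simp only: X_def fst_conv snd_conv mult_ac)
    finally show "(\<integral>x. g (X \<omega>, x) \<partial>std_normal_distribution) =
       indicator A \<omega> * (iexp (\<theta> * ?S j \<omega>) * of_real (exp (\<theta>\<^sup>2 / 2 * ?Q j \<omega>)))"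
      unfolding E by (simp only: mult_ac)
  qed simp
  also have "\<dots> = prob A" using step by simp
  finally show ?case .
qed

text \<open>When the squared coefficients add up to exactly \<open>1\<close>, the compensator in
  \<open>char_transform\<close> is the constant \<open>exp (\<theta>\<^sup>2 / 2)\<close> and can be
  divided out. Under the conditional law given \<open>A\<close> the characteristic function is then
  the standard normal one, so the sum is normal and independent of what happened before its first
  coefficient.\<close>

lemma transform_gaussian_given_past:
  assumes A: "A \<in> sets (past k)" and k: "k \<le> N" and zero: "\<And>i \<omega>. i < k \<Longrightarrow> a i \<omega> = 0"
    and one: "\<And>\<omega>. \<omega> \<in> space M \<Longrightarrow> (\<Sum>i<N. (a i \<omega>)\<^sup>2) = 1" and B: "B \<in> sets borel"
  shows "prob (A \<inter> (transform a (\<lambda>x. x) N -` B \<inter> space M)) = prob A * measure std_normal_distribution B"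
proof (cases "prob A = 0")
  case True
  have AM: "A \<in> sets M" using sets_past_imp[OF A k] .
  have "prob (A \<inter> (transform a (\<lambda>x. x) N -` B \<inter> space M)) \<le> prob A"
    using AM by (intro finite_measure_mono) auto
  then show ?thesis using True measure_nonneg[of M "A \<inter> (transform a (\<lambda>x. x) N -` B \<inter> space M)"] by auto
next
  case False
  let ?S = "transform a (\<lambda>x. x) N"
  have AM[measurable]: "A \<in> sets M" using sets_past_imp[OF A k] .
  have SM[measurable]: "?S \<in> borel_measurable M"
    using past_imp[OF transform_past[OF a_past, of N "\<lambda>x. x"]] by auto
  have p: "0 < prob A" using False by (simp add: zero_less_measure_iff)
  \<comment> \<open>The conditional probability given \<open>A\<close>, written as a density; it
    makes sense because the null case was split off.\<close>
  define M' where "M' = density M (\<lambda>\<omega>. ennreal (indicator A \<omega> / prob A))"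
  have int': "(\<integral>\<omega>. f \<omega> \<partial>M') = (\<integral>\<omega>. (indicator A \<omega> / prob A) *\<^sub>R f \<omega> \<partial>M)"
    if "f \<in> borel_measurable M" for f :: "'a \<Rightarrow> 'c::{banach, second_countable_topology}"
    unfolding M'_def using that p by (intro integral_density) auto
  have "emeasure M' (space M') = (\<integral>\<^sup>+ \<omega>. ennreal (indicator A \<omega> / prob A) * indicator (space M) \<omega> \<partial>M)"
    by (simp add: M'_def emeasure_density)
  also have "\<dots> = (\<integral>\<^sup>+ \<omega>. ennreal (1 / prob A) * indicator A \<omega> \<partial>M)"
    using sets.sets_into_space[OF AM] by (intro nn_integral_cong) (auto simp: indicator_def)
  also have "\<dots> = 1"
    using p by (simp add: nn_integral_cmult emeasure_eq_measure flip: ennreal_mult)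
  finally interpret M': prob_space M' by (rule prob_spaceI)
  have meas: "M'.prob C = prob (A \<inter> C) / prob A" if "C \<in> sets M" for C
  proof -
    have "M'.prob C = (\<integral>\<omega>. indicator C \<omega> \<partial>M')"
      using that by (simp add: M'_def)
    also have "\<dots> = (\<integral>\<omega>. (1 / prob A) * indicator (A \<inter> C) \<omega> \<partial>M)"
      using that by (subst int') (auto intro!: Bochner_Integration.integral_cong simp: indicator_def)
    finally show ?thesis using that by simp
  qed
  have SM': "?S \<in> borel_measurable M'" by (simp add: M'_def)
  have rd: "real_distribution (distr M' borel ?S)"
    using M'.real_distribution_distr[OF SM'] .
  have ch: "char (distr M' borel ?S) = char std_normal_distribution"
  proof
    fix \<theta>
    have 1: "(\<integral>\<omega>. indicator A \<omega> * (iexp (\<theta> * ?S \<omega>) * complex_of_real (exp (\<theta>\<^sup>2 / 2))) \<partial>M) = prob A"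
      using char_transform[OF A k order_refl zero, of \<theta>] one by (simp cong: Bochner_Integration.integral_cong)
    have "char (distr M' borel ?S) \<theta> = (\<integral>\<omega>. iexp (\<theta> * ?S \<omega>) \<partial>M')"
      unfolding char_def by (rule integral_distr[OF SM']) auto
    also have "\<dots> = (\<integral>\<omega>. (indicator A \<omega> / prob A) *\<^sub>R iexp (\<theta> * ?S \<omega>) \<partial>M)"
      by (rule int') measurable
    also have "\<dots> = (\<integral>\<omega>. (complex_of_real (exp (- (\<theta>\<^sup>2) / 2)) / prob A) * (indicator A \<omega> * (iexp (\<theta> * ?S \<omega>) * complex_of_real (exp (\<theta>\<^sup>2 / 2)))) \<partial>M)"
    proof (rule Bochner_Integration.integral_cong)
      fix \<omega>
      have "complex_of_real (exp (- (\<theta>\<^sup>2) / 2)) * complex_of_real (exp (\<theta>\<^sup>2 / 2)) = 1"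
        by (simp flip: of_real_mult exp_add)
      then show "(indicator A \<omega> / prob A) *\<^sub>R iexp (\<theta> * ?S \<omega>) = (complex_of_real (exp (- (\<theta>\<^sup>2) / 2)) / prob A) * (indicator A \<omega> * (iexp (\<theta> * ?S \<omega>) * complex_of_real (exp (\<theta>\<^sup>2 / 2))))"
        by (simp add: indicator_def scaleR_conv_of_real)
    qed simp
    also have "\<dots> = (complex_of_real (exp (- (\<theta>\<^sup>2) / 2)) / prob A) * prob A"
      using 1 by simp
    also have "\<dots> = char std_normal_distribution \<theta>"
      using p by (simp add: char_std_normal_distribution)
    finally show "char (distr M' borel ?S) \<theta> = char std_normal_distribution \<theta>" .
  qed
  have "distr M' borel ?S = std_normal_distribution"
    by (rule Levy_uniqueness[OF rd real_dist_normal_dist ch])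
  then have "measure std_normal_distribution B = M'.prob (?S -` B \<inter> space M')"
    using measure_distr[OF SM' B] by simp
  also have "?S -` B \<inter> space M' = ?S -` B \<inter> space M" by (simp add: M'_def)
  also have "M'.prob (?S -` B \<inter> space M) = prob (A \<inter> (?S -` B \<inter> space M)) / prob A"
    using measurable_sets[OF SM B] by (rule meas)
  finally show ?thesis using p by simp
qed

end

text \<open>Earlier block sums are measurable with respect to the past at the start of the next
  block, and given that past the next sum is standard normal. The product formula follows by
  induction on the number of blocks, with membership in the past carried along.\<close>

lemma distr_block_transforms:
  fixes a :: "nat \<Rightarrow> nat \<Rightarrow> 'a \<Rightarrow> real" and st :: "nat \<Rightarrow> nat"
  assumes K: "0 < K" and st: "\<And>k. k < K \<Longrightarrow> st k \<le> st (Suc k)" "st K \<le> N"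
    and a_past: "\<And>k i. k < K \<Longrightarrow> i < N \<Longrightarrow> a k i \<in> borel_measurable (past i)"
    and a_bound: "\<And>k i \<omega>. k < K \<Longrightarrow> \<bar>a k i \<omega>\<bar> \<le> b i"
    and supp: "\<And>k i \<omega>. k < K \<Longrightarrow> i < st k \<or> st (Suc k) \<le> i \<Longrightarrow> a k i \<omega> = 0"
    and one: "\<And>k \<omega>. k < K \<Longrightarrow> \<omega> \<in> space M \<Longrightarrow> (\<Sum>i<N. (a k i \<omega>)\<^sup>2) = 1"
  shows "distr M (\<Pi>\<^sub>M k\<in>{..<K}. borel) (\<lambda>\<omega>. \<lambda>k\<in>{..<K}. transform (a k) (\<lambda>x. x) N \<omega>) = (\<Pi>\<^sub>M k\<in>{..<K}. std_normal_distribution)"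
proof -
  define S where "S k = transform (a k) (\<lambda>x. x) N" for k
  have st_le: "st k \<le> N" if "k \<le> K" for k
    using that
  proof (induction k rule: inc_induct)
    case (step m) then show ?case using st(1)[of m] by simp
  qed (rule st(2))
  have S_past: "S k \<in> borel_measurable (past (st (Suc k)))" if k: "k < K" for k
  proof -
    have le: "st (Suc k) \<le> N" using st_le[of "Suc k"] k by simp
    have eq: "S k = transform (a k) (\<lambda>x. x) (st (Suc k))"
    proof
      fix \<omega> show "S k \<omega> = transform (a k) (\<lambda>x. x) (st (Suc k)) \<omega>"
        unfolding S_def transform_def using supp[OF k] le
        by (intro sum.mono_neutral_right) auto
    qed
    show ?thesis unfolding eq
      by (rule transform_past) (use a_past[OF k] le in simp_all)
  qed
  have SM: "S k \<in> borel_measurable M" if "k < K" for k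
    using past_imp[OF S_past[OF that]] st_le[of "Suc k"] that by auto
  have given: "prob (A \<inter> (S k -` B \<inter> space M)) = prob A * measure std_normal_distribution B"
    if "k < K" "A \<in> sets (past (st k))" "B \<in> sets borel" for k A B
    unfolding S_def using that st_le[of k]
    by (intro transform_gaussian_given_past[OF a_past a_bound that(2)] supp one) auto
  have each: "prob (S k -` B \<inter> space M) = measure std_normal_distribution B" if "k < K" "B \<in> sets borel" for k B
  proof -
    have "space M \<in> sets (past (st k))" using sets.top[of "past (st k)"] by simp
    from given[OF that(1) this that(2)] show ?thesis by (simp add: prob_space Int_absorb1)
  qed
  have dS: "distr M borel (S k) = std_normal_distribution" if "k < K" for k
  proof (rule measure_eqI)
    fix B assume "B \<in> sets (distr M borel (S k))"
    then have B: "B \<in> sets borel" by simp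
    interpret G: prob_space std_normal_distribution
      using real_dist_normal_dist by (simp add: real_distribution_def)
    show "emeasure (distr M borel (S k)) B = emeasure std_normal_distribution B"
      using each[OF that B] B SM[OF that] by (simp add: emeasure_distr emeasure_eq_measure G.emeasure_eq_measure)
  qed simp
  have prod: "prob ((\<Inter>j<k. S j -` A j) \<inter> space M) = (\<Prod>j<k. measure std_normal_distribution (A j))
      \<and> (\<Inter>j<k. S j -` A j) \<inter> space M \<in> sets (past (st k))"
    if "k \<le> K" "\<And>j. j < K \<Longrightarrow> A j \<in> sets borel" for k A
    using that(1)
  proof (induction k)
    case 0
    then show ?case using sets.top[of "past (st 0)"] by (simp add: prob_space)
  next
    case (Suc k)
    let ?E = "(\<Inter>j<k. S j -` A j) \<inter> space M"
    have eq: "(\<Inter>j<Suc k. S j -` A j) \<inter> space M = ?E \<inter> (S k -` A k \<inter> space M)"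
      by (auto simp: less_Suc_eq)
    have "?E \<in> sets (past (st (Suc k)))"
      using Suc past_mono[OF st(1)[of k]] by (auto simp: subalgebra_def)
    moreover have "S k -` A k \<inter> space M \<in> sets (past (st (Suc k)))"
      using measurable_sets[OF S_past[of k] that(2)[of k]] Suc.prems by simp
    ultimately show ?case
      unfolding eq using given[of k ?E "A k"] Suc that(2)[of k] by auto
  qed
  have iv: "indep_vars (\<lambda>_. borel) S {..<K}"
  proof (subst indep_vars_finite[where E = "\<lambda>_. sets (borel :: real measure)"])
    show "\<forall>A\<in>{..<K} \<rightarrow> sets borel. prob (\<Inter>j<K. S j -` A j \<inter> space M) = (\<Prod>j<K. prob (S j -` A j \<inter> space M))"
    proof
      fix A assume A: "A \<in> {..<K} \<rightarrow> sets (borel :: real measure)"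
      have "(\<Inter>j<K. S j -` A j \<inter> space M) = (\<Inter>j<K. S j -` A j) \<inter> space M" using K by auto
      then show "prob (\<Inter>j<K. S j -` A j \<inter> space M) = (\<Prod>j<K. prob (S j -` A j \<inter> space M))"
        using prod[of K A] A each by (auto simp: Pi_iff)
    qed
  qed (use K SM in \<open>auto simp: sets.sigma_sets_eq[of borel, simplified] Int_stable_def\<close>)
  have "distr M (\<Pi>\<^sub>M k\<in>{..<K}. borel) (\<lambda>\<omega>. \<lambda>k\<in>{..<K}. S k \<omega>) = (\<Pi>\<^sub>M k\<in>{..<K}. distr M borel (S k))"
    using iv indep_vars_iff_distr_eq_PiM'[of "{..<K}" S "\<lambda>_. borel"] K SM by auto
  also have "\<dots> = (\<Pi>\<^sub>M k\<in>{..<K}. std_normal_distribution)"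
    by (intro PiM_cong) (auto simp: dS)
  finally show ?thesis by (simp add: S_def)
qed

end

section \<open>The martingale approximation\<close>

text \<open>Independence is a condition on finite subfamilies and ignores order, whereas the
  filtration depends on it. Reordering is what allows the filler of a block, taken from a later
  time, to be enumerated right after the steps of the block.\<close>

lemma (in prob_space) indep_vars_reindex_inj:
  assumes X: "indep_vars M' X I" and inj: "inj_on \<pi> J" and sub: "\<pi> ` J \<subseteq> I"
  shows "indep_vars (\<lambda>j. M' (\<pi> j)) (\<lambda>j. X (\<pi> j)) J"
  unfolding indep_vars_def2
proof (intro conjI ballI)
  fix j assume "j \<in> J"
  then show "random_variable (M' (\<pi> j)) (X (\<pi> j))" using X sub by (auto simp: indep_vars_def2)
next
  let ?F = "\<lambda>i. {X i -` A \<inter> space M | A. A \<in> sets (M' i)}"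
  have F: "indep_sets ?F I" using X by (simp add: indep_vars_def2)
  show "indep_sets (\<lambda>j. ?F (\<pi> j)) J"
  proof (rule indep_setsI)
    fix j assume "j \<in> J"
    then show "?F (\<pi> j) \<subseteq> events" using F sub by (auto simp: indep_sets_def)
  next
    fix A J' assume J': "J' \<noteq> {}" "J' \<subseteq> J" "finite J'" and A: "\<forall>j\<in>J'. A j \<in> ?F (\<pi> j)"
    define B where "B i = A (the_inv_into J' \<pi> i)" for i
    have inj': "inj_on \<pi> J'" using inj J' inj_on_subset by blast
    have BA: "B (\<pi> j) = A j" if "j \<in> J'" for j
      using that inj' by (simp add: B_def the_inv_into_f_f)
    have "prob (\<Inter>i\<in>\<pi> ` J'. B i) = (\<Prod>i\<in>\<pi> ` J'. prob (B i))"
      using J' sub A BA by (intro indep_setsD[OF F]) auto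
    then show "prob (\<Inter>j\<in>J'. A j) = (\<Prod>j\<in>J'. prob (A j))"
      using BA by (simp add: prod.reindex[OF inj'])
  qed
qed

lemma (in std_normal_sequence) std_normal_sequence_reindex:
  assumes "inj_on \<pi> {..<N'}" "\<pi> ` {..<N'} \<subseteq> {..<N}"
  shows "std_normal_sequence M (\<lambda>i. \<zeta> (\<pi> i)) N'"
  using indep_vars_reindex_inj[OF indep assms] distr_zeta assms(2)
  by unfold_locales (auto simp: image_subset_iff)

section \<open>Drifted Brownian motion observed on a grid\<close>

locale drifted_brownian_motion = standard_brownian_motion M "{0..}" W
  for M :: "'a measure" and W :: "real \<Rightarrow> 'a \<Rightarrow> real" +
  fixes \<mu> c :: real
  assumes c: "0 < c"
begin

definition path :: "'a \<Rightarrow> real \<Rightarrow> real" where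
  "path \<omega> s = W s \<omega> + \<mu> * s"

lemma path_continuous: "\<omega> \<in> space M \<Longrightarrow> continuous_on {0..} (path \<omega>)"
  unfolding path_def by (intro continuous_intros continuous_paths)

text \<open>The nodes are left general because the fillers come from increments whose length may
  differ from the mesh.\<close>

definition noise :: "(nat \<Rightarrow> real) \<Rightarrow> nat \<Rightarrow> 'a \<Rightarrow> real" where
  "noise t j \<omega> = (W (t (Suc j)) \<omega> - W (t j) \<omega>) / sqrt (t (Suc j) - t j)"

lemma noise_sequence:
  assumes t: "strict_mono t" "\<And>j. 0 \<le> t j"
  shows "std_normal_sequence M (noise t) N"
proof
  have pos: "0 < sqrt (t (Suc j) - t j)" for j using strict_monoD[OF t(1), of j "Suc j"] by simp
  have "indep_vars (\<lambda>_. borel) (\<lambda>i \<omega>. W (t (i + 1)) \<omega> - W (t i) \<omega>) {..<N}"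
    using t by (intro indep_increments) (auto simp: strict_mono_on_def strict_mono_def)
  from indep_vars_compose2[OF this, of "\<lambda>i x. x / sqrt (t (Suc i) - t i)" "\<lambda>_. borel"]
  show "indep_vars (\<lambda>_. borel) (noise t) {..<N}" by (simp add: noise_def[abs_def])
  fix i
  have "distributed M lborel (\<lambda>\<omega>. W (t (Suc i)) \<omega> - W (t i) \<omega>) (normal_density 0 (sqrt (t (Suc i) - t i)))"
    using t strict_monoD[OF t(1), of i "Suc i"] by (intro normal_increments) auto
  then have "distributed M lborel (noise t i) std_normal_density"
    using normal_standard_normal_convert[OF pos[of i], of "\<lambda>\<omega>. W (t (Suc i)) \<omega> - W (t i) \<omega>" 0] by (simp add: noise_def[abs_def])
  from distributed_distr_eq_density[OF this] show "distr M borel (noise t i) = std_normal_distribution"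
    by (metis distr_cong sets_lborel)
qed

abbreviation grid :: "real \<Rightarrow> nat \<Rightarrow> real" where
  "grid \<delta> \<equiv> \<lambda>j. real j * \<delta>"

definition incr :: "real \<Rightarrow> 'a \<Rightarrow> nat \<Rightarrow> real" where
  "incr \<delta> \<omega> = grid_increment \<delta> (path \<omega>)"

lemma incr_eq: "0 < \<delta> \<Longrightarrow> incr \<delta> \<omega> j = \<mu> * \<delta> + sqrt \<delta> * noise (grid \<delta>) j \<omega>"
  using real_sqrt_gt_zero[of \<delta>] by (simp add: incr_def grid_increment_def path_def noise_def algebra_simps diff_divide_distrib)

lemma grid_sequence: "0 < \<delta> \<Longrightarrow> std_normal_sequence M (noise (grid \<delta>)) N"
  by (intro noise_sequence) (auto simp: strict_mono_def)

abbreviation chain :: "real \<Rightarrow> 'a \<Rightarrow> nat \<Rightarrow> real" where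
  "chain \<delta> \<omega> \<equiv> refl_chain c (incr \<delta> \<omega>)"

lemma chain_measurable:
  assumes "0 < \<delta>" "\<And>i. i < j \<Longrightarrow> noise (grid \<delta>) i \<in> borel_measurable A"
  shows "(\<lambda>\<omega>. chain \<delta> \<omega> j) \<in> borel_measurable A"
  using assms(2)
proof (induction j)
  case (Suc j)
  then have [measurable]: "(\<lambda>\<omega>. chain \<delta> \<omega> j) \<in> borel_measurable A" "noise (grid \<delta>) j \<in> borel_measurable A"
    by auto
  have "(\<lambda>\<omega>. max 0 (min c (chain \<delta> \<omega> j + (\<mu> * \<delta> + sqrt \<delta> * noise (grid \<delta>) j \<omega>)))) \<in> borel_measurable A"
    by measurable
  moreover have "(\<lambda>\<omega>. chain \<delta> \<omega> (Suc j)) = (\<lambda>\<omega>. max 0 (min c (chain \<delta> \<omega> j + (\<mu> * \<delta> + sqrt \<delta> * noise (grid \<delta>) j \<omega>))))"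
    by (rule ext) (simp add: incr_eq[OF assms(1), of _ j])
  ultimately show ?case by simp
qed simp

lemma chain_bounds: "0 \<le> chain \<delta> \<omega> j" "chain \<delta> \<omega> j \<le> c"
  using refl_chain_bounds[of c "incr \<delta> \<omega>" j] c by auto

text \<open>The supremum runs over uncountably many chains. For a continuous path, chains on the
  grids of mesh \<open>s / Q\<close> suffice by \<open>grid_chain_approx\<close>, and these are
  coded by pairs of a number and a sorted list, of which there are countably many. List positions
  start at \<open>0\<close>, chain indices at \<open>1\<close>.\<close>

lemma tv_path_measurable:
  assumes s: "0 \<le> s"
  shows "(\<lambda>\<omega>. tv c (path \<omega>) s) \<in> borel_measurable M"
proof -
  define t where "t Q l k = real (l ! (k - 1)) * (s / real Q)" for Q :: nat and l :: "nat list" and k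
  define A :: "(nat \<times> nat list) set" where "A = {(Q, l). sorted l \<and> (\<forall>j\<in>set l. j \<le> Q)}"
  define H where "H = (\<lambda>(Q, l) \<omega>. chain_sum c (path \<omega>) (length l) (t Q l))"
  have Hm: "H z \<in> borel_measurable M" for z
    unfolding H_def chain_sum_def phi_def path_def t_def using s
    by (cases z) (auto intro!: borel_measurable_sum borel_measurable_max borel_measurable_diff borel_measurable_abs
          borel_measurable_add measurable_at)
  have le: "H z \<omega> \<le> tv c (path \<omega>) s" if z: "z \<in> A" and w: "\<omega> \<in> space M" for z \<omega>
  proof -
    obtain Q l where zz: "z = (Q, l)" "sorted l" "\<And>j. j \<in> set l \<Longrightarrow> j \<le> Q" using z by (auto simp: A_def)
    have "chain_sum c (path \<omega>) (length l) (t Q l) \<le> tv c (path \<omega>) s"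
    proof (rule chain_sum_le_tv[OF path_continuous[OF w] c s])
      show "mono_on {1..length l} (t Q l)"
        using s zz(2) by (auto simp: mono_on_def t_def intro!: divide_right_mono mult_right_mono sorted_nth_mono)
      have "t Q l k \<le> s" if "1 \<le> k" "k \<le> length l" for k
      proof -
        have "l ! (k - 1) \<le> Q" using that by (intro zz(3)) auto
        then have "t Q l k \<le> real Q * (s / Q)" unfolding t_def using s by (intro mult_right_mono) auto
        then show ?thesis using s by (cases "Q = 0") auto
      qed
      then show "t Q l ` {1..length l} \<subseteq> {0..s}" using s by (auto simp: t_def)
    qed
    then show ?thesis by (simp add: H_def zz(1))
  qed
  show ?thesis
  proof (rule borel_measurableI_greater)
    fix y
    \<comment> \<open>For negative \<open>y\<close> the set is the whole space. Otherwise a value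
      above \<open>y\<close> forces \<open>s > 0\<close>, which the grid of mesh
      \<open>s / Q\<close> requires.\<close>
    have "{\<omega> \<in> space M. y < tv c (path \<omega>) s} = (if y < 0 then space M else (\<Union>z\<in>A. {\<omega> \<in> space M. y < H z \<omega>}))"
    proof (cases "y < 0")
      case True
      have "y < tv c (path \<omega>) s" for \<omega> using True by (simp add: tv_def order_less_le_trans)
      then show ?thesis using True by auto
    next
      case False
      have "\<exists>z\<in>A. y < H z \<omega>" if w: "\<omega> \<in> space M" "y < tv c (path \<omega>) s" for \<omega>
      proof -
        have s0: "0 < s"
        proof (rule ccontr)
          assume "\<not> 0 < s"
          then show False using s w(2) False by (simp add: tv_def truncated_variation_singleton)
        qed
        have "0 < tv c (path \<omega>) s - y" using w(2) by simp
        from eventually_happens[OF eventually_conj[OF eventually_ge_at_top[of 1] grid_chain_approx[OF path_continuous[OF w(1)] c s0 s this]]]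
        obtain Q n i where Q: "1 \<le> Q" and i: "mono_on {1..n} i" "i ` {1..n} \<subseteq> {..nat \<lfloor>s * real Q / s\<rfloor>}"
          "y < chain_sum c (path \<omega>) n (\<lambda>k. real (i k) * (s / real Q))"
          by auto
        define l where "l = map (\<lambda>k. i (Suc k)) [0..<n]"
        have "sorted l" using i(1) by (auto simp: l_def sorted_iff_nth_mono mono_on_def)
        moreover have "j \<le> Q" if "j \<in> set l" for j using i(2) that s0 by (fastforce simp: l_def)
        moreover have "chain_sum c (path \<omega>) n (\<lambda>k. real (i k) * (s / real Q)) = H (Q, l) \<omega>"
        proof -
          have "l ! (k - 1) = i k" if "1 \<le> k" "k \<le> n" for k
          proof -
            have "k - 1 < n" "Suc (k - 1) = k" using that by auto
            then show ?thesis by (simp add: l_def)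
          qed
          then have "chain_sum c (path \<omega>) n (\<lambda>k. real (i k) * (s / real Q)) = chain_sum c (path \<omega>) n (t Q l)"
            by (intro chain_sum_cong) (simp add: t_def)
          then show ?thesis by (simp add: H_def l_def)
        qed
        ultimately show ?thesis using i(3) by (intro bexI[of _ "(Q, l)"]) (auto simp: A_def)
      qed
      then show ?thesis using False le by (auto intro: order_less_le_trans)
    qed
    also have "\<dots> \<in> sets M" using Hm countable_subset[OF subset_UNIV, of A] by (auto intro!: sets.countable_UN'')
    finally show "{\<omega> \<in> space M. y < tv c (path \<omega>) s} \<in> sets M" .
  qed
qed

end

lemma std_normal_moments:
  shows "integrable std_normal_distribution (\<lambda>x. x)" "(\<integral>x. x \<partial>std_normal_distribution) = 0"
    and "integrable std_normal_distribution (\<lambda>x. x\<^sup>2)" "(\<integral>x. x\<^sup>2 \<partial>std_normal_distribution) = 1"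
    and "integrable std_normal_distribution (\<lambda>x. x\<^sup>2 - 1)" "(\<integral>x. x\<^sup>2 - 1 \<partial>std_normal_distribution) = 0"
    and "integrable std_normal_distribution (\<lambda>x. (x\<^sup>2 - 1)\<^sup>2)" "(\<integral>x. (x\<^sup>2 - 1)\<^sup>2 \<partial>std_normal_distribution) = 2"
    and "integrable std_normal_distribution (\<lambda>x. 1 + \<bar>x\<bar> ^ 3)"
proof -
  interpret G: prob_space std_normal_distribution
    using real_dist_normal_dist by (simp add: real_distribution_def)
  show i1: "integrable std_normal_distribution (\<lambda>x. x)" using integrable_std_normal_distribution_moment[of 1] by simp
  show "(\<integral>x. x \<partial>std_normal_distribution) = 0" using integral_std_normal_distribution_moment_odd[of 1] by simp
  show i2: "integrable std_normal_distribution (\<lambda>x. x\<^sup>2)" by (rule integrable_std_normal_distribution_moment)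
  show m2: "(\<integral>x. x\<^sup>2 \<partial>std_normal_distribution) = 1" using std_normal_distribution_even_moments(1)[of 1] by simp
  have c1: "integrable std_normal_distribution (\<lambda>x. 1 :: real)" by (rule G.integrable_const)
  show "integrable std_normal_distribution (\<lambda>x. x\<^sup>2 - 1)" using i2 c1 by (rule Bochner_Integration.integrable_diff)
  show "(\<integral>x. x\<^sup>2 - 1 \<partial>std_normal_distribution) = 0" 
    using Bochner_Integration.integral_diff[OF i2 c1] m2 G.prob_space by simp
  have i4: "integrable std_normal_distribution (\<lambda>x. x ^ 4)" by (rule integrable_std_normal_distribution_moment)
  have m4: "(\<integral>x. x ^ 4 \<partial>std_normal_distribution) = 3" using std_normal_distribution_even_moments(1)[of 2] by (simp add: fact_numeral)
  have eq: "(x\<^sup>2 - 1)\<^sup>2 = x ^ 4 - 2 * x\<^sup>2 + 1" for x :: real by (simp add: power2_eq_square algebra_simps eval_nat_numeral)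
  show "integrable std_normal_distribution (\<lambda>x. (x\<^sup>2 - 1)\<^sup>2)" unfolding eq using i2 i4 c1 by auto
  show "(\<integral>x. (x\<^sup>2 - 1)\<^sup>2 \<partial>std_normal_distribution) = 2"
    unfolding eq using i2 i4 c1 m2 m4 G.prob_space by simp
  have "integrable std_normal_distribution (\<lambda>x. \<bar>x ^ 3\<bar>)" by (rule integrable_abs[OF integrable_std_normal_distribution_moment])
  then show "integrable std_normal_distribution (\<lambda>x. 1 + \<bar>x\<bar> ^ 3)" using c1 by (auto simp: power_abs)
qed

lemma (in prob_space) prob_eventually_tendsto_1:
  assumes A: "\<And>n. A n \<in> events" and ev: "\<And>\<omega>. \<omega> \<in> space M \<Longrightarrow> \<forall>\<^sub>F n in sequentially. \<omega> \<in> A n"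
  shows "(\<lambda>n. prob (A n)) \<longlonglongrightarrow> 1"
proof -
  have "(\<lambda>n. \<integral>\<omega>. indicator (A n) \<omega> \<partial>M) \<longlonglongrightarrow> (\<integral>\<omega>. 1 \<partial>M :: real)"
  proof (rule integral_dominated_convergence[where w = "\<lambda>_. 1"])
    show "AE \<omega> in M. (\<lambda>n. indicator (A n) \<omega> :: real) \<longlonglongrightarrow> 1"
    proof (rule AE_I2)
      fix \<omega> assume "\<omega> \<in> space M"
      from ev[OF this] show "(\<lambda>n. indicator (A n) \<omega> :: real) \<longlonglongrightarrow> 1"
        by (intro tendsto_eventually) (auto elim: eventually_mono)
    qed
  qed (use A in \<open>auto simp: indicator_def\<close>)
  then show ?thesis using A by (simp add: prob_space)
qed

context drifted_brownian_motion
begin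

section \<open>Grid martingales and exceptional events\<close>

definition mart :: "(nat \<Rightarrow> real \<Rightarrow> real) \<Rightarrow> real \<Rightarrow> nat \<Rightarrow> 'a \<Rightarrow> real" where
  "mart F \<delta> N \<omega> = (\<Sum>j<N. sqrt \<delta> * F 1 (chain \<delta> \<omega> j) * noise (grid \<delta>) j \<omega>)"

definition second_order :: "(nat \<Rightarrow> real \<Rightarrow> real) \<Rightarrow> real \<Rightarrow> nat \<Rightarrow> 'a \<Rightarrow> real" where
  "second_order F \<delta> N \<omega> = (\<Sum>j<N. \<delta> / 2 * F 2 (chain \<delta> \<omega> j) * ((noise (grid \<delta>) j \<omega>)\<^sup>2 - 1))"

text \<open>\<open>C0\<close> will not depend on \<open>\<delta>\<close> or \<open>L\<close>, so
  both errors disappear under the scaling. In the second estimate the Neumann value \<open>0\<close>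
  of \<open>G\<close> leaves no pushing term, so the deviation of the clock and the martingale of
  \<open>G\<close> cancel; hence the plus sign.\<close>

definition good :: "real \<Rightarrow> (nat \<Rightarrow> real \<Rightarrow> real) \<Rightarrow> (nat \<Rightarrow> real \<Rightarrow> real) \<Rightarrow> real \<Rightarrow> nat \<Rightarrow> 'a \<Rightarrow> bool" where
  "good C0 F G \<delta> L \<omega> \<longleftrightarrow> (\<forall>N\<le>L.
     \<bar>tv c (path \<omega>) (real N * \<delta>) - m_const c \<mu> * (real N * \<delta>) - mart F \<delta> N \<omega>\<bar> \<le> C0 \<and>
     \<bar>\<delta> * (\<Sum>j<N. (F 1 (chain \<delta> \<omega> j))\<^sup>2 - sigma_sq c \<mu>) + mart G \<delta> N \<omega>\<bar> \<le> C0)"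

lemma noise_measurable: "0 < \<delta> \<Longrightarrow> noise (grid \<delta>) j \<in> borel_measurable M"
  using std_normal_sequence.measurable_zeta[OF grid_sequence[of \<delta> "Suc j"]] by simp

lemma chain_measurable_M: "0 < \<delta> \<Longrightarrow> (\<lambda>\<omega>. chain \<delta> \<omega> j) \<in> borel_measurable M"
  by (rule chain_measurable) (auto intro: noise_measurable)

lemma incr_measurable: "0 < \<delta> \<Longrightarrow> (\<lambda>\<omega>. incr \<delta> \<omega> j) \<in> borel_measurable M"
  using noise_measurable[of \<delta> j] by (simp add: incr_eq)

lemma pushing_measurable: "0 < \<delta> \<Longrightarrow> (\<lambda>\<omega>. pushing c (incr \<delta> \<omega>) N) \<in> borel_measurable M"
  unfolding pushing_def overshoot_def
  by (intro borel_measurable_sum borel_measurable_abs borel_measurable_diff borel_measurable_add chain_measurable_M incr_measurable)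

lemma corrector_chain_past:
  assumes F: "corrector c \<mu> \<kappa> q F C" "k \<le> 2" and d: "0 < \<delta>" "i \<le> N"
  shows "(\<lambda>\<omega>. F k (chain \<delta> \<omega> i)) \<in> borel_measurable (std_normal_sequence.past M (noise (grid \<delta>)) i)"
proof -
  interpret S: std_normal_sequence M "noise (grid \<delta>)" N by (rule grid_sequence[OF d(1)])
  show ?thesis
    by (intro measurable_compose[OF chain_measurable corrector_measurable[OF F]] d(1) S.zeta_past)
qed

lemma corrector_chain_measurable:
  assumes F: "corrector c \<mu> \<kappa> q F C" "k \<le> 2" and d: "0 < \<delta>"
  shows "(\<lambda>\<omega>. F k (chain \<delta> \<omega> i)) \<in> borel_measurable M"
  by (intro measurable_compose[OF chain_measurable_M corrector_measurable[OF F]] d)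

lemma corrector_chain_bound:
  assumes F: "corrector c \<mu> \<kappa> q F C" "k \<le> 3"
  shows "\<bar>F k (chain \<delta> \<omega> i)\<bar> \<le> C"
  using corrector_bound[OF F, of "chain \<delta> \<omega> i"] chain_bounds[of \<delta> \<omega> i] by auto

text \<open>The coefficients are of order \<open>\<delta>\<close>, so the variance is of order
  \<open>L * \<delta>\<^sup>2\<close> and tends to \<open>0\<close> when \<open>L * \<delta>\<close>
  is kept fixed.\<close>

lemma second_order_small:
  assumes F: "corrector c \<mu> \<kappa> q F C" and d: "0 < \<delta>"
  shows "prob {\<omega> \<in> space M. \<exists>N\<le>L. 1 \<le> \<bar>second_order F \<delta> N \<omega>\<bar>} \<le> 2 * (real L * (\<delta> / 2 * C)\<^sup>2)"
    and "{\<omega> \<in> space M. \<exists>N\<le>L. 1 \<le> \<bar>second_order F \<delta> N \<omega>\<bar>} \<in> events"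
proof -
  interpret S: std_normal_sequence M "noise (grid \<delta>)" L by (rule grid_sequence[OF d])
  let ?a = "\<lambda>j \<omega>. \<delta> / 2 * F 2 (chain \<delta> \<omega> j)"
  have "prob {\<omega> \<in> space M. \<exists>N\<le>L. 1 \<le> \<bar>S.transform ?a (\<lambda>x. x\<^sup>2 - 1) N \<omega>\<bar>} \<le> 2 * (\<Sum>i<L. (\<delta> / 2 * C)\<^sup>2) / 1\<^sup>2"
  proof -
    have a: "?a i \<in> borel_measurable (S.past i)" if "i < L" for i
      using corrector_chain_past[OF F, of 2 \<delta> i L] d that by (intro borel_measurable_times) auto
    have b: "\<bar>?a i \<omega>\<bar> \<le> \<delta> / 2 * C" for i \<omega>
      unfolding abs_mult using d corrector_chain_bound[OF F, of 2 \<delta> \<omega> i] by (intro mult_mono) auto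
    have f: "(\<lambda>x :: real. x\<^sup>2 - 1) \<in> borel_measurable borel" by measurable
    show ?thesis
      by (rule S.kolmogorov_maximal[where b = "\<lambda>_. \<delta> / 2 * C", OF a b f std_normal_moments(5,7,6,8) zero_less_one order_refl])
  qed
  then show "prob {\<omega> \<in> space M. \<exists>N\<le>L. 1 \<le> \<bar>second_order F \<delta> N \<omega>\<bar>} \<le> 2 * (real L * (\<delta> / 2 * C)\<^sup>2)"
    by (simp add: S.transform_def second_order_def)
  have [measurable]: "second_order F \<delta> N \<in> borel_measurable M" for N
    unfolding second_order_def
    by (intro borel_measurable_sum borel_measurable_times borel_measurable_diff borel_measurable_power
        borel_measurable_const noise_measurable corrector_chain_measurable[OF F] d) auto
  have "{\<omega> \<in> space M. \<exists>N\<le>L. 1 \<le> \<bar>second_order F \<delta> N \<omega>\<bar>} = (\<Union>N\<in>{..L}. {\<omega> \<in> space M. 1 \<le> \<bar>second_order F \<delta> N \<omega>\<bar>})" by auto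
  also have "\<dots> \<in> events" by (intro sets.finite_UN) auto
  finally show "{\<omega> \<in> space M. \<exists>N\<le>L. 1 \<le> \<bar>second_order F \<delta> N \<omega>\<bar>} \<in> events" .
qed

lemma cubic_small:
  assumes d: "0 < \<delta>" and D: "0 \<le> D"
  shows "prob {\<omega> \<in> space M. 1 \<le> D * (\<Sum>j<L. \<delta> * sqrt \<delta> * (1 + \<bar>noise (grid \<delta>) j \<omega>\<bar> ^ 3))}
      \<le> D * (real L * (\<delta> * sqrt \<delta> * (\<integral>x. 1 + \<bar>x\<bar> ^ 3 \<partial>std_normal_distribution)))"
    and "{\<omega> \<in> space M. 1 \<le> D * (\<Sum>j<L. \<delta> * sqrt \<delta> * (1 + \<bar>noise (grid \<delta>) j \<omega>\<bar> ^ 3))} \<in> events"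
proof -
  interpret S: std_normal_sequence M "noise (grid \<delta>)" L by (rule grid_sequence[OF d])
  note [measurable] = noise_measurable[OF d]
  have int: "integrable M (\<lambda>\<omega>. 1 + \<bar>noise (grid \<delta>) j \<omega>\<bar> ^ 3)"
    and eq: "(\<integral>\<omega>. 1 + \<bar>noise (grid \<delta>) j \<omega>\<bar> ^ 3 \<partial>M) = (\<integral>x. 1 + \<bar>x\<bar> ^ 3 \<partial>std_normal_distribution)" if "j < L" for j
    using S.integral_zeta[OF that, of "\<lambda>x. 1 + \<bar>x\<bar> ^ 3"] std_normal_moments(9) by auto
  let ?f = "\<lambda>\<omega>. D * (\<Sum>j<L. \<delta> * sqrt \<delta> * (1 + \<bar>noise (grid \<delta>) j \<omega>\<bar> ^ 3))"
  have "prob {\<omega> \<in> space M. 1 \<le> ?f \<omega>} \<le> (\<integral>\<omega>. ?f \<omega> \<partial>M) / 1"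
  proof (rule integral_Markov_inequality_measure[where A = "{}"])
    show "integrable M ?f" using int by (intro integrable_mult_right Bochner_Integration.integrable_sum) auto
  qed (use d D in \<open>auto intro!: mult_nonneg_nonneg sum_nonneg\<close>)
  also have "(\<integral>\<omega>. ?f \<omega> \<partial>M) = D * (\<Sum>j<L. \<delta> * sqrt \<delta> * (\<integral>\<omega>. 1 + \<bar>noise (grid \<delta>) j \<omega>\<bar> ^ 3 \<partial>M))"
    using int by (subst integral_mult_right_zero, subst Bochner_Integration.integral_sum) auto
  also have "\<dots> = D * (real L * (\<delta> * sqrt \<delta> * (\<integral>x. 1 + \<bar>x\<bar> ^ 3 \<partial>std_normal_distribution)))"
    by (simp add: eq)
  finally show "prob {\<omega> \<in> space M. 1 \<le> ?f \<omega>}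
      \<le> D * (real L * (\<delta> * sqrt \<delta> * (\<integral>x. 1 + \<bar>x\<bar> ^ 3 \<partial>std_normal_distribution)))" by simp
  show "{\<omega> \<in> space M. 1 \<le> ?f \<omega>} \<in> events" by measurable
qed

text \<open>Properties that every continuous path has once the mesh is small. The last one tames the
  overshoot remainder of the Ito formula; it is stated for each increment separately, and the
  largest increment is inserted later.\<close>

definition regular :: "real \<Rightarrow> real \<Rightarrow> nat \<Rightarrow> 'a set" where
  "regular C R L = {\<omega> \<in> space M. \<forall>N\<in>{..L}.
     pushing c (incr (R / L) \<omega>) N - c / 2 \<le> tv c (path \<omega>) (real N * (R / L)) \<and>
     tv c (path \<omega>) (real N * (R / L)) \<le> pushing c (incr (R / L) \<omega>) N + 1 \<and>
     \<bar>incr (R / L) \<omega> N\<bar> \<le> 1 \<and> C * \<bar>incr (R / L) \<omega> N\<bar> * pushing c (incr (R / L) \<omega>) L \<le> 1}"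

lemma regular_events:
  assumes "0 < R" "0 < L"
  shows "regular C R L \<in> events"
proof -
  have d: "0 < R / real L" using assms by simp
  note [measurable] = pushing_measurable[OF d] incr_measurable[OF d]
  have [measurable]: "(\<lambda>\<omega>. tv c (path \<omega>) (real N * (R / real L))) \<in> borel_measurable M" for N
    by (intro tv_path_measurable mult_nonneg_nonneg) (use d in simp_all)
  show ?thesis unfolding regular_def by measurable
qed

text \<open>Each path is uniformly continuous on a compact interval, so it lies in the event for all
  fine grids; dominated convergence turns this into probability tending to \<open>1\<close>, without
  a rate. \<open>Suc L\<close> keeps the mesh positive.\<close>

lemma regular_tendsto:
  assumes R: "0 < R" and C: "0 \<le> C"
  shows "(\<lambda>L. prob (regular C R (Suc L))) \<longlonglongrightarrow> 1"
proof (rule prob_eventually_tendsto_1)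
  fix \<omega> assume w: "\<omega> \<in> space M"
  note pc = path_continuous[OF w]
  \<comment> \<open>\<open>V\<close> bounds the pushing on all grids of mesh at most
    \<open>1\<close> at once, since pushing exceeds the variation by at most \<open>c / 2\<close>.
    The extra unit of time makes room for increment number \<open>L\<close>, which starts at time
    \<open>R\<close>.\<close>
  define V where "V = tv c (path \<omega>) (R + 1) + c / 2"
  have V: "0 < V" using c by (auto simp: V_def tv_def intro: add_nonneg_pos)
  define \<epsilon> where "\<epsilon> = min 1 (1 / (C * V + 1))"
  have eps: "0 < \<epsilon>" "\<epsilon> \<le> 1" "C * \<epsilon> * V \<le> 1"
  proof -
    have "0 \<le> C * V" using C V by simp
    then show "0 < \<epsilon>" "\<epsilon> \<le> 1" by (auto simp: \<epsilon>_def)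
    have "(C * V) * \<epsilon> \<le> (C * V) * (1 / (C * V + 1))" using \<open>0 \<le> C * V\<close> by (intro mult_left_mono) (auto simp: \<epsilon>_def)
    also have "\<dots> \<le> 1" using \<open>0 \<le> C * V\<close> by (simp add: divide_simps)
    finally show "C * \<epsilon> * V \<le> 1" by (simp add: mult_ac)
  qed
  have "continuous_on {0..R + 1} (path \<omega>)" using pc by (rule continuous_on_subset) auto
  from continuous_grid_modulus[OF this _ eps(1)] R
  have "\<forall>\<^sub>F L in sequentially. \<forall>s t. 0 \<le> s \<longrightarrow> s \<le> R + 1 \<longrightarrow> 0 \<le> t \<longrightarrow> t \<le> R + 1 \<longrightarrow>
    \<bar>s - t\<bar> \<le> (R + 1) / real L \<longrightarrow> \<bar>path \<omega> s - path \<omega> t\<bar> < \<epsilon>" by simp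
  moreover have "\<forall>\<^sub>F L in sequentially. R / real L < 1" by real_asymp
  ultimately have "\<forall>\<^sub>F L in sequentially. 1 \<le> L \<longrightarrow> \<omega> \<in> regular C R L"
    using tv_le_pushing[OF pc c R zero_less_one]
  proof eventually_elim
    case (elim L)
    show ?case
    proof
      assume L: "1 \<le> L"
      have d: "0 < R / L" using L R by simp
      have VL: "pushing c (incr (R / L) \<omega>) L \<le> V"
      proof -
        have "pushing c (incr (R / L) \<omega>) L - c / 2 \<le> tv c (path \<omega>) (real L * (R / L))"
          unfolding incr_def using d by (intro pushing_le_tv[OF pc c]) auto
        also have "\<dots> \<le> tv c (path \<omega>) (R + 1)" using d R L by (intro tv_mono[OF pc c]) auto
        finally show ?thesis by (simp add: V_def)
      qed
      show "\<omega> \<in> regular C R L"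
        unfolding regular_def
      proof (intro CollectI conjI ballI w)
        fix N assume N: "N \<in> {..L}"
        show "pushing c (incr (R / L) \<omega>) N - c / 2 \<le> tv c (path \<omega>) (real N * (R / L))"
          unfolding incr_def using d by (intro pushing_le_tv[OF pc c]) auto
        show "tv c (path \<omega>) (real N * (R / L)) \<le> pushing c (incr (R / L) \<omega>) N + 1"
          unfolding incr_def using elim(3) N by auto
        have "real N * (R / L) \<le> real L * (R / L)" using d N by (intro mult_right_mono) auto
        then have NR: "real N * (R / L) \<le> R" using L by simp
        have "real (Suc N) * (R / L) = real N * (R / L) + R / L" by (simp add: algebra_simps add_divide_distrib)
        moreover have "R / L \<le> (R + 1) / L" by (simp add: divide_right_mono)
        ultimately have "\<bar>path \<omega> (real (Suc N) * (R / L)) - path \<omega> (real N * (R / L))\<bar> < \<epsilon>"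
          using elim(1,2) d NR R by (intro elim(1)[rule_format]) auto
        then have e: "\<bar>incr (R / L) \<omega> N\<bar> \<le> \<epsilon>" by (simp add: incr_def grid_increment_def)
        then show "\<bar>incr (R / L) \<omega> N\<bar> \<le> 1" using eps by simp
        have "C * \<bar>incr (R / L) \<omega> N\<bar> * pushing c (incr (R / L) \<omega>) L \<le> C * \<epsilon> * V"
          using e VL C eps by (intro mult_mono mult_nonneg_nonneg pushing_nonneg) auto
        then show "C * \<bar>incr (R / L) \<omega> N\<bar> * pushing c (incr (R / L) \<omega>) L \<le> 1" using eps by simp
      qed
    qed
  qed
  then have "\<forall>\<^sub>F L in sequentially. 1 \<le> Suc L \<longrightarrow> \<omega> \<in> regular C R (Suc L)"
    by (rule eventually_compose_filterlim) (rule filterlim_Suc)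
  then show "\<forall>\<^sub>F L in sequentially. \<omega> \<in> regular C R (Suc L)" by simp
qed (use R in \<open>auto intro: regular_events\<close>)

text \<open>The constant collects \<open>2 * C\<close> from the telescoped values of
  \<open>F 0\<close> and one unit each for the second-order martingale, the cubic remainder and the
  overshoot remainder.\<close>

lemma regular_approximation:
  assumes w: "\<omega> \<in> regular C R L" and L: "0 < L" and R: "0 < R" and d1: "R / L \<le> 1"
    and F: "corrector c \<mu> \<kappa> q F C"
    and so: "\<not> (\<exists>N\<le>L. 1 \<le> \<bar>second_order F (R / L) N \<omega>\<bar>)"
    and cu: "\<not> 1 \<le> C * (4 * \<bar>\<mu>\<bar> ^ 3 + 4 + \<bar>\<mu>\<bar> + \<mu>\<^sup>2) * (\<Sum>j<L. (R / L) * sqrt (R / L) * (1 + \<bar>noise (grid (R / L)) j \<omega>\<bar> ^ 3))"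
    and N: "N \<le> L"
  shows "\<bar>\<kappa> * pushing c (incr (R / L) \<omega>) N - (R / L) * (\<Sum>j<N. q (chain (R / L) \<omega> j)) - mart F (R / L) N \<omega>\<bar> \<le> 2 * C + 3"
proof -
  define \<delta> where "\<delta> = R / L"
  have d: "0 < \<delta>" using R L by (simp add: \<delta>_def)
  have C: "0 \<le> C" using corrector_nonneg[OF F] c by simp
  \<comment> \<open>The largest step is attained at some index, and the bound in
    \<open>regular\<close> for that index controls the overshoot remainder.\<close>
  define \<eta> where "\<eta> = Max ((\<lambda>j. \<bar>incr \<delta> \<omega> j\<bar>) ` {..<L})"
  have "\<eta> \<in> (\<lambda>j. \<bar>incr \<delta> \<omega> j\<bar>) ` {..<L}" unfolding \<eta>_def using L by (intro Max_in) auto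
  then obtain j where j: "j < L" "\<eta> = \<bar>incr \<delta> \<omega> j\<bar>" by auto
  have reg: "\<bar>incr \<delta> \<omega> j\<bar> \<le> 1" "C * \<bar>incr \<delta> \<omega> j\<bar> * pushing c (incr \<delta> \<omega>) L \<le> 1"
    using w j(1) by (auto simp: regular_def \<delta>_def)
  have small: "\<bar>incr \<delta> \<omega> i\<bar> \<le> \<eta>" if "i < L" for i
    unfolding \<eta>_def using that by (intro Max_ge) auto
  have "C * \<eta> * pushing c (incr \<delta> \<omega>) N \<le> C * \<eta> * pushing c (incr \<delta> \<omega>) L"
    using C j N by (intro mult_left_mono pushing_mono) auto
  also have "\<dots> \<le> 1" using reg by (simp add: j(2))
  finally have 1: "C * \<eta> * pushing c (incr \<delta> \<omega>) N \<le> 1" .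
  have "\<bar>\<kappa> * pushing c (incr \<delta> \<omega>) N - \<delta> * (\<Sum>j<N. q (chain \<delta> \<omega> j)) - (\<Sum>j<N. sqrt \<delta> * F 1 (chain \<delta> \<omega> j) * noise (grid \<delta>) j \<omega>)
      - (\<Sum>j<N. \<delta> / 2 * F 2 (chain \<delta> \<omega> j) * ((noise (grid \<delta>) j \<omega>)\<^sup>2 - 1))\<bar>
    \<le> 2 * C + C * (4 * \<bar>\<mu>\<bar> ^ 3 + 4 + \<bar>\<mu>\<bar> + \<mu>\<^sup>2) * (\<Sum>j<L. \<delta> * sqrt \<delta> * (1 + \<bar>noise (grid \<delta>) j \<omega>\<bar> ^ 3)) + C * \<eta> * pushing c (incr \<delta> \<omega>) N"
    using reg(1) j d1 N d by (intro discrete_ito_normal[OF F c] small) (auto simp: incr_eq \<delta>_def)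
  moreover have "\<not> 1 \<le> \<bar>second_order F \<delta> N \<omega>\<bar>" using so N unfolding \<delta>_def by blast
  ultimately show ?thesis
    using cu 1 unfolding \<delta>_def[symmetric] mart_def second_order_def by linarith
qed

text \<open>Four exceptional events share \<open>\<eta>\<close> equally: an irregular path, a large
  second-order martingale for either corrector, and a large cubic sum. The surplus
  \<open>c / 2 + 1\<close> over \<open>2 * C + 3\<close> accounts for the distance between pushing
  and truncated variation.\<close>

lemma good_events:
  assumes F: "corrector c \<mu> 1 (\<lambda>_. m_const c \<mu>) F C"
    and G: "corrector c \<mu> 0 (\<lambda>x. (F 1 x)\<^sup>2 - sigma_sq c \<mu>) G C"
    and R: "0 < R" and \<eta>: "0 < \<eta>"
  shows "\<forall>\<^sub>F L in sequentially. \<exists>E\<in>events. 1 - \<eta> \<le> prob E \<and>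
     (\<forall>\<omega>\<in>E. good (c / 2 + 2 * C + 4) F G (R / real L) L \<omega>)"
proof -
  have C: "0 \<le> C" using corrector_nonneg[OF F] c by simp
  define D where "D = C * (4 * \<bar>\<mu>\<bar> ^ 3 + 4 + \<bar>\<mu>\<bar> + \<mu>\<^sup>2)"
  have D: "0 \<le> D" using C by (simp add: D_def)
  define m3 where "m3 = (\<integral>x. 1 + \<bar>x\<bar> ^ 3 \<partial>std_normal_distribution)"
  have lim: "(\<lambda>L. R / real (Suc L)) \<longlonglongrightarrow> 0" by real_asymp
  have "(\<lambda>L. R * C\<^sup>2 / 2 * (R / real (Suc L))) \<longlonglongrightarrow> R * C\<^sup>2 / 2 * 0" by (intro tendsto_intros lim)
  moreover have "R * C\<^sup>2 / 2 * (R / real (Suc L)) = 2 * (real (Suc L) * (R / real (Suc L) / 2 * C)\<^sup>2)" for L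
    by (simp add: power2_eq_square divide_simps del: of_nat_Suc)
  ultimately have "(\<lambda>L. 2 * (real (Suc L) * (R / real (Suc L) / 2 * C)\<^sup>2)) \<longlonglongrightarrow> 0" by (simp only: mult_zero_right)
  then have e1: "\<forall>\<^sub>F L in sequentially. 2 * (real (Suc L) * (R / real (Suc L) / 2 * C)\<^sup>2) < \<eta> / 4"
    by (rule order_tendstoD(2)) (use \<eta> in simp)
  have "(\<lambda>L. D * R * m3 * sqrt (R / real (Suc L))) \<longlonglongrightarrow> D * R * m3 * sqrt 0" by (intro tendsto_intros lim)
  moreover have "D * R * m3 * sqrt (R / real (Suc L)) = D * (real (Suc L) * (R / real (Suc L) * sqrt (R / real (Suc L)) * m3))" for L
    by (simp del: of_nat_Suc)
  ultimately have "(\<lambda>L. D * (real (Suc L) * (R / real (Suc L) * sqrt (R / real (Suc L)) * m3))) \<longlonglongrightarrow> 0"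
    by (simp only: mult_zero_right real_sqrt_zero)
  then have e2: "\<forall>\<^sub>F L in sequentially. D * (real (Suc L) * (R / real (Suc L) * sqrt (R / real (Suc L)) * m3)) < \<eta> / 4"
    by (rule order_tendstoD(2)) (use \<eta> in simp)
  have e3: "\<forall>\<^sub>F L in sequentially. 1 - \<eta> / 4 < prob (regular C R (Suc L))"
    using regular_tendsto[OF R C] \<eta> by (intro order_tendstoD) auto
  have e4: "\<forall>\<^sub>F L in sequentially. R / real (Suc L) < 1" by real_asymp
  from e1 e2 e3 e4 have "\<forall>\<^sub>F L in sequentially. \<exists>E\<in>events. 1 - \<eta> \<le> prob E \<and>
     (\<forall>\<omega>\<in>E. good (c / 2 + 2 * C + 4) F G (R / real (Suc L)) (Suc L) \<omega>)"
  proof eventually_elim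
    case (elim L)
    let ?\<delta> = "R / real (Suc L)"
    have d: "0 < ?\<delta>" using R by simp
    define A1 where "A1 = {\<omega> \<in> space M. \<exists>N\<le>Suc L. 1 \<le> \<bar>second_order F ?\<delta> N \<omega>\<bar>}"
    define A2 where "A2 = {\<omega> \<in> space M. \<exists>N\<le>Suc L. 1 \<le> \<bar>second_order G ?\<delta> N \<omega>\<bar>}"
    define A3 where "A3 = {\<omega> \<in> space M. 1 \<le> D * (\<Sum>j<Suc L. ?\<delta> * sqrt ?\<delta> * (1 + \<bar>noise (grid ?\<delta>) j \<omega>\<bar> ^ 3))}"
    have ev: "A1 \<in> events" "A2 \<in> events" "A3 \<in> events" "regular C R (Suc L) \<in> events"
      unfolding A1_def A2_def A3_def
      by (rule second_order_small(2)[OF F d], rule second_order_small(2)[OF G d], rule cubic_small(2)[OF d D],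
          rule regular_events[OF R zero_less_Suc])
    have pr: "prob A1 < \<eta> / 4" "prob A2 < \<eta> / 4" "prob A3 < \<eta> / 4"
      unfolding A1_def A2_def A3_def
      by (rule order_le_less_trans[OF second_order_small(1)[OF F d] elim(1)],
          rule order_le_less_trans[OF second_order_small(1)[OF G d] elim(1)],
          rule order_le_less_trans[OF cubic_small(1)[OF d D] elim(2)[unfolded m3_def]])
    define E where "E = regular C R (Suc L) - (A1 \<union> (A2 \<union> A3))"
    have "prob (regular C R (Suc L)) \<le> prob (E \<union> (A1 \<union> (A2 \<union> A3)))"
      using ev by (intro finite_measure_mono) (auto simp: E_def)
    also have "\<dots> \<le> prob E + (prob A1 + (prob A2 + prob A3))"
      using ev by (intro order_trans[OF measure_Un_le] add_left_mono sets.Un) (auto simp: E_def)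
    finally have pE: "1 - \<eta> \<le> prob E" using pr elim(3) by linarith
    have main: "\<bar>tv c (path \<omega>) (real N * ?\<delta>) - m_const c \<mu> * (real N * ?\<delta>) - mart F ?\<delta> N \<omega>\<bar> \<le> c / 2 + 2 * C + 4 \<and>
     \<bar>?\<delta> * (\<Sum>j<N. (F 1 (chain ?\<delta> \<omega> j))\<^sup>2 - sigma_sq c \<mu>) + mart G ?\<delta> N \<omega>\<bar> \<le> c / 2 + 2 * C + 4"
      if w: "\<omega> \<in> E" and N: "N \<le> Suc L" for \<omega> N
    proof -
      have wr: "\<omega> \<in> regular C R (Suc L)" and ws: "\<omega> \<in> space M" using w by (auto simp: E_def regular_def)
      have a: "\<not> (\<exists>N\<le>Suc L. 1 \<le> \<bar>second_order F ?\<delta> N \<omega>\<bar>)" "\<not> (\<exists>N\<le>Suc L. 1 \<le> \<bar>second_order G ?\<delta> N \<omega>\<bar>)"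
        "\<not> 1 \<le> D * (\<Sum>j<Suc L. ?\<delta> * sqrt ?\<delta> * (1 + \<bar>noise (grid ?\<delta>) j \<omega>\<bar> ^ 3))"
        using w ws unfolding E_def A1_def A2_def A3_def by blast+
      have s: "?\<delta> * (\<Sum>j<N. m_const c \<mu>) = m_const c \<mu> * (real N * ?\<delta>)" by simp
      note X = regular_approximation[OF wr zero_less_Suc R less_imp_le[OF elim(4)] F a(1) a(3)[unfolded D_def] N, unfolded s mult_1]
      note Y = regular_approximation[OF wr zero_less_Suc R less_imp_le[OF elim(4)] G a(2) a(3)[unfolded D_def] N, unfolded mult_zero_left]
      have "pushing c (incr ?\<delta> \<omega>) N - c / 2 \<le> tv c (path \<omega>) (real N * ?\<delta>)"
         "tv c (path \<omega>) (real N * ?\<delta>) \<le> pushing c (incr ?\<delta> \<omega>) N + 1"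
        using wr N unfolding regular_def by blast+
      with X Y c C show ?thesis by linarith
    qed
    have "\<forall>\<omega>\<in>E. good (c / 2 + 2 * C + 4) F G ?\<delta> (Suc L) \<omega>" unfolding good_def using main by blast
    moreover have "E \<in> events" using ev by (auto simp: E_def)
    ultimately show ?case using pE by blast
  qed
  then show ?thesis by (rule eventually_sequentially_Suc[THEN iffD1])
qed

end

section \<open>Weak convergence in metric spaces\<close>

definition lipschitz_functional :: "'c metric \<Rightarrow> real \<Rightarrow> ('c \<Rightarrow> real) \<Rightarrow> bool" where
  "lipschitz_functional m L F \<longleftrightarrow> 0 \<le> L \<and> (\<forall>x\<in>mspace m. \<forall>y\<in>mspace m. \<bar>F x - F y\<bar> \<le> L * mdist m x y)"

lemma space_borel_of_topology [simp]: "space (borel_of_topology X) = topspace X"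
  unfolding borel_of_topology_def by (rule space_measure_of) (auto dest: openin_subset)

lemma sets_borel_of_topology: "sets (borel_of_topology X) = sigma_sets (topspace X) {U. openin X U}"
  unfolding borel_of_topology_def by (rule sets_measure_of) (auto dest: openin_subset)

lemma openin_borel_of_topology: "openin X U \<Longrightarrow> U \<in> sets (borel_of_topology X)"
  by (simp add: sets_borel_of_topology)

lemma continuous_map_borel_measurable:
  assumes "continuous_map X euclideanreal F"
  shows "F \<in> borel_measurable (borel_of_topology X)"
proof (rule borel_measurableI)
  fix V :: "real set" assume "open V"
  then have "openin X {x \<in> topspace X. F x \<in> V}"
    using assms by (auto simp: continuous_map_def)
  moreover have "{x \<in> topspace X. F x \<in> V} = F -` V \<inter> space (borel_of_topology X)" by auto
  ultimately show "F -` V \<inter> space (borel_of_topology X) \<in> sets (borel_of_topology X)"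
    using openin_borel_of_topology by metis
qed

lemma measurable_borel_of_topologyI:
  assumes "Y \<in> space M \<rightarrow> topspace X" "\<And>U. openin X U \<Longrightarrow> Y -` U \<inter> space M \<in> sets M"
  shows "Y \<in> measurable M (borel_of_topology X)"
  unfolding borel_of_topology_def using assms
  by (intro measurable_measure_of) (auto dest: openin_subset)

lemma lipschitz_functional_continuous:
  assumes "lipschitz_functional m L F"
  shows "continuous_map (mtopology_of m) euclideanreal F"
proof -
  have "Lipschitz_continuous_map m euclidean_metric F"
    using assms by (auto simp: Lipschitz_continuous_map_def lipschitz_functional_def dist_real_def)
  then show ?thesis
    using Lipschitz_continuous_imp_continuous_map by fastforce
qed

text \<open>The Pasch-Hausdorff envelope: for bounded \<open>F\<close> and \<open>k \<ge> 0\<close>,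
  the largest \<open>k\<close>-Lipschitz minorant of \<open>F\<close>.\<close>

definition inf_conv :: "'c metric \<Rightarrow> ('c \<Rightarrow> real) \<Rightarrow> real \<Rightarrow> 'c \<Rightarrow> real" where
  "inf_conv m F k x = (INF y\<in>mspace m. F y + k * mdist m x y)"

context
  fixes m :: "'c metric" and F :: "'c \<Rightarrow> real" and B :: real
  assumes B: "\<And>x. x \<in> mspace m \<Longrightarrow> \<bar>F x\<bar> \<le> B"
begin

lemma inf_conv_bdd:
  assumes "0 \<le> k"
  shows "bdd_below ((\<lambda>y. F y + k * mdist m x y) ` mspace m)"
proof (rule bdd_belowI2)
  fix y assume "y \<in> mspace m"
  then have "- B \<le> F y" using B[of y] by auto
  moreover have "0 \<le> k * mdist m x y" using assms by simp
  ultimately show "- B \<le> F y + k * mdist m x y" by linarith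
qed

lemma inf_conv_le: "0 \<le> k \<Longrightarrow> x \<in> mspace m \<Longrightarrow> inf_conv m F k x \<le> F x"
  unfolding inf_conv_def using cINF_lower[OF inf_conv_bdd, of k x x] by (simp add: Metric_space.mdist_zero[OF Metric_space_mspace_mdist])

lemma inf_conv_ge: "0 \<le> k \<Longrightarrow> x \<in> mspace m \<Longrightarrow> - B \<le> inf_conv m F k x"
  unfolding inf_conv_def
proof (rule cINF_greatest)
  fix y assume "0 \<le> k" "y \<in> mspace m"
  then have "- B \<le> F y" "0 \<le> k * mdist m x y" using B[of y] by auto
  then show "- B \<le> F y + k * mdist m x y" by linarith
qed auto

lemma inf_conv_bound: "0 \<le> k \<Longrightarrow> x \<in> mspace m \<Longrightarrow> \<bar>inf_conv m F k x\<bar> \<le> B"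
  using inf_conv_le[of k x] inf_conv_ge[of k x] B[of x] by auto

lemma inf_conv_lipschitz:
  assumes k: "0 \<le> k"
  shows "lipschitz_functional m k (inf_conv m F k)"
proof -
  have le: "inf_conv m F k x \<le> inf_conv m F k y + k * mdist m x y" if "x \<in> mspace m" "y \<in> mspace m" for x y
  proof -
    have "inf_conv m F k x - k * mdist m x y \<le> inf_conv m F k y"
      unfolding inf_conv_def[of m F k y]
    proof (rule cINF_greatest)
      fix z assume z: "z \<in> mspace m"
      have "inf_conv m F k x \<le> F z + k * mdist m x z"
        unfolding inf_conv_def by (rule cINF_lower[OF inf_conv_bdd[OF k] z])
      moreover have "k * mdist m x z \<le> k * (mdist m x y + mdist m y z)"
        using k that z by (intro mult_left_mono mdist_triangle)
      ultimately show "inf_conv m F k x - k * mdist m x y \<le> F z + k * mdist m y z" by (simp add: algebra_simps)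
    qed (use that in auto)
    then show ?thesis by simp
  qed
  show ?thesis
    unfolding lipschitz_functional_def
  proof (intro conjI ballI k)
    fix x y assume "x \<in> mspace m" "y \<in> mspace m"
    then show "\<bar>inf_conv m F k x - inf_conv m F k y\<bar> \<le> k * mdist m x y"
      using le[of x y] le[of y x] by (simp add: mdist_commute[of m] abs_le_iff)
  qed
qed

end

text \<open>A point at distance at least \<open>d\<close> from \<open>x\<close> pays
  \<open>k * d\<close>, which for large \<open>k\<close> exceeds the oscillation
  \<open>2 * B\<close>; only points near \<open>x\<close> compete, and there continuity keeps
  \<open>F\<close> close to \<open>F x\<close>.\<close>

lemma inf_conv_tendsto:
  assumes B: "\<And>x. x \<in> mspace m \<Longrightarrow> \<bar>F x\<bar> \<le> B"
    and F: "continuous_map (mtopology_of m) euclideanreal F" and x: "x \<in> mspace m"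
  shows "(\<lambda>k. inf_conv m F (real k) x) \<longlonglongrightarrow> F x"
proof (rule LIMSEQ_I)
  fix e :: real assume e: "0 < e"
  have "openin (mtopology_of m) {y \<in> topspace (mtopology_of m). F y \<in> U}" if "open U" for U
    using F that by (auto simp: continuous_map_def)
  from this[OF open_greaterThan]
  have "openin (mtopology_of m) {y \<in> topspace (mtopology_of m). F y \<in> {F x - e / 2<..}}" .
  moreover have "x \<in> {y \<in> topspace (mtopology_of m). F y \<in> {F x - e / 2<..}}" using x e by simp
  ultimately obtain d where d: "d > 0" "\<And>y. y \<in> mspace m \<Longrightarrow> mdist m x y < d \<Longrightarrow> F x - e / 2 < F y"
    unfolding mtopology_of_def Metric_space.openin_mtopology[OF Metric_space_mspace_mdist]
    by (force simp: Metric_space.mball_def[OF Metric_space_mspace_mdist] Metric_space.topspace_mtopology[OF Metric_space_mspace_mdist] x)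
  obtain K :: nat where K: "2 * B / d < K" using reals_Archimedean2 by blast
  have B0: "0 \<le> B" using B[OF x] by linarith
  show "\<exists>no. \<forall>k\<ge>no. norm (inf_conv m F (real k) x - F x) < e"
  proof (intro exI[of _ K] allI impI)
    fix k assume k: "K \<le> k"
    have "2 * B < real K * d" using K d by (simp add: divide_less_eq)
    also have "\<dots> \<le> real k * d" using k d by (intro mult_right_mono) auto
    finally have kd: "2 * B \<le> real k * d" by simp
    have "F x - e / 2 \<le> inf_conv m F (real k) x"
      unfolding inf_conv_def
    proof (rule cINF_greatest)
      fix y assume y: "y \<in> mspace m"
      show "F x - e / 2 \<le> F y + real k * mdist m x y"
      proof (cases "mdist m x y < d")
        case True
        then have "F x - e / 2 < F y" using d(2)[OF y] by simp
        moreover have "0 \<le> real k * mdist m x y" by simp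
        ultimately show ?thesis by linarith
      next
        case False
        then have "real k * d \<le> real k * mdist m x y" by (intro mult_left_mono) auto
        then show ?thesis using kd B[OF y] B[OF x] e by linarith
      qed
    qed (use x in auto)
    moreover have "inf_conv m F (real k) x \<le> F x" by (rule inf_conv_le[OF B]) (use x in auto)
    ultimately show "norm (inf_conv m F (real k) x - F x) < e" using e by simp
  qed
qed

text \<open>A bounded continuous functional is the increasing limit of its infimal convolutions, and these
  are Lipschitz.\<close>

lemma converges_in_distributionI:
  assumes M: "prob_space M" and N: "prob_space N"
    and Y: "\<And>n. Y n \<in> measurable M (borel_of_topology (mtopology_of m))"
    and Z: "Z \<in> measurable N (borel_of_topology (mtopology_of m))"
    and lip: "\<And>F L B. lipschitz_functional m L F \<Longrightarrow> (\<And>x. x \<in> mspace m \<Longrightarrow> \<bar>F x\<bar> \<le> B) \<Longrightarrow>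
      (\<lambda>n. \<integral>\<omega>. F (Y n \<omega>) \<partial>M) \<longlonglongrightarrow> (\<integral>\<omega>. F (Z \<omega>) \<partial>N)"
  shows "converges_in_distribution (mtopology_of m) M Y N Z"
proof -
  interpret M: prob_space M by fact
  interpret N: prob_space N by fact
  have Ym: "Y n \<omega> \<in> mspace m" if "\<omega> \<in> space M" for n \<omega> using measurable_space[OF Y that] by simp
  have Zm: "Z \<omega> \<in> mspace m" if "\<omega> \<in> space N" for \<omega> using measurable_space[OF Z that] by simp
  have int: "integrable M (\<lambda>\<omega>. F (Y n \<omega>))" "integrable N (\<lambda>\<omega>. F (Z \<omega>))"
    if F: "continuous_map (mtopology_of m) euclideanreal F" and B: "\<And>x. x \<in> mspace m \<Longrightarrow> \<bar>F x\<bar> \<le> B" for F B n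
    using Ym Zm B measurable_compose[OF Y continuous_map_borel_measurable[OF F]] measurable_compose[OF Z continuous_map_borel_measurable[OF F]]
    by (auto intro!: M.integrable_const_bound[where B=B] N.integrable_const_bound[where B=B] AE_I2)
  have il: "inf_conv m F (real k) x \<le> F x" if "\<And>x. x \<in> mspace m \<Longrightarrow> \<bar>F x\<bar> \<le> B" "x \<in> mspace m" for F B k x
    by (rule inf_conv_le[of m F B]) (use that in auto)
  \<comment> \<open>Minorants yield only an asymptotic lower bound for the integrals; the upper
    bound comes from applying this to the functional \<open>- F\<close>.\<close>
  have lower: "\<forall>\<^sub>F n in sequentially. (\<integral>\<omega>. F (Z \<omega>) \<partial>N) - e < (\<integral>\<omega>. F (Y n \<omega>) \<partial>M)"
    if F: "continuous_map (mtopology_of m) euclideanreal F" and B: "\<And>x. x \<in> mspace m \<Longrightarrow> \<bar>F x\<bar> \<le> B" and e: "0 < e" for F B e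
  proof -
    have lipk: "lipschitz_functional m (real k) (inf_conv m F (real k))" for k by (rule inf_conv_lipschitz[OF B]) auto
    note ck = lipschitz_functional_continuous[OF lipk]
    have bk: "\<bar>inf_conv m F (real k) x\<bar> \<le> B" if "x \<in> mspace m" for k x by (rule inf_conv_bound[OF B]) (use that in auto)
    have "(\<lambda>k. \<integral>\<omega>. inf_conv m F (real k) (Z \<omega>) \<partial>N) \<longlonglongrightarrow> (\<integral>\<omega>. F (Z \<omega>) \<partial>N)"
    proof (rule integral_dominated_convergence[where w = "\<lambda>_. B"])
      show "AE \<omega> in N. (\<lambda>k. inf_conv m F (real k) (Z \<omega>)) \<longlonglongrightarrow> F (Z \<omega>)"
        by (intro AE_I2 inf_conv_tendsto[OF B F] Zm)
    qed (use bk Zm int(2)[OF ck bk] int(2)[OF F B] in auto)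
    then have "\<forall>\<^sub>F k in sequentially. (\<integral>\<omega>. F (Z \<omega>) \<partial>N) - e < (\<integral>\<omega>. inf_conv m F (real k) (Z \<omega>) \<partial>N)"
      using e by (intro order_tendstoD(1)) auto
    from eventually_happens[OF this]
    obtain k where k: "(\<integral>\<omega>. F (Z \<omega>) \<partial>N) - e < (\<integral>\<omega>. inf_conv m F (real k) (Z \<omega>) \<partial>N)" by auto
    have "(\<lambda>n. \<integral>\<omega>. inf_conv m F (real k) (Y n \<omega>) \<partial>M) \<longlonglongrightarrow> (\<integral>\<omega>. inf_conv m F (real k) (Z \<omega>) \<partial>N)"
      by (rule lip[OF lipk]) (rule bk)
    from order_tendstoD(1)[OF this k]
    show ?thesis
    proof eventually_elim
      case (elim n)
      have "(\<integral>\<omega>. inf_conv m F (real k) (Y n \<omega>) \<partial>M) \<le> (\<integral>\<omega>. F (Y n \<omega>) \<partial>M)"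
        using int(1)[OF ck bk] int(1)[OF F B] Ym by (intro integral_mono il[OF B]) auto
      then show ?case using elim by simp
    qed
  qed
  have "(\<lambda>n. \<integral>\<omega>. F (Y n \<omega>) \<partial>M) \<longlonglongrightarrow> (\<integral>\<omega>. F (Z \<omega>) \<partial>N)"
    if F: "continuous_map (mtopology_of m) euclideanreal F" and bd: "bounded (F ` mspace m)" for F
  proof -
    obtain B where B: "\<And>x. x \<in> mspace m \<Longrightarrow> \<bar>F x\<bar> \<le> B" using bd by (auto simp: bounded_iff)
    show ?thesis
    proof (rule order_tendstoI)
      fix a assume "a < (\<integral>\<omega>. F (Z \<omega>) \<partial>N)"
      then show "\<forall>\<^sub>F n in sequentially. a < (\<integral>\<omega>. F (Y n \<omega>) \<partial>M)"
        using lower[OF F B, of "(\<integral>\<omega>. F (Z \<omega>) \<partial>N) - a"] by simp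
    next
      fix a assume a: "(\<integral>\<omega>. F (Z \<omega>) \<partial>N) < a"
      have "continuous_map (mtopology_of m) euclideanreal (\<lambda>x. - F x)" using F by (intro continuous_intros)
      from lower[OF this, of B "a - (\<integral>\<omega>. F (Z \<omega>) \<partial>N)"] B a
      show "\<forall>\<^sub>F n in sequentially. (\<integral>\<omega>. F (Y n \<omega>) \<partial>M) < a" by simp
    qed
  qed
  moreover have "(\<integral>x. F x \<partial>distr M (borel_of_topology (mtopology_of m)) (Y n)) = (\<integral>\<omega>. F (Y n \<omega>) \<partial>M)"
    "(\<integral>x. F x \<partial>distr N (borel_of_topology (mtopology_of m)) Z) = (\<integral>\<omega>. F (Z \<omega>) \<partial>N)"
    if "continuous_map (mtopology_of m) euclideanreal F" for F n
    by (rule integral_distr[OF Y continuous_map_borel_measurable[OF that]],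
        rule integral_distr[OF Z continuous_map_borel_measurable[OF that]])
  ultimately show ?thesis
    unfolding converges_in_distribution_def weakly_converges_def
    using Y Z by simp
qed

section \<open>The space of continuous functions on an interval\<close>

abbreviation C_metric :: "real \<Rightarrow> (real \<Rightarrow> real) metric" where
  "C_metric T \<equiv> cfunspace (top_of_set {0..T}) euclidean_metric"

lemma C_space_eq: "C_space T = mtopology_of (C_metric T)"
  by (simp add: C_space_def)

declare mspace_cfunspace [simp del]

lemma mspace_C_metric: "f \<in> mspace (C_metric T) \<longleftrightarrow> f \<in> extensional {0..T} \<and> continuous_on {0..T} f"
  using compact_imp_bounded[OF compact_continuous_image[of "{0..T}" f]]
  by (auto simp: mspace_cfunspace )

lemma mdist_C_metric_le:
  assumes "f \<in> mspace (C_metric T)" "g \<in> mspace (C_metric T)" "0 \<le> T"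
  shows "mdist (C_metric T) f g \<le> a \<longleftrightarrow> (\<forall>t\<in>{0..T}. \<bar>f t - g t\<bar> \<le> a)"
  using cfunspace_mdist_le[OF assms(1,2), of a] assms(3) by (simp add: dist_real_def)

text \<open>\<open>g\<close> lists increments, not vertex values: the \<open>k\<close>-th clamped
  factor is a ramp that rises from \<open>0\<close> to \<open>1\<close> on the \<open>k\<close>-th
  cell and carries one increment. The polygon is thereby continuous in \<open>t\<close> and linear
  in \<open>g\<close> without any choice of a cell.\<close>

definition polygon :: "real \<Rightarrow> nat \<Rightarrow> (nat \<Rightarrow> real) \<Rightarrow> real \<Rightarrow> real" where
  "polygon T K g t = (\<Sum>k<K. g k * max 0 (min 1 (t * K / T - real k)))"

lemma polygon_continuous: "continuous_on A (polygon T K g)"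
  unfolding polygon_def by (cases "T = 0") (auto intro!: continuous_intros)

lemma polygon_diff_le: "\<bar>polygon T K g t - polygon T K h t\<bar> \<le> (\<Sum>k<K. \<bar>g k - h k\<bar>)"
proof -
  have "\<bar>polygon T K g t - polygon T K h t\<bar> = \<bar>\<Sum>k<K. (g k - h k) * max 0 (min 1 (t * K / T - real k))\<bar>"
    by (simp add: polygon_def sum_subtractf left_diff_distrib)
  also have "\<dots> \<le> (\<Sum>k<K. \<bar>(g k - h k) * max 0 (min 1 (t * K / T - real k))\<bar>)" by (rule sum_abs)
  also have "\<dots> \<le> (\<Sum>k<K. \<bar>g k - h k\<bar> * 1)"
    unfolding abs_mult by (intro sum_mono mult_left_mono) auto
  finally show ?thesis by simp
qed

lemma polygon_eq:
  assumes k: "k < K" "real k \<le> t * K / T" "t * K / T \<le> real k + 1"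
  obtains \<theta> where "0 \<le> \<theta>" "\<theta> \<le> 1" "\<And>g. polygon T K g t = (\<Sum>i<k. g i) + \<theta> * g k"
proof
  let ?s = "t * K / T"
  show "0 \<le> ?s - real k" "?s - real k \<le> 1" using k by auto
  show "polygon T K g t = (\<Sum>i<k. g i) + (?s - real k) * g k" for g
  proof -
    have "polygon T K g t = (\<Sum>i<Suc k. g i * max 0 (min 1 (?s - real i)))"
      unfolding polygon_def
    proof (rule sum.mono_neutral_right)
      show "\<forall>i\<in>{..<K} - {..<Suc k}. g i * max 0 (min 1 (?s - real i)) = 0"
      proof
        fix i assume "i \<in> {..<K} - {..<Suc k}"
        then have "real k + 1 \<le> real i" by auto
        then have "?s - real i \<le> 0" using k by linarith
        then show "g i * max 0 (min 1 (?s - real i)) = 0" by auto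
      qed
    qed (use k in auto)
    also have "\<dots> = (\<Sum>i<k. g i * max 0 (min 1 (?s - real i))) + g k * (?s - real k)"
      using k by simp
    also have "(\<Sum>i<k. g i * max 0 (min 1 (?s - real i))) = (\<Sum>i<k. g i)"
    proof (rule sum.cong)
      fix i assume "i \<in> {..<k}"
      then have "real i + 1 \<le> real k" by auto
      then have "1 \<le> ?s - real i" using k by linarith
      then show "g i * max 0 (min 1 (?s - real i)) = g i" by auto
    qed simp
    finally show ?thesis by (simp add: mult.commute)
  qed
qed

lemma polygon_cell:
  fixes K :: nat and t T :: real
  assumes T: "0 < T" and K: "0 < K" and t: "0 \<le> t" "t \<le> T"
  obtains k where "k < K" "real k \<le> t * K / T" "t * K / T \<le> real k + 1"
proof (cases "t = T")
  case True
  then show ?thesis using that[of "K - 1"] K T by (simp add: of_nat_diff)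
next
  case False
  then have "t * K / T < K" using t T K by (simp add: divide_less_eq)
  moreover have "0 \<le> t * K / T" using t T by simp
  ultimately show ?thesis using that[of "nat \<lfloor>t * K / T\<rfloor>"] by linarith
qed

definition increments :: "real \<Rightarrow> nat \<Rightarrow> (real \<Rightarrow> real) \<Rightarrow> nat \<Rightarrow> real" where
  "increments T K f k = f (real (Suc k) * T / K) - f (real k * T / K)"

definition interpolation :: "real \<Rightarrow> nat \<Rightarrow> (real \<Rightarrow> real) \<Rightarrow> real \<Rightarrow> real" where
  "interpolation T K f = (\<lambda>t\<in>{0..T}. f 0 + polygon T K (increments T K f) t)"

lemma interpolation_in_C: "(\<lambda>t\<in>{0..T}. y + polygon T K g t) \<in> mspace (C_metric T)"
proof -
  have "continuous_on {0..T} (\<lambda>t\<in>{0..T}. y + polygon T K g t) = continuous_on {0..T} (\<lambda>t. y + polygon T K g t)"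
    by (intro continuous_on_cong) auto
  also have "\<dots>" by (intro continuous_intros polygon_continuous)
  finally show ?thesis by (simp add: mspace_C_metric)
qed

lemma interpolation_close:
  assumes T: "0 < T" and K: "0 < K" and e: "0 \<le> \<epsilon>"
    and osc: "\<And>s t. 0 \<le> s \<Longrightarrow> s \<le> T \<Longrightarrow> 0 \<le> t \<Longrightarrow> t \<le> T \<Longrightarrow> \<bar>s - t\<bar> \<le> T / K \<Longrightarrow> \<bar>f s - f t\<bar> \<le> \<epsilon>"
    and t: "0 \<le> t" "t \<le> T"
  shows "\<bar>f t - interpolation T K f t\<bar> \<le> 2 * \<epsilon>"
proof -
  obtain k where k: "k < K" "real k \<le> t * K / T" "t * K / T \<le> real k + 1"
    by (rule polygon_cell[OF T K t])
  obtain \<theta> where th: "0 \<le> \<theta>" "\<theta> \<le> 1" "\<And>g. polygon T K g t = (\<Sum>i<k. g i) + \<theta> * g k"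
    by (rule polygon_eq[OF k]) blast
  have "(\<Sum>i<k. increments T K f i) = f (real k * T / K) - f 0"
    unfolding increments_def by (subst sum_lessThan_telescope[of "\<lambda>i. f (real i * T / K)"]) simp
  then have eq: "interpolation T K f t = f (real k * T / K) + \<theta> * increments T K f k"
    using t th(3) by (simp add: interpolation_def)
  have b: "real k * T / K \<le> t" "t \<le> real (Suc k) * T / K" "real (Suc k) * T / K \<le> T"
  proof -
    show "real k * T / K \<le> t" "t \<le> real (Suc k) * T / K" using k T K by (auto simp: field_simps)
    have "real (Suc k) * T \<le> real K * T" using k T by (intro mult_right_mono) auto
    then show "real (Suc k) * T / K \<le> T" using K by (simp add: divide_le_eq mult.commute)
  qed
  have d: "real (Suc k) * T / K - real k * T / K = T / K" by (simp add: algebra_simps add_divide_distrib)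
  have k0: "0 \<le> real k * T / K" using T by simp
  have 1: "\<bar>f t - f (real k * T / K)\<bar> \<le> \<epsilon>" using b d k0 t by (intro osc) auto
  have "\<bar>increments T K f k\<bar> \<le> \<epsilon>" unfolding increments_def using b d k0 t by (intro osc) auto
  then have "\<theta> * \<bar>increments T K f k\<bar> \<le> 1 * \<epsilon>" using th by (intro mult_mono) auto
  then have "\<bar>\<theta> * increments T K f k\<bar> \<le> \<epsilon>" using th by (simp add: abs_mult)
  with 1 show ?thesis unfolding eq by linarith
qed

lemma interpolation_tendsto:
  assumes T: "0 < T" and f: "f \<in> mspace (C_metric T)" and F: "lipschitz_functional (C_metric T) L F"
  shows "(\<lambda>K. F (interpolation T K f)) \<longlonglongrightarrow> F f"
proof (rule LIMSEQ_I)
  fix e :: real assume e: "0 < e"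
  have L: "0 \<le> L" using F by (simp add: lipschitz_functional_def)
  define \<epsilon> where "\<epsilon> = e / (4 * (L + 1))"
  have eps: "0 < \<epsilon>" "L * (2 * \<epsilon>) < e"
  proof -
    show "0 < \<epsilon>" using e L by (simp add: \<epsilon>_def)
    have "L * (2 * \<epsilon>) \<le> (L + 1) * (2 * \<epsilon>)" using \<open>0 < \<epsilon>\<close> by (intro mult_right_mono) auto
    also have "\<dots> = e / 2" using L by (simp add: \<epsilon>_def divide_simps)
    finally show "L * (2 * \<epsilon>) < e" using e by simp
  qed
  have fc: "continuous_on {0..T} f" using f by (simp add: mspace_C_metric)
  have "uniformly_continuous_on {0..T} f" using fc by (intro compact_uniformly_continuous) auto
  then obtain d where d: "d > 0" "\<And>s t. s \<in> {0..T} \<Longrightarrow> t \<in> {0..T} \<Longrightarrow> dist t s < d \<Longrightarrow> dist (f t) (f s) < \<epsilon>"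
    using eps(1) unfolding uniformly_continuous_on_def by metis
  obtain K0 :: nat where K0: "T / d < K0" using reals_Archimedean2 by blast
  show "\<exists>no. \<forall>K\<ge>no. norm (F (interpolation T K f) - F f) < e"
  proof (intro exI[of _ "Suc K0"] allI impI)
    fix K assume K: "Suc K0 \<le> K"
    have "T < K0 * d" using K0 d by (simp add: divide_less_eq)
    also have "\<dots> \<le> K * d" using K d by (intro mult_right_mono) auto
    finally have Kd: "T / K < d" using K by (simp add: divide_less_eq mult.commute)
    have im: "interpolation T K f \<in> mspace (C_metric T)" unfolding interpolation_def by (rule interpolation_in_C)
    have "mdist (C_metric T) (interpolation T K f) f \<le> 2 * \<epsilon>"
      unfolding mdist_C_metric_le[OF im f less_imp_le[OF T]]
    proof
      fix t assume t: "t \<in> {0..T}"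
      have "\<bar>f t - interpolation T K f t\<bar> \<le> 2 * \<epsilon>"
      proof (rule interpolation_close[OF T])
        fix s u assume "0 \<le> s" "s \<le> T" "0 \<le> u" "u \<le> T" "\<bar>s - u\<bar> \<le> T / K"
        then show "\<bar>f s - f u\<bar> \<le> \<epsilon>" using d(2)[of u s] Kd by (simp add: dist_real_def)
      qed (use K t eps in auto)
      then show "\<bar>interpolation T K f t - f t\<bar> \<le> 2 * \<epsilon>" by (simp add: abs_minus_commute)
    qed
    then have "L * mdist (C_metric T) (interpolation T K f) f \<le> L * (2 * \<epsilon>)" using L by (intro mult_left_mono)
    then show "norm (F (interpolation T K f) - F f) < e"
      using F im f eps unfolding lipschitz_functional_def real_norm_def by (meson le_less_trans order_trans)
  qed
qed

text \<open>A polygon depends in a Lipschitz way on finitely many coordinates of its data, so the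
  composite with \<open>F\<close> is continuous in the product topology on sequences, hence Borel.
  Coordinate \<open>0\<close> holds the starting value, \<open>Suc k\<close> the \<open>k\<close>-th
  increment.\<close>

lemma lipschitz_polygon_measurable:
  assumes T: "0 \<le> T" and F: "lipschitz_functional (C_metric T) L F"
  shows "(\<lambda>y :: nat \<Rightarrow> real. F (\<lambda>t\<in>{0..T}. y 0 + polygon T K (\<lambda>k. y (Suc k)) t)) \<in> borel_measurable borel"
proof (rule borel_measurable_continuous_onI)
  define \<Phi> where "\<Phi> y = F (\<lambda>t\<in>{0..T}. y 0 + polygon T K (\<lambda>k. y (Suc k)) t)" for y :: "nat \<Rightarrow> real"
  have L: "0 \<le> L" using F by (simp add: lipschitz_functional_def)
  have est: "\<bar>\<Phi> y - \<Phi> z\<bar> \<le> L * (\<bar>y 0 - z 0\<bar> + (\<Sum>k<K. \<bar>y (Suc k) - z (Suc k)\<bar>))" for y z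
  proof -
    have "mdist (C_metric T) (\<lambda>t\<in>{0..T}. y 0 + polygon T K (\<lambda>k. y (Suc k)) t) (\<lambda>t\<in>{0..T}. z 0 + polygon T K (\<lambda>k. z (Suc k)) t)
        \<le> \<bar>y 0 - z 0\<bar> + (\<Sum>k<K. \<bar>y (Suc k) - z (Suc k)\<bar>)"
      unfolding mdist_C_metric_le[OF interpolation_in_C interpolation_in_C T]
    proof
      fix t assume t: "t \<in> {0..T}"
      show "\<bar>(\<lambda>t\<in>{0..T}. y 0 + polygon T K (\<lambda>k. y (Suc k)) t) t - (\<lambda>t\<in>{0..T}. z 0 + polygon T K (\<lambda>k. z (Suc k)) t) t\<bar>
         \<le> \<bar>y 0 - z 0\<bar> + (\<Sum>k<K. \<bar>y (Suc k) - z (Suc k)\<bar>)"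
        using polygon_diff_le[of T K "\<lambda>k. y (Suc k)" t "\<lambda>k. z (Suc k)"] t by simp
    qed
    then have "L * mdist (C_metric T) (\<lambda>t\<in>{0..T}. y 0 + polygon T K (\<lambda>k. y (Suc k)) t) (\<lambda>t\<in>{0..T}. z 0 + polygon T K (\<lambda>k. z (Suc k)) t)
        \<le> L * (\<bar>y 0 - z 0\<bar> + (\<Sum>k<K. \<bar>y (Suc k) - z (Suc k)\<bar>))" using L by (intro mult_left_mono)
    then show ?thesis using F interpolation_in_C unfolding lipschitz_functional_def \<Phi>_def by (meson order_trans)
  qed
  show "continuous_on UNIV (\<lambda>y :: nat \<Rightarrow> real. F (\<lambda>t\<in>{0..T}. y 0 + polygon T K (\<lambda>k. y (Suc k)) t))"
    unfolding continuous_on_def \<Phi>_def[symmetric]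
  proof
    fix z :: "nat \<Rightarrow> real"
    have coord: "((\<lambda>y :: nat \<Rightarrow> real. y k) \<longlongrightarrow> z k) (at z)" for k
      using continuous_on_product_coordinates[of k] by (auto simp: continuous_on_def)
    have "((\<lambda>y. L * (\<bar>y 0 - z 0\<bar> + (\<Sum>k<K. \<bar>y (Suc k) - z (Suc k)\<bar>))) \<longlongrightarrow>
        L * (\<bar>z 0 - z 0\<bar> + (\<Sum>k<K. \<bar>z (Suc k) - z (Suc k)\<bar>))) (at z)"
      by (intro tendsto_intros coord)
    then have "((\<lambda>y. L * (\<bar>y 0 - z 0\<bar> + (\<Sum>k<K. \<bar>y (Suc k) - z (Suc k)\<bar>))) \<longlongrightarrow> 0) (at z)" by simp
    then have "((\<lambda>y. \<Phi> y - \<Phi> z) \<longlongrightarrow> 0) (at z)"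
      by (rule Lim_null_comparison[rotated]) (use est in \<open>auto intro!: always_eventually\<close>)
    then show "(\<Phi> \<longlongrightarrow> \<Phi> z) (at z within UNIV)" by (simp add: LIM_zero_iff)
  qed
qed

text \<open>An open set is the positivity set of a Lipschitz functional, and such a functional is the
  limit of its values on polygons.\<close>

lemma measurable_C_space:
  assumes T: "0 < T" and Y: "\<And>\<omega>. \<omega> \<in> space M \<Longrightarrow> Y \<omega> \<in> mspace (C_metric T)"
    and meas: "\<And>t. 0 \<le> t \<Longrightarrow> t \<le> T \<Longrightarrow> (\<lambda>\<omega>. Y \<omega> t) \<in> borel_measurable M"
  shows "Y \<in> measurable M (borel_of_topology (C_space T))"
proof -
  have lip: "(\<lambda>\<omega>. F (Y \<omega>)) \<in> borel_measurable M" if F: "lipschitz_functional (C_metric T) L F" for F L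
  proof (rule borel_measurable_LIMSEQ_real[OF interpolation_tendsto[OF T Y F]])
    fix K
    show "(\<lambda>\<omega>. F (interpolation T K (Y \<omega>))) \<in> borel_measurable M"
    proof (cases "K = 0")
      case True
      let ?X = "\<lambda>\<omega> (i :: nat). if i = 0 then Y \<omega> 0 else 0 :: real"
      have "?X \<in> borel_measurable M"
        using meas[of 0] T by (intro measurable_coordinatewise_then_product) auto
      from measurable_compose[OF this lipschitz_polygon_measurable[OF less_imp_le[OF T] F, of 0]]
      show ?thesis using True by (simp add: interpolation_def polygon_def)
    next
      case False
      let ?X = "\<lambda>\<omega> i. if i = 0 then Y \<omega> 0 else if i \<le> K then increments T K (Y \<omega>) (i - 1) else 0"
      have "?X \<in> borel_measurable M"
      proof (rule measurable_coordinatewise_then_product)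
        fix i :: nat
        show "(\<lambda>\<omega>. ?X \<omega> i) \<in> borel_measurable M"
        proof (cases "i = 0 \<or> K < i")
          case True
          then show ?thesis using meas[of 0] T by auto
        next
          case i: False
          have *: "0 \<le> real j * T / K \<and> real j * T / K \<le> T" if "j \<le> K" for j
          proof -
            have "real j * T \<le> real K * T" using that T by (intro mult_right_mono) auto
            then show ?thesis using T False by (simp add: divide_le_eq mult.commute)
          qed
          have "(\<lambda>\<omega>. Y \<omega> (real (Suc (i - 1)) * T / K) - Y \<omega> (real (i - 1) * T / K)) \<in> borel_measurable M"
            using *[of "Suc (i - 1)"] *[of "i - 1"] i by (intro borel_measurable_diff meas) auto
          then show ?thesis using i by (simp add: increments_def)
        qed
      qed
      from measurable_compose[OF this lipschitz_polygon_measurable[OF less_imp_le[OF T] F, of K]]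
      moreover have "polygon T K (\<lambda>k. ?X \<omega> (Suc k)) = polygon T K (increments T K (Y \<omega>))" for \<omega>
        unfolding polygon_def by (intro ext sum.cong) auto
      ultimately show ?thesis
        by (simp add: interpolation_def)
    qed
  qed
  show ?thesis
  proof (rule measurable_borel_of_topologyI)
    show "Y \<in> space M \<rightarrow> topspace (C_space T)" using Y by (auto simp: C_space_eq)
    fix U assume U: "openin (C_space T) U"
    let ?m = "C_metric T"
    show "Y -` U \<inter> space M \<in> sets M"
    proof (cases "mspace ?m \<subseteq> U")
      case True
      then have "Y -` U \<inter> space M = space M" using Y by auto
      then show ?thesis by simp
    next
      case False
      \<comment> \<open>The \<open>1\<close>-Lipschitz envelope of the indicator of \<open>U\<close>
        vanishes off \<open>U\<close>, and it is positive on the open set \<open>U\<close>: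
        competitors outside \<open>U\<close> are at distance at least \<open>r\<close>, those inside
        cost \<open>1\<close>.\<close>
      define D where "D = inf_conv ?m (\<lambda>g. if g \<in> U then 1 else 0) 1"
      have B: "\<bar>if g \<in> U then 1 else 0 :: real\<bar> \<le> 1" for g by simp
      have DL: "lipschitz_functional ?m 1 D" unfolding D_def by (rule inf_conv_lipschitz[OF B]) simp
      have "f \<in> U \<longleftrightarrow> 0 < D f" if f: "f \<in> mspace ?m" for f
      proof
        assume "f \<in> U"
        then obtain r where r: "r > 0" "\<And>g. g \<in> mspace ?m \<Longrightarrow> mdist ?m f g < r \<Longrightarrow> g \<in> U"
          using U unfolding C_space_eq mtopology_of_def Metric_space.openin_mtopology[OF Metric_space_mspace_mdist]
          by (force simp: Metric_space.in_mball[OF Metric_space_mspace_mdist] f)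
        have "min r 1 \<le> D f"
          unfolding D_def inf_conv_def
        proof (rule cINF_greatest)
          fix g assume "g \<in> mspace ?m"
          then have "g \<in> U \<or> r \<le> mdist ?m f g" using r(2)[of g] by linarith
          moreover have "0 \<le> mdist ?m f g" by simp
          ultimately show "min r 1 \<le> (if g \<in> U then 1 else 0) + 1 * mdist ?m f g" by (auto simp: min_le_iff_disj)
        qed (use f in auto)
        then show "0 < D f" using r by linarith
      next
        assume "0 < D f"
        moreover have "D f \<le> (if f \<in> U then 1 else 0)" unfolding D_def by (rule inf_conv_le[OF B]) (use f in auto)
        ultimately show "f \<in> U" by (auto split: if_splits)
      qed
      then have "Y -` U \<inter> space M = {\<omega> \<in> space M. 0 < D (Y \<omega>)}" using Y by auto
      also have "\<dots> \<in> sets M" using lip[OF DL] by measurable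
      finally show ?thesis .
    qed
  qed
qed

section \<open>Coupling with Gaussian blocks\<close>

lemma polygon_scale: "polygon T K (\<lambda>k. a * g k) t = a * polygon T K g t"
  by (simp add: polygon_def sum_distrib_left mult.assoc)

text \<open>Monotonicity of \<open>V\<close> squeezes \<open>V s\<close> between its values at two
  adjacent grid times of one block, at the cost of \<open>C0 + \<bar>m\<bar> * \<delta>\<close>.
  Inside the block the martingale moves by at most \<open>l\<close> and the current side of the
  polygon by at most \<open>l + l'\<close>; every block passed before adds a discrepancy
  \<open>l'\<close>.\<close>

lemma path_polygon_bound:
  fixes V :: "real \<Rightarrow> real" and a :: "nat \<Rightarrow> real"
  assumes K: "0 < K" and q: "0 < q" and d: "0 < \<delta>" and R: "R = real (K * q) * \<delta>"
    and mono: "\<And>s t. 0 \<le> s \<Longrightarrow> s \<le> t \<Longrightarrow> V s \<le> V t"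
    and h1: "\<And>N. N \<le> K * q \<Longrightarrow> \<bar>V (real N * \<delta>) - m * (real N * \<delta>) - a N\<bar> \<le> C0"
    and h2: "\<And>k N. k < K \<Longrightarrow> k * q \<le> N \<Longrightarrow> N \<le> Suc k * q \<Longrightarrow> \<bar>a N - a (k * q)\<bar> \<le> l"
    and h3: "\<And>k. k < K \<Longrightarrow> \<bar>a (Suc k * q) - a (k * q) - g k\<bar> \<le> l'"
    and a0: "a 0 = 0" and l': "0 \<le> l'" and s: "0 \<le> s" "s \<le> R"
  shows "\<bar>V s - m * s - polygon R K g s\<bar> \<le> C0 + \<bar>m\<bar> * \<delta> + 2 * l + real (Suc K) * l'"
proof -
  have R0: "0 < R" using K q d by (simp add: R)
  obtain k where k: "k < K" "real k \<le> s * K / R" "s * K / R \<le> real k + 1"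
    by (rule polygon_cell[OF R0 K s])
  obtain \<theta> where th: "0 \<le> \<theta>" "\<theta> \<le> 1" "\<And>g. polygon R K g s = (\<Sum>i<k. g i) + \<theta> * g k"
    by (rule polygon_eq[OF k]) blast
  have sK: "s * K / R = s / (real q * \<delta>)" using K q d by (simp add: R)
  have kq: "real (k * q) * \<delta> \<le> s" "s \<le> real (Suc k * q) * \<delta>"
    using k q d unfolding sK by (simp_all add: le_divide_eq divide_le_eq algebra_simps)
  have le: "Suc k * q \<le> K * q" using k by (intro mult_le_mono1) auto
  \<comment> \<open>The minimum matters when \<open>s\<close> is the right end of the block:
    \<open>N\<close> then stays one step before it, so that \<open>Suc N\<close> still belongs to
    the block.\<close>
  define N where "N = min (nat \<lfloor>s / \<delta>\<rfloor>) (Suc k * q - 1)"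
  have sd: "real (k * q) \<le> s / \<delta>" "s / \<delta> \<le> real (Suc k * q)"
    using kq d by (auto simp: le_divide_eq divide_le_eq)
  have pos: "1 \<le> Suc k * q" using q by simp
  have N1: "k * q \<le> N" "Suc N \<le> Suc k * q"
  proof -
    have "k * q \<le> nat \<lfloor>s / \<delta>\<rfloor>" using sd(1) by (simp add: le_nat_floor)
    moreover have "k * q \<le> Suc k * q - 1" using q by simp
    ultimately show "k * q \<le> N" by (simp add: N_def)
    show "Suc N \<le> Suc k * q" using pos unfolding N_def by linarith
  qed
  have "real N \<le> s / \<delta>" "s / \<delta> \<le> real (Suc N)"
  proof -
    have f: "real (nat \<lfloor>s / \<delta>\<rfloor>) \<le> s / \<delta>" "s / \<delta> \<le> real (nat \<lfloor>s / \<delta>\<rfloor>) + 1"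
      using s d divide_nonneg_pos[of s \<delta>] by linarith+
    show "real N \<le> s / \<delta>" using f(1) unfolding N_def by linarith
    show "s / \<delta> \<le> real (Suc N)"
    proof (cases "nat \<lfloor>s / \<delta>\<rfloor> \<le> Suc k * q - 1")
      case True then show ?thesis using f(2) by (simp add: N_def)
    next
      case False
      then have "Suc N = Suc k * q" using pos by (simp add: N_def min_def)
      then show ?thesis using sd(2) by simp
    qed
  qed
  then have Ns: "real N * \<delta> \<le> s" "s \<le> real (Suc N) * \<delta>" using d by (auto simp: le_divide_eq divide_le_eq)
  have d1: "real (Suc N) * \<delta> = real N * \<delta> + \<delta>" by (simp add: algebra_simps)
  have mb: "\<bar>m * x\<bar> \<le> \<bar>m\<bar> * \<delta>" if "0 \<le> x" "x \<le> \<delta>" for x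
    using that by (simp add: abs_mult mult_left_mono)
  have up: "V s \<le> V (real (Suc N) * \<delta>)" and lo: "V (real N * \<delta>) \<le> V s"
    using Ns s d by (auto intro!: mono)
  have m1: "\<bar>m * (real (Suc N) * \<delta>) - m * s\<bar> \<le> \<bar>m\<bar> * \<delta>" "\<bar>m * s - m * (real N * \<delta>)\<bar> \<le> \<bar>m\<bar> * \<delta>"
    using mb[of "real (Suc N) * \<delta> - s"] mb[of "s - real N * \<delta>"] Ns d1 by (simp_all add: right_diff_distrib)
  have b: "\<bar>a N - a (k * q)\<bar> \<le> l" "\<bar>a (Suc N) - a (k * q)\<bar> \<le> l" "\<bar>a (Suc k * q) - a (k * q)\<bar> \<le> l"
    by (rule h2[OF k(1)]; use N1 in simp)+
  have main: "\<bar>V s - m * s - a (k * q)\<bar> \<le> C0 + \<bar>m\<bar> * \<delta> + l"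
  proof -
    have "N \<le> K * q" "Suc N \<le> K * q" using N1(2) le by linarith+
    from h1[OF this(1)] h1[OF this(2)] show ?thesis using up lo m1 b(1,2) by linarith
  qed
  have sumg: "\<bar>a (i * q) - (\<Sum>j<i. g j)\<bar> \<le> real i * l'" if "i \<le> k" for i
    using that
  proof (induction i)
    case (Suc i)
    have "\<bar>a (i * q) - (\<Sum>j<i. g j)\<bar> \<le> real i * l'" using Suc by simp
    moreover have "\<bar>a (Suc i * q) - a (i * q) - g i\<bar> \<le> l'" using Suc k by (intro h3) auto
    moreover have "real (Suc i) * l' = real i * l' + l'" by (simp add: algebra_simps)
    ultimately show ?case unfolding sum.lessThan_Suc by linarith
  qed (simp add: a0)
  have "real k * l' \<le> real K * l'" using k l' by (intro mult_right_mono) auto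
  moreover have "\<bar>g k\<bar> \<le> l + l'" using b(3) h3[OF k(1)] by linarith
  then have "\<theta> * \<bar>g k\<bar> \<le> 1 * (l + l')" using th by (intro mult_mono) auto
  then have "\<bar>\<theta> * g k\<bar> \<le> l + l'" using th by (simp add: abs_mult)
  moreover have "real (Suc K) * l' = real K * l' + l'" by (simp add: algebra_simps)
  ultimately show ?thesis using main sumg[OF order_refl] unfolding th(3) by linarith
qed

section \<open>Stopping blocks at a prescribed variance\<close>

definition cutoff :: "real \<Rightarrow> (nat \<Rightarrow> real) \<Rightarrow> nat \<Rightarrow> real" where
  "cutoff v d s = (if (\<Sum>t<Suc s. d t) \<le> v then 1 else 0)"

lemma cutoff_sq [simp]: "(cutoff v d s)\<^sup>2 = cutoff v d s"
  by (auto simp: cutoff_def)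

text \<open>The running sum in \<open>cutoff\<close> includes the current term, so the stopped clock
  never exceeds \<open>v\<close>; in the application this term is known before the noise it belongs
  to. Once the running sum passes \<open>v\<close>, all later terms are cut off as well, and the
  stopped clock is within one term, at most \<open>\<delta>\<close>, of \<open>v\<close>.\<close>

lemma cutoff_sum:
  assumes d: "\<And>s. 0 \<le> d s" "\<And>s. d s \<le> \<delta>" and v: "0 \<le> v"
  shows "(\<Sum>s<r. cutoff v d s * d s) = (\<Sum>s<r. d s) \<and> (\<Sum>s<r. d s) \<le> v \<or>
    v < (\<Sum>s<r. d s) \<and> v - \<delta> \<le> (\<Sum>s<r. cutoff v d s * d s) \<and> (\<Sum>s<r. cutoff v d s * d s) \<le> v"
proof (induction r)
  case (Suc r)
  show ?case
  proof (cases "(\<Sum>s<Suc r. d s) \<le> v")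
    case True
    then have "cutoff v d r = 1" "(\<Sum>s<r. d s) \<le> v" using d(1)[of r] by (auto simp: cutoff_def)
    then show ?thesis using Suc True by auto
  next
    case False
    then have "cutoff v d r = 0" by (simp add: cutoff_def)
    then show ?thesis using Suc False d(2)[of r] by auto
  qed
qed (use v in auto)

lemma sum_block:
  fixes g :: "nat \<Rightarrow> real"
  assumes "k < K"
  shows "(\<Sum>i<K * Suc q. if i div Suc q = k then g (i mod Suc q) else 0) = (\<Sum>r<q. g r) + g q"
proof -
  have "(\<Sum>i<K * Suc q. if i div Suc q = k then g (i mod Suc q) else 0) = (\<Sum>i\<in>(\<lambda>r. k * Suc q + r) ` {..<Suc q}. g (i mod Suc q))"
  proof (rule sum.mono_neutral_cong_right)
    have "Suc k * Suc q \<le> K * Suc q" using assms by (intro mult_le_mono1) auto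
    then show "(\<lambda>r. k * Suc q + r) ` {..<Suc q} \<subseteq> {..<K * Suc q}" by auto
    show "\<forall>i\<in>{..<K * Suc q} - (\<lambda>r. k * Suc q + r) ` {..<Suc q}. (if i div Suc q = k then g (i mod Suc q) else 0) = 0"
    proof
      fix i assume i: "i \<in> {..<K * Suc q} - (\<lambda>r. k * Suc q + r) ` {..<Suc q}"
      have "i div Suc q \<noteq> k"
      proof
        assume "i div Suc q = k"
        then have "i = k * Suc q + i mod Suc q" using div_mult_mod_eq[of i "Suc q"] by simp
        moreover have "i mod Suc q \<in> {..<Suc q}" by simp
        ultimately show False using i by blast
      qed
      then show "(if i div Suc q = k then g (i mod Suc q) else 0) = 0" by simp
    qed
  next
    fix i assume "i \<in> (\<lambda>r. k * Suc q + r) ` {..<Suc q}"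
    then obtain r where r: "r < Suc q" "i = k * Suc q + r" by auto
    then have "i div Suc q = k" by (metis add.commute div_mult_self3 div_less add_0 Suc_neq_Zero)
    then show "(if i div Suc q = k then g (i mod Suc q) else 0) = g (i mod Suc q)" by simp
  qed simp
  also have "\<dots> = (\<Sum>r<Suc q. g r)"
  proof (subst sum.reindex)
    have "(k * Suc q + r) mod Suc q = r" if "r < Suc q" for r
      using that mod_mult_self3[of k "Suc q" r] by (simp del: mult_Suc_right)
    then show "sum ((\<lambda>i. g (i mod Suc q)) \<circ> (\<lambda>r. k * Suc q + r)) {..<Suc q} = (\<Sum>r<Suc q. g r)"
      by (intro sum.cong) auto
  qed (auto simp: inj_on_def)
  finally show ?thesis by simp
qed

lemma sum_lessThan_Suc_mult:
  fixes f :: "nat \<Rightarrow> real"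
  shows "sum f {..<Suc k * q} = sum f {..<k * q} + (\<Sum>r<q. f (k * q + r))"
proof -
  have "{..<Suc k * q} = {..<k * q} \<union> (\<lambda>r. k * q + r) ` {..<q}"
  proof (intro equalityI subsetI)
    fix j assume j: "j \<in> {..<Suc k * q}"
    show "j \<in> {..<k * q} \<union> (\<lambda>r. k * q + r) ` {..<q}"
    proof (cases "j < k * q")
      case False
      then have "j = k * q + (j - k * q)" "j - k * q \<in> {..<q}" using j by auto
      then show ?thesis by blast
    qed simp
  qed auto
  then show ?thesis
    by (simp only:) (subst sum.union_disjoint, auto simp: sum.reindex inj_on_def)
qed

text \<open>The indices below \<open>L\<close> are the steps of the walk, \<open>L + k\<close> is a later Brownian increment reserved
  as filler of block \<open>k\<close>. This enumeration puts the filler directly after the \<open>q\<close> steps of its block,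
  so that the coefficient of the filler depends on the past only.\<close>

definition block_index :: "nat \<Rightarrow> nat \<Rightarrow> nat \<Rightarrow> nat" where
  "block_index q L i = (if i mod Suc q < q then i div Suc q * q + i mod Suc q else L + i div Suc q)"

lemma block_index_at:
  "r < q \<Longrightarrow> block_index q L (k * Suc q + r) = k * q + r"
  "block_index q L (k * Suc q + q) = L + k"
proof -
  have *: "(k * Suc q + r) div Suc q = k" "(k * Suc q + r) mod Suc q = r" if "r \<le> q" for r
    using that div_mult_self3[of "Suc q" r k] mod_mult_self3[of k "Suc q" r] by (simp_all del: mult_Suc_right)
  show "r < q \<Longrightarrow> block_index q L (k * Suc q + r) = k * q + r" using *[of r] by (simp add: block_index_def del: mult_Suc_right)
  show "block_index q L (k * Suc q + q) = L + k" using *[of q] by (simp add: block_index_def del: mult_Suc_right)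
qed

lemma block_index_inj:
  assumes q: "0 < q"
  shows "inj_on (block_index q (K * q)) {..<K * Suc q}" "block_index q (K * q) ` {..<K * Suc q} \<subseteq> {..<K * q + K}"
proof -
  have k: "i div Suc q < K" if "i < K * Suc q" for i
    using that by (simp add: less_mult_imp_div_less)
  have lt: "i div Suc q * q + i mod Suc q < K * q" if "i < K * Suc q" "i mod Suc q < q" for i
  proof -
    have "i div Suc q * q + i mod Suc q < Suc (i div Suc q) * q" using that by simp
    also have "\<dots> \<le> K * q" using k[OF that(1)] by (intro mult_le_mono1) auto
    finally show ?thesis .
  qed
  have rq: "i mod Suc q \<le> q" for i using mod_less_divisor[of "Suc q" i] by linarith
  show "block_index q (K * q) ` {..<K * Suc q} \<subseteq> {..<K * q + K}"
    using k lt by (auto simp: block_index_def intro: trans_less_add1)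
  show "inj_on (block_index q (K * q)) {..<K * Suc q}"
  proof (rule inj_onI)
    fix i j assume ij: "i \<in> {..<K * Suc q}" "j \<in> {..<K * Suc q}" "block_index q (K * q) i = block_index q (K * q) j"
    have "i div Suc q = j div Suc q \<and> i mod Suc q = j mod Suc q"
    proof (cases "i mod Suc q < q"; cases "j mod Suc q < q")
      assume a: "i mod Suc q < q" "j mod Suc q < q"
      then have e: "i div Suc q * q + i mod Suc q = j div Suc q * q + j mod Suc q" using ij(3) by (simp add: block_index_def)
      from arg_cong[OF e, of "\<lambda>x. x div q"] arg_cong[OF e, of "\<lambda>x. x mod q"] a show ?thesis using q by simp
    next
      assume a: "i mod Suc q < q" "\<not> j mod Suc q < q"
      then show ?thesis using ij lt[of i] by (simp add: block_index_def)
    next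
      assume a: "\<not> i mod Suc q < q" "j mod Suc q < q"
      then show ?thesis using ij lt[of j] by (simp add: block_index_def)
    next
      assume a: "\<not> i mod Suc q < q" "\<not> j mod Suc q < q"
      then show ?thesis using ij(3) rq[of i] rq[of j] by (simp add: block_index_def)
    qed
    then show "i = j" by (metis div_mult_mod_eq)
  qed
qed

context drifted_brownian_motion
begin

text \<open>The unit steps after the grid supply the fillers. Their length is arbitrary, since
  \<open>noise\<close> normalises it away.\<close>

definition node :: "real \<Rightarrow> nat \<Rightarrow> nat \<Rightarrow> real" where
  "node \<delta> L j = (if j \<le> L then real j * \<delta> else real L * \<delta> + (real j - real L))"

lemma node_noise: "j < L \<Longrightarrow> noise (node \<delta> L) j = noise (grid \<delta>) j"
  by (auto simp: noise_def node_def fun_eq_iff)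

lemma block_sequence:
  assumes "0 < \<delta>" "0 < q"
  shows "std_normal_sequence M (\<lambda>i. noise (node \<delta> (K * q)) (block_index q (K * q) i)) (K * Suc q)"
proof -
  have "strict_mono (node \<delta> (K * q))"
  proof (rule strict_monoI_Suc)
    fix n show "node \<delta> (K * q) n < node \<delta> (K * q) (Suc n)"
      using assms by (cases "n = K * q") (auto simp: node_def algebra_simps)
  qed
  moreover have "0 \<le> node \<delta> (K * q) j" for j
    using assms by (auto simp: node_def simp del: of_nat_mult intro!: add_nonneg_nonneg mult_nonneg_nonneg)
  ultimately interpret S: std_normal_sequence M "noise (node \<delta> (K * q))" "K * q + K" by (rule noise_sequence)
  show ?thesis by (rule S.std_normal_sequence_reindex[OF block_index_inj[OF assms(2)]])
qed

lemma mart_sq: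
  assumes F: "corrector c \<mu> \<kappa> q F C" and d: "0 < \<delta>"
  shows "integrable M (\<lambda>\<omega>. (mart F \<delta> N \<omega>)\<^sup>2)" "(\<integral>\<omega>. (mart F \<delta> N \<omega>)\<^sup>2 \<partial>M) \<le> C\<^sup>2 * (real N * \<delta>)"
    and "mart F \<delta> N \<in> borel_measurable M"
proof -
  interpret S: std_normal_sequence M "noise (grid \<delta>)" N by (rule grid_sequence[OF d])
  let ?a = "\<lambda>j \<omega>. sqrt \<delta> * F 1 (chain \<delta> \<omega> j)"
  have eq: "mart F \<delta> N \<omega> = S.transform ?a (\<lambda>x. x) N \<omega>" for \<omega> by (simp add: mart_def S.transform_def)
  have a: "?a i \<in> borel_measurable (S.past i)" if "i < N" for i
    using corrector_chain_past[OF F, of 1 \<delta> i N] d that by (intro borel_measurable_times) auto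
  have b: "\<bar>?a i \<omega>\<bar> \<le> sqrt \<delta> * C" for i \<omega>
    unfolding abs_mult using d corrector_chain_bound[OF F, of 1 \<delta> \<omega> i] by (intro mult_mono) auto
  have f: "(\<lambda>x :: real. x) \<in> borel_measurable borel" by simp
  show "integrable M (\<lambda>\<omega>. (mart F \<delta> N \<omega>)\<^sup>2)"
    unfolding eq by (rule S.transform_sq_integrable[where b = "\<lambda>_. sqrt \<delta> * C", OF a b f std_normal_moments(1,3,2,4) order_refl])
  have "(\<integral>\<omega>. (mart F \<delta> N \<omega>)\<^sup>2 \<partial>M) = 1 * (\<Sum>i<N. \<integral>\<omega>. (?a i \<omega>)\<^sup>2 \<partial>M)"
    unfolding eq by (rule S.transform_sq_expectation[where b = "\<lambda>_. sqrt \<delta> * C", OF a b f std_normal_moments(1,3,2,4) order_refl])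
  also have "\<dots> \<le> (\<Sum>i<N. C\<^sup>2 * \<delta>)"
  proof -
    have "(\<integral>\<omega>. (?a i \<omega>)\<^sup>2 \<partial>M) \<le> C\<^sup>2 * \<delta>" for i
    proof (rule integral_le_const)
      have le: "(?a i \<omega>)\<^sup>2 \<le> C\<^sup>2 * \<delta>" for \<omega>
      proof -
        have "\<bar>?a i \<omega>\<bar> \<le> sqrt \<delta> * C" by (rule b)
        from power_mono[OF this, of 2] show ?thesis using d by (simp add: power_mult_distrib mult.commute)
      qed
      show "integrable M (\<lambda>\<omega>. (?a i \<omega>)\<^sup>2)"
        using le corrector_chain_measurable[OF F, of 1 \<delta> i] d by (intro S.bounded_integrable[where B = "C\<^sup>2 * \<delta>"]) auto
      show "AE \<omega> in M. (?a i \<omega>)\<^sup>2 \<le> C\<^sup>2 * \<delta>" using le by simp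
    qed
    then show ?thesis by (simp only: mult_1) (rule sum_mono)
  qed
  finally show "(\<integral>\<omega>. (mart F \<delta> N \<omega>)\<^sup>2 \<partial>M) \<le> C\<^sup>2 * (real N * \<delta>)" by (simp add: mult_ac)
  show "mart F \<delta> N \<in> borel_measurable M"
    unfolding mart_def
    by (intro borel_measurable_sum borel_measurable_times borel_measurable_const noise_measurable corrector_chain_measurable[OF F] d) auto
qed

text \<open>Setting the coefficients to zero before the block makes the increment of the martingale
  a transform in its own right. As \<open>\<bar>F 1 x\<bar> \<le> 1\<close>, its variance is bounded
  by \<open>q * \<delta>\<close>, the length of the block.\<close>

lemma mart_oscillation:
  assumes F: "corrector c \<mu> \<kappa> q' F C" and F1: "\<And>x. 0 \<le> x \<Longrightarrow> x \<le> c \<Longrightarrow> \<bar>F 1 x\<bar> \<le> 1"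
    and d: "0 < \<delta>" and k: "k < K" and q: "0 < q" and l: "0 < l"
  shows "prob {\<omega> \<in> space M. \<exists>N\<in>{k * q..Suc k * q}. l \<le> \<bar>mart F \<delta> N \<omega> - mart F \<delta> (k * q) \<omega>\<bar>} \<le> 2 * exp (- l\<^sup>2 / (2 * (real q * \<delta>)))"
    and "{\<omega> \<in> space M. \<exists>N\<in>{k * q..Suc k * q}. l \<le> \<bar>mart F \<delta> N \<omega> - mart F \<delta> (k * q) \<omega>\<bar>} \<in> events"
proof -
  define n where "n = Suc k * q"
  interpret S: std_normal_sequence M "noise (grid \<delta>)" n by (rule grid_sequence[OF d])
  let ?a = "\<lambda>j \<omega>. if k * q \<le> j then sqrt \<delta> * F 1 (chain \<delta> \<omega> j) else 0"
  let ?b = "\<lambda>j. if k * q \<le> j then sqrt \<delta> else 0"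
  have a: "?a i \<in> borel_measurable (S.past i)" if "i < n" for i
    using corrector_chain_past[OF F, of 1 \<delta> i n] d that by (cases "k * q \<le> i") (auto intro!: borel_measurable_times)
  have b: "\<bar>?a i \<omega>\<bar> \<le> ?b i" for i \<omega>
    using d F1[of "chain \<delta> \<omega> i"] chain_bounds[of \<delta> \<omega> i] by (simp add: abs_mult mult_left_le)
  have "(\<Sum>i<n. (?b i)\<^sup>2) = (\<Sum>i\<in>{k * q..<n}. \<delta>)"
    using d by (intro sum.mono_neutral_cong_right) (auto simp: n_def)
  also have "\<dots> = real q * \<delta>" by (simp add: n_def)
  finally have v: "(\<Sum>i<n. (?b i)\<^sup>2) \<le> real q * \<delta>" by simp
  have eq: "mart F \<delta> N \<omega> - mart F \<delta> (k * q) \<omega> = S.transform ?a (\<lambda>x. x) N \<omega>" if "k * q \<le> N" for N \<omega>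
  proof -
    have "{..<N} = {..<k * q} \<union> {k * q..<N}" "{..<k * q} \<inter> {k * q..<N} = {}" using that by auto
    then have s: "(\<Sum>j<N. f j) = (\<Sum>j<k * q. f j) + (\<Sum>j\<in>{k * q..<N}. f j)" for f :: "nat \<Rightarrow> real"
      by (simp add: sum.union_disjoint)
    show ?thesis unfolding mart_def S.transform_def s by simp
  qed
  have sub: "{\<omega> \<in> space M. \<exists>N\<in>{k * q..Suc k * q}. l \<le> \<bar>mart F \<delta> N \<omega> - mart F \<delta> (k * q) \<omega>\<bar>}
     \<subseteq> {\<omega> \<in> space M. \<exists>N\<le>n. l \<le> \<bar>S.transform ?a (\<lambda>x. x) N \<omega>\<bar>}" (is "?A \<subseteq> ?B")
  proof
    fix \<omega> assume "\<omega> \<in> ?A"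
    then obtain N where "\<omega> \<in> space M" "k * q \<le> N" "N \<le> n" "l \<le> \<bar>mart F \<delta> N \<omega> - mart F \<delta> (k * q) \<omega>\<bar>"
      by (auto simp: n_def)
    then show "\<omega> \<in> ?B" unfolding eq[OF \<open>k * q \<le> N\<close>] by blast
  qed
  have "S.transform ?a (\<lambda>x. x) N \<in> borel_measurable M" if N: "N \<le> n" for N
    by (rule S.past_imp[OF S.transform_past N]) (use a N in auto)
  then have "(\<Union>N\<in>{..n}. {\<omega> \<in> space M. l \<le> \<bar>S.transform ?a (\<lambda>x. x) N \<omega>\<bar>}) \<in> events"
    by (intro sets.finite_UN) auto
  also have "(\<Union>N\<in>{..n}. {\<omega> \<in> space M. l \<le> \<bar>S.transform ?a (\<lambda>x. x) N \<omega>\<bar>}) = ?B" by auto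
  finally have "?B \<in> events" .
  then have "prob ?A \<le> prob ?B" by (rule finite_measure_mono[OF sub])
  also have "\<dots> \<le> 2 * exp (- l\<^sup>2 / (2 * (real q * \<delta>)))"
    by (rule S.gaussian_maximal[OF a b order_refl l v]) (use q d in simp_all)
  finally show "prob ?A \<le> 2 * exp (- l\<^sup>2 / (2 * (real q * \<delta>)))" .
  have [measurable]: "mart F \<delta> N \<in> borel_measurable M" for N by (rule mart_sq(3)[OF F d])
  show "?A \<in> events" by measurable
qed

text \<open>In each block the martingale is stopped just before its clock exceeds \<open>v\<close>, and the missing
  variance is supplied by the filler: the modified block sums are exactly Gaussian and independent.\<close>

lemma block_coupling:
  assumes F: "corrector c \<mu> \<kappa> q' F C" and F1: "\<And>x. 0 \<le> x \<Longrightarrow> x \<le> c \<Longrightarrow> \<bar>F 1 x\<bar> \<le> 1"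
    and K: "0 < K" and q: "0 < q" and d: "0 < \<delta>" and v: "0 < v"
  obtains G where "\<And>k. k < K \<Longrightarrow> G k \<in> borel_measurable M"
    and "distr M (\<Pi>\<^sub>M k\<in>{..<K}. borel) (\<lambda>\<omega>. \<lambda>k\<in>{..<K}. G k \<omega>) = (\<Pi>\<^sub>M k\<in>{..<K}. std_normal_distribution)"
    and "\<And>k. k < K \<Longrightarrow> integrable M (\<lambda>\<omega>. (mart F \<delta> (Suc k * q) \<omega> - mart F \<delta> (k * q) \<omega> - sqrt v * G k \<omega>)\<^sup>2)"
    and "\<And>k. k < K \<Longrightarrow> (\<integral>\<omega>. (mart F \<delta> (Suc k * q) \<omega> - mart F \<delta> (k * q) \<omega> - sqrt v * G k \<omega>)\<^sup>2 \<partial>M)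
      \<le> (\<integral>\<omega>. \<bar>(\<Sum>r<q. \<delta> * (F 1 (chain \<delta> \<omega> (k * q + r)))\<^sup>2) - v\<bar> + 2 * \<delta> \<partial>M)"
proof -
  define \<xi> where "\<xi> i = noise (node \<delta> (K * q)) (block_index q (K * q) i)" for i
  define N where "N = K * Suc q"
  interpret S: std_normal_sequence M \<xi> N
    unfolding \<xi>_def[abs_def] N_def by (rule block_sequence[OF d q])
  define u where "u k \<omega> r = F 1 (chain \<delta> \<omega> (k * q + r))" for k \<omega> r
  define D where "D k \<omega> r = \<delta> * (u k \<omega> r)\<^sup>2" for k \<omega> r
  define X where "X k \<omega> = cutoff v (D k \<omega>)" for k \<omega>
  define P where "P k \<omega> = (\<Sum>r<q. X k \<omega> r * D k \<omega> r)" for k \<omega>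
  \<comment> \<open>Coefficients of the Gaussian sum: the stopped martingale divided by
    \<open>sqrt v\<close>, and at position \<open>q\<close> the filler with the variance still
    missing. The next definitions give the coefficients \<open>p\<close> of the true martingale
    increment and the discrepancy \<open>h\<close>.\<close>
  define g where "g k \<omega> r = (if r < q then X k \<omega> r * (sqrt \<delta> * u k \<omega> r) / sqrt v else sqrt (1 - P k \<omega> / v))" for k \<omega> r
  define p where "p k \<omega> r = (if r < q then sqrt \<delta> * u k \<omega> r else 0)" for k \<omega> r
  define a where "a k i \<omega> = (if i div Suc q = k then g k \<omega> (i mod Suc q) else 0)" for k i \<omega>
  define h where "h k \<omega> r = p k \<omega> r - sqrt v * g k \<omega> r" for k \<omega> r
  define e where "e k i \<omega> = (if i div Suc q = k then h k \<omega> (i mod Suc q) else 0)" for k i \<omega>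
  have u1: "\<bar>u k \<omega> r\<bar> \<le> 1" for k \<omega> r unfolding u_def by (intro F1 chain_bounds)
  have u2: "(u k \<omega> r)\<^sup>2 \<le> 1" for k \<omega> r using u1[of k \<omega> r] by (simp add: abs_square_le_1)
  have D: "0 \<le> D k \<omega> r" "D k \<omega> r \<le> \<delta>" for k \<omega> r
    using d u2[of k \<omega> r] by (auto simp: D_def mult_left_le)
  have X01: "0 \<le> X k \<omega> r" "X k \<omega> r \<le> 1" for k \<omega> r by (auto simp: X_def cutoff_def)
  have P0: "0 \<le> P k \<omega>" for k \<omega> unfolding P_def using X01 D by (intro sum_nonneg mult_nonneg_nonneg) auto
  have cs: "P k \<omega> = (\<Sum>r<q. D k \<omega> r) \<and> (\<Sum>r<q. D k \<omega> r) \<le> v \<or>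
    v < (\<Sum>r<q. D k \<omega> r) \<and> v - \<delta> \<le> P k \<omega> \<and> P k \<omega> \<le> v" for k \<omega>
    unfolding P_def X_def by (rule cutoff_sum) (use D v in auto)
  have Pv: "P k \<omega> \<le> v" for k \<omega> using cs[of k \<omega>] by auto
  have P1: "0 \<le> 1 - P k \<omega> / v" "1 - P k \<omega> / v \<le> 1" for k \<omega> using Pv[of k \<omega>] P0[of k \<omega>] v by auto
  have sd: "0 \<le> sqrt \<delta>" "sqrt \<delta> * sqrt \<delta> = \<delta>" "sqrt v * sqrt v = v" "0 < sqrt v" using d v by auto
  have gb: "\<bar>g k \<omega> r\<bar> \<le> sqrt \<delta> / sqrt v + 1" for k \<omega> r
  proof (cases "r < q")
    case True
    have "\<bar>X k \<omega> r * (sqrt \<delta> * u k \<omega> r)\<bar> \<le> 1 * (sqrt \<delta> * 1)"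
      unfolding abs_mult using X01[of k \<omega> r] u1[of k \<omega> r] sd by (intro mult_mono) auto
    then have "\<bar>X k \<omega> r * (sqrt \<delta> * u k \<omega> r)\<bar> / sqrt v \<le> sqrt \<delta> / sqrt v" using sd by (intro divide_right_mono) auto
    then show ?thesis using True sd by (simp add: g_def)
  next
    case False
    have "sqrt (1 - P k \<omega> / v) \<le> 1" "0 \<le> sqrt (1 - P k \<omega> / v)" using P1[of k \<omega>] by auto
    moreover have "0 \<le> sqrt \<delta> / sqrt v" using sd by simp
    ultimately have "\<bar>sqrt (1 - P k \<omega> / v)\<bar> \<le> sqrt \<delta> / sqrt v + 1" by linarith
    then show ?thesis using False by (simp only: g_def if_False)
  qed
  have pb: "\<bar>p k \<omega> r\<bar> \<le> sqrt \<delta>" for k \<omega> r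
    using u1[of k \<omega> r] sd by (auto simp: p_def abs_mult mult_left_le)
  have ab: "\<bar>a k i \<omega>\<bar> \<le> sqrt \<delta> / sqrt v + 1" for k i \<omega>
    using gb[of k \<omega> "i mod Suc q"] sd by (auto simp: a_def)
  have hb: "\<bar>h k \<omega> r\<bar> \<le> sqrt \<delta> + sqrt v * (sqrt \<delta> / sqrt v + 1)" for k \<omega> r
  proof -
    have "\<bar>sqrt v * g k \<omega> r\<bar> \<le> sqrt v * (sqrt \<delta> / sqrt v + 1)"
      using gb[of k \<omega> r] sd by (simp only: abs_mult abs_of_pos mult_left_mono less_imp_le)
    then show ?thesis using pb[of k \<omega> r] unfolding h_def by linarith
  qed
  have eb: "\<bar>e k i \<omega>\<bar> \<le> sqrt \<delta> + sqrt v * (sqrt \<delta> / sqrt v + 1)" for k i \<omega>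
    using hb[of k \<omega> "i mod Suc q"] by (auto simp: e_def)

  \<comment> \<open>Step \<open>j\<close> of the walk stands at position \<open>j + j div q\<close>
    of the enumeration, after \<open>j div q\<close> fillers. For \<open>j < k * q + r\<close> with
    \<open>r \<le> q\<close> this is below \<open>k * Suc q + r\<close>, so the state of the chain
    is known in time.\<close>
  have noise_past: "noise (grid \<delta>) j \<in> borel_measurable (S.past (k * Suc q + r))"
    if "k < K" "r \<le> q" "j < k * q + r" for k r j
  proof -
    have "j < Suc k * q" using that by simp
    then have jk: "j div q \<le> k" using less_mult_imp_div_less less_Suc_eq_le by blast
    have jK: "j < K * q"
    proof -
      have "Suc k * q \<le> K * q" using that(1) by (intro mult_le_mono1) auto
      then show ?thesis using \<open>j < Suc k * q\<close> by linarith
    qed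
    define i where "i = (j div q) * Suc q + j mod q"
    have "i = j div q + ((j div q) * q + j mod q)" by (simp add: i_def)
    also have "\<dots> = j div q + j" by simp
    finally have "i < k * Suc q + r" using jk that(3) by simp
    then have "\<xi> i \<in> borel_measurable (S.past (k * Suc q + r))" by (rule S.zeta_past)
    moreover have "block_index q (K * q) i = j"
      unfolding i_def using block_index_at(1)[of "j mod q" q "K * q" "j div q"] q by simp
    then have "\<xi> i = noise (grid \<delta>) j" using node_noise[OF jK] by (simp add: \<xi>_def)
    ultimately show ?thesis by simp
  qed
  have u_past: "(\<lambda>\<omega>. u k \<omega> s) \<in> borel_measurable (S.past (k * Suc q + r))" if "k < K" "s \<le> r" "r \<le> q" for k r s
    unfolding u_def
    by (rule measurable_compose[OF chain_measurable[OF d] corrector_measurable[OF F]], rule noise_past) (use that in auto)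
  have D_past: "(\<lambda>\<omega>. D k \<omega> s) \<in> borel_measurable (S.past (k * Suc q + r))" if "k < K" "s \<le> r" "r \<le> q" for k r s
    unfolding D_def using u_past[OF that] by measurable
  have X_past: "(\<lambda>\<omega>. X k \<omega> s) \<in> borel_measurable (S.past (k * Suc q + r))" if "k < K" "s \<le> r" "r \<le> q" for k r s
  proof -
    have [measurable]: "(\<lambda>\<omega>. \<Sum>t<Suc s. D k \<omega> t) \<in> borel_measurable (S.past (k * Suc q + r))"
      using that by (intro borel_measurable_sum D_past) auto
    show ?thesis unfolding X_def cutoff_def by measurable
  qed
  have g_past: "(\<lambda>\<omega>. g k \<omega> r) \<in> borel_measurable (S.past (k * Suc q + r))" if "k < K" "r \<le> q" for k r
  proof (cases "r < q")
    case True
    have [measurable]: "(\<lambda>\<omega>. X k \<omega> r) \<in> borel_measurable (S.past (k * Suc q + r))" "(\<lambda>\<omega>. u k \<omega> r) \<in> borel_measurable (S.past (k * Suc q + r))"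
      using X_past[of k r r] u_past[of k r r] that by auto
    have "(\<lambda>\<omega>. X k \<omega> r * (sqrt \<delta> * u k \<omega> r) / sqrt v) \<in> borel_measurable (S.past (k * Suc q + r))" by measurable
    then show ?thesis using True by (simp add: g_def)
  next
    case False
    then have r: "r = q" using that by simp
    have [measurable]: "(\<lambda>\<omega>. P k \<omega>) \<in> borel_measurable (S.past (k * Suc q + r))"
      unfolding P_def using that r by (intro borel_measurable_sum borel_measurable_times X_past D_past) auto
    have "(\<lambda>\<omega>. sqrt (1 - P k \<omega> / v)) \<in> borel_measurable (S.past (k * Suc q + r))" by measurable
    then show ?thesis using r by (simp add: g_def)
  qed
  have p_past: "(\<lambda>\<omega>. p k \<omega> r) \<in> borel_measurable (S.past (k * Suc q + r))" if "k < K" "r \<le> q" for k r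
    unfolding p_def using u_past[of k r r] that by (cases "r < q") auto
  have split: "i = k * Suc q + i mod Suc q" "i mod Suc q \<le> q" if "i div Suc q = k" for i k
    using div_mult_mod_eq[of i "Suc q"] that mod_less_divisor[of "Suc q" i] by (auto simp: mult.commute)
  have a_past: "a k i \<in> borel_measurable (S.past i)" if "k < K" for k i
  proof (cases "i div Suc q = k")
    case True
    have "(\<lambda>\<omega>. g k \<omega> (i mod Suc q)) \<in> borel_measurable (S.past (k * Suc q + i mod Suc q))"
      using split[OF True] that by (intro g_past) auto
    then show ?thesis using True split(1)[OF True] by (simp add: a_def[abs_def])
  qed (simp add: a_def[abs_def])
  have e_past: "e k i \<in> borel_measurable (S.past i)" if "k < K" for k i
  proof (cases "i div Suc q = k")
    case True
    have "(\<lambda>\<omega>. p k \<omega> (i mod Suc q) - sqrt v * g k \<omega> (i mod Suc q)) \<in> borel_measurable (S.past (k * Suc q + i mod Suc q))"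
      using split[OF True] that by (intro borel_measurable_diff borel_measurable_times borel_measurable_const g_past p_past) auto
    then show ?thesis using True split(1)[OF True] by (simp add: e_def[abs_def] h_def)
  qed (simp add: e_def[abs_def])

  have one: "(\<Sum>i<N. (a k i \<omega>)\<^sup>2) = 1" if "k < K" for k \<omega>
  proof -
    have "(\<Sum>i<N. (a k i \<omega>)\<^sup>2) = (\<Sum>i<K * Suc q. if i div Suc q = k then (g k \<omega> (i mod Suc q))\<^sup>2 else 0)"
      unfolding N_def a_def by (intro sum.cong) auto
    also have "\<dots> = (\<Sum>r<q. (g k \<omega> r)\<^sup>2) + (g k \<omega> q)\<^sup>2" by (rule sum_block[OF that])
    also have "(\<Sum>r<q. (g k \<omega> r)\<^sup>2) = (\<Sum>r<q. X k \<omega> r * D k \<omega> r / v)"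
    proof (rule sum.cong)
      fix r assume "r \<in> {..<q}"
      have "(X k \<omega> r)\<^sup>2 = X k \<omega> r" by (simp add: X_def)
      then show "(g k \<omega> r)\<^sup>2 = X k \<omega> r * D k \<omega> r / v"
        using \<open>r \<in> {..<q}\<close> d v by (simp add: g_def D_def power_mult_distrib power_divide)
    qed simp
    also have "\<dots> = P k \<omega> / v" by (simp add: P_def sum_divide_distrib)
    also have "(g k \<omega> q)\<^sup>2 = 1 - P k \<omega> / v" using P1[of k \<omega>] by (simp add: g_def)
    finally show ?thesis by simp
  qed
  define G where "G k = S.transform (a k) (\<lambda>x. x) N" for k
  have Gm: "G k \<in> borel_measurable M" if "k < K" for k
    unfolding G_def by (rule S.past_imp[OF S.transform_past order_refl]) (use a_past that in auto)
  have law: "distr M (\<Pi>\<^sub>M k\<in>{..<K}. borel) (\<lambda>\<omega>. \<lambda>k\<in>{..<K}. G k \<omega>) = (\<Pi>\<^sub>M k\<in>{..<K}. std_normal_distribution)"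
    unfolding G_def
  proof (rule S.distr_block_transforms[OF K, where st = "\<lambda>k. k * Suc q" and b = "\<lambda>_. sqrt \<delta> / sqrt v + 1"])
    fix k i \<omega> assume "i < k * Suc q \<or> Suc k * Suc q \<le> i"
    then have "i div Suc q \<noteq> k"
      by (metis dividend_less_div_times zero_less_Suc add.commute div_times_less_eq_dividend mult_Suc not_le)
    then show "a k i \<omega> = 0" by (simp add: a_def)
  qed (use a_past ab one in \<open>auto simp: N_def\<close>)
  \<comment> \<open>The difference is again a transform, because the true increment and the Gaussian
    sum use the same noise; its second moment is therefore the sum of the expected squared
    coefficients.\<close>
  have diff: "mart F \<delta> (Suc k * q) \<omega> - mart F \<delta> (k * q) \<omega> - sqrt v * G k \<omega> = S.transform (e k) (\<lambda>x. x) N \<omega>" if k: "k < K" for k \<omega>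
  proof -
    have "S.transform (e k) (\<lambda>x. x) N \<omega> = (\<Sum>i<N. (if i div Suc q = k then p k \<omega> (i mod Suc q) * \<xi> (k * Suc q + i mod Suc q) \<omega> else 0) - sqrt v * (a k i \<omega> * \<xi> i \<omega>))"
      unfolding S.transform_def
    proof (rule sum.cong)
      fix i
      show "e k i \<omega> * \<xi> i \<omega> = (if i div Suc q = k then p k \<omega> (i mod Suc q) * \<xi> (k * Suc q + i mod Suc q) \<omega> else 0) - sqrt v * (a k i \<omega> * \<xi> i \<omega>)"
        using split(1)[of i k] by (auto simp: e_def h_def a_def left_diff_distrib simp del: mult_Suc_right)
    qed simp
    also have "\<dots> = (\<Sum>i<N. (if i div Suc q = k then p k \<omega> (i mod Suc q) * \<xi> (k * Suc q + i mod Suc q) \<omega> else 0)) - sqrt v * G k \<omega>"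
      by (simp add: sum_subtractf G_def S.transform_def sum_distrib_left)
    also have "(\<Sum>i<N. (if i div Suc q = k then p k \<omega> (i mod Suc q) * \<xi> (k * Suc q + i mod Suc q) \<omega> else 0))
        = (\<Sum>r<q. p k \<omega> r * \<xi> (k * Suc q + r) \<omega>) + p k \<omega> q * \<xi> (k * Suc q + q) \<omega>"
      unfolding N_def by (rule sum_block[OF k])
    also have "\<dots> = (\<Sum>r<q. sqrt \<delta> * F 1 (chain \<delta> \<omega> (k * q + r)) * noise (grid \<delta>) (k * q + r) \<omega>)"
    proof -
      have "\<xi> (k * Suc q + r) = noise (grid \<delta>) (k * q + r)" if "r < q" for r
      proof -
        have "Suc k * q \<le> K * q" using k by (intro mult_le_mono1) auto
        then have "k * q + r < K * q" using that by simp
        then show ?thesis using block_index_at(1)[OF that] node_noise by (simp add: \<xi>_def del: mult_Suc_right)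
      qed
      then show ?thesis by (simp add: p_def u_def del: mult_Suc_right)
    qed
    also have "\<dots> = mart F \<delta> (Suc k * q) \<omega> - mart F \<delta> (k * q) \<omega>"
      unfolding mart_def sum_lessThan_Suc_mult by simp
    finally show ?thesis by simp
  qed
  have x: "(\<lambda>x :: real. x) \<in> borel_measurable borel" by simp
  show ?thesis
  proof (rule that[OF Gm law])
    fix k assume k: "k < K"
    note ep = e_past[OF k]
    show "integrable M (\<lambda>\<omega>. (mart F \<delta> (Suc k * q) \<omega> - mart F \<delta> (k * q) \<omega> - sqrt v * G k \<omega>)\<^sup>2)"
      unfolding diff[OF k] by (rule S.transform_sq_integrable[OF ep eb x std_normal_moments(1,3,2,4) order_refl])
    have "(\<integral>\<omega>. (S.transform (e k) (\<lambda>x. x) N \<omega>)\<^sup>2 \<partial>M) = 1 * (\<Sum>i<N. \<integral>\<omega>. (e k i \<omega>)\<^sup>2 \<partial>M)"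
      by (rule S.transform_sq_expectation[OF ep eb x std_normal_moments(1,3,2,4) order_refl])
    also have "\<dots> = (\<integral>\<omega>. (\<Sum>i<N. (e k i \<omega>)\<^sup>2) \<partial>M)"
    proof -
      have "integrable M (\<lambda>\<omega>. (e k i \<omega>)\<^sup>2)" if "i < N" for i
      proof (rule S.bounded_integrable[where B = "(sqrt \<delta> + sqrt v * (sqrt \<delta> / sqrt v + 1))\<^sup>2"])
        show "(\<lambda>\<omega>. (e k i \<omega>)\<^sup>2) \<in> borel_measurable M" using S.past_imp[OF ep less_imp_le[OF that]] by measurable
        show "norm ((e k i \<omega>)\<^sup>2) \<le> (sqrt \<delta> + sqrt v * (sqrt \<delta> / sqrt v + 1))\<^sup>2" for \<omega>
          using power_mono[OF eb[of k i \<omega>], of 2] by simp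
      qed
      then show ?thesis by (subst Bochner_Integration.integral_sum) auto
    qed
    also have "\<dots> \<le> (\<integral>\<omega>. \<bar>(\<Sum>r<q. D k \<omega> r) - v\<bar> + 2 * \<delta> \<partial>M)"
    proof (rule integral_mono)
      \<comment> \<open>The squares add up to the part of the clock that was cut off plus the filler
        variance \<open>v - P k \<omega>\<close>. Without stopping the first part vanishes; with
        stopping \<open>v - P k \<omega> \<le> \<delta>\<close>. Either way the total is the
        deviation of the full clock from \<open>v\<close>, up to
        \<open>2 * \<delta>\<close>.\<close>
      have le: "(\<Sum>i<N. (e k i \<omega>)\<^sup>2) \<le> \<bar>(\<Sum>r<q. D k \<omega> r) - v\<bar> + 2 * \<delta>" for \<omega>
      proof -
        have "(\<Sum>i<N. (e k i \<omega>)\<^sup>2) = (\<Sum>i<K * Suc q. if i div Suc q = k then (h k \<omega> (i mod Suc q))\<^sup>2 else 0)"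
          unfolding N_def e_def by (intro sum.cong) auto
        also have "\<dots> = (\<Sum>r<q. (h k \<omega> r)\<^sup>2) + (h k \<omega> q)\<^sup>2" by (rule sum_block[OF k])
        also have "(\<Sum>r<q. (h k \<omega> r)\<^sup>2) = (\<Sum>r<q. D k \<omega> r - X k \<omega> r * D k \<omega> r)"
        proof (rule sum.cong)
          fix r assume "r \<in> {..<q}"
          then have "h k \<omega> r = (1 - X k \<omega> r) * (sqrt \<delta> * u k \<omega> r)" using sd by (simp add: h_def p_def g_def algebra_simps)
          moreover have "(1 - X k \<omega> r)\<^sup>2 = 1 - X k \<omega> r" by (auto simp: X_def cutoff_def)
          moreover have "(sqrt \<delta>)\<^sup>2 = \<delta>" using d by simp
          ultimately have "(h k \<omega> r)\<^sup>2 = (1 - X k \<omega> r) * D k \<omega> r" by (simp only: power_mult_distrib D_def)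
          then show "(h k \<omega> r)\<^sup>2 = D k \<omega> r - X k \<omega> r * D k \<omega> r" by (simp add: left_diff_distrib)
        qed simp
        also have "\<dots> = (\<Sum>r<q. D k \<omega> r) - P k \<omega>" by (simp add: sum_subtractf P_def)
        also have "(h k \<omega> q)\<^sup>2 = v - P k \<omega>"
          using P1[of k \<omega>] v by (simp add: h_def p_def g_def power_mult_distrib right_diff_distrib)
        finally have eq: "(\<Sum>i<N. (e k i \<omega>)\<^sup>2) = (\<Sum>r<q. D k \<omega> r) - P k \<omega> + (v - P k \<omega>)" .
        show ?thesis using cs[of k \<omega>] d unfolding eq by linarith
      qed
      show "(\<Sum>i<N. (e k i \<omega>)\<^sup>2) \<le> \<bar>(\<Sum>r<q. D k \<omega> r) - v\<bar> + 2 * \<delta>" for \<omega> by (rule le)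
      have DM: "(\<lambda>\<omega>. D k \<omega> r) \<in> borel_measurable M" for r
        unfolding D_def u_def using corrector_chain_measurable[OF F, of 1 \<delta>] d
        by (intro borel_measurable_times borel_measurable_power) auto
      show int: "integrable M (\<lambda>\<omega>. \<bar>(\<Sum>r<q. D k \<omega> r) - v\<bar> + 2 * \<delta>)"
      proof (rule S.bounded_integrable[where B = "real q * \<delta> + v + 2 * \<delta>"])
        show "(\<lambda>\<omega>. \<bar>(\<Sum>r<q. D k \<omega> r) - v\<bar> + 2 * \<delta>) \<in> borel_measurable M" using DM by measurable
        fix \<omega>
        have "(\<Sum>r<q. D k \<omega> r) \<le> (\<Sum>r<q. \<delta>)" using D by (intro sum_mono) auto
        moreover have "0 \<le> (\<Sum>r<q. D k \<omega> r)" using D by (intro sum_nonneg) auto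
        ultimately show "norm (\<bar>(\<Sum>r<q. D k \<omega> r) - v\<bar> + 2 * \<delta>) \<le> real q * \<delta> + v + 2 * \<delta>" using v d by auto
      qed
      show "integrable M (\<lambda>\<omega>. \<Sum>i<N. (e k i \<omega>)\<^sup>2)"
      proof (rule Bochner_Integration.integrable_bound[OF int])
        have "e k i \<in> borel_measurable M" if "i < N" for i using S.past_imp[OF ep less_imp_le[OF that]] .
        then show "(\<lambda>\<omega>. \<Sum>i<N. (e k i \<omega>)\<^sup>2) \<in> borel_measurable M" by (intro borel_measurable_sum borel_measurable_power) auto
        show "AE \<omega> in M. norm (\<Sum>i<N. (e k i \<omega>)\<^sup>2) \<le> norm (\<bar>(\<Sum>r<q. D k \<omega> r) - v\<bar> + 2 * \<delta>)"
          using le d by (intro AE_I2) (simp add: sum_nonneg)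
      qed
    qed
    finally show "(\<integral>\<omega>. (mart F \<delta> (Suc k * q) \<omega> - mart F \<delta> (k * q) \<omega> - sqrt v * G k \<omega>)\<^sup>2 \<partial>M)
      \<le> (\<integral>\<omega>. \<bar>(\<Sum>r<q. \<delta> * (F 1 (chain \<delta> \<omega> (k * q + r)))\<^sup>2) - v\<bar> + 2 * \<delta> \<partial>M)"
      unfolding diff[OF k] by (simp add: D_def u_def)
  qed
qed

text \<open>On \<open>E\<close> the second corrector writes the clock deviation of a block as a
  difference of two values of \<open>mart G\<close>, up to \<open>2 * C0\<close>; their first
  moments are of order \<open>sqrt R\<close>, small against \<open>R\<close>. Off \<open>E\<close>
  there is only the crude bound \<open>R * (1 + sigma_sq c \<mu>)\<close>, paid for by the small
  probability.\<close>

lemma clock_deviation: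
  assumes F: "corrector c \<mu> 1 (\<lambda>_. m_const c \<mu>) F C"
    and G: "corrector c \<mu> 0 (\<lambda>x. (F 1 x)\<^sup>2 - sigma_sq c \<mu>) G C"
    and F1: "\<And>x. 0 \<le> x \<Longrightarrow> x \<le> c \<Longrightarrow> \<bar>F 1 x\<bar> \<le> 1"
    and k: "k < K" and q: "0 < q" and R: "0 < R" and d: "\<delta> = R / real (K * q)"
    and E: "E \<in> events" "1 - \<eta> \<le> prob E" and C0': "0 \<le> C0"
    and good: "\<And>\<omega> N. \<omega> \<in> E \<Longrightarrow> N \<le> K * q \<Longrightarrow>
      \<bar>\<delta> * (\<Sum>j<N. (F 1 (chain \<delta> \<omega> j))\<^sup>2 - sigma_sq c \<mu>) + mart G \<delta> N \<omega>\<bar> \<le> C0"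
  shows "(\<integral>\<omega>. \<bar>(\<Sum>r<q. \<delta> * (F 1 (chain \<delta> \<omega> (k * q + r)))\<^sup>2) - sigma_sq c \<mu> * (R / real K)\<bar> + 2 * \<delta> \<partial>M)
    \<le> 2 * C0 + 2 * (1 + C\<^sup>2) * sqrt R + R * (1 + sigma_sq c \<mu>) * \<eta> + 2 * \<delta>"
proof -
  have dpos: "0 < \<delta>" using R q k by (simp add: d)
  have s2: "0 < sigma_sq c \<mu>" by (rule sigma_sq_pos[OF c])
  define V where "V \<omega> = (\<Sum>r<q. \<delta> * (F 1 (chain \<delta> \<omega> (k * q + r)))\<^sup>2) - sigma_sq c \<mu> * (R / real K)" for \<omega>
  have le: "Suc k * q \<le> K * q" "k * q \<le> K * q" using k by (intro mult_le_mono1; simp)+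
  have KqR: "real (K * q) * \<delta> = R" using q k by (simp add: d)
  have sR: "0 < sqrt R" "sqrt R * sqrt R = R" using R by auto
  have V_eq: "V \<omega> = \<delta> * (\<Sum>j<Suc k * q. (F 1 (chain \<delta> \<omega> j))\<^sup>2 - sigma_sq c \<mu>) - \<delta> * (\<Sum>j<k * q. (F 1 (chain \<delta> \<omega> j))\<^sup>2 - sigma_sq c \<mu>)" for \<omega>
  proof -
    have "real q * \<delta> = R / K" using q k by (simp add: d)
    moreover have "(\<Sum>r<q. \<delta> * sigma_sq c \<mu>) = sigma_sq c \<mu> * (real q * \<delta>)" by simp
    ultimately have "(\<Sum>r<q. \<delta> * sigma_sq c \<mu>) = sigma_sq c \<mu> * (R / K)" by simp
    then have "V \<omega> = (\<Sum>r<q. \<delta> * ((F 1 (chain \<delta> \<omega> (k * q + r)))\<^sup>2 - sigma_sq c \<mu>))"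
      by (simp add: V_def right_diff_distrib sum_subtractf)
    then show ?thesis unfolding sum_lessThan_Suc_mult by (simp add: sum_distrib_left distrib_left)
  qed
  define H where "H \<omega> = 2 * C0 + ((sqrt R + (mart G \<delta> (Suc k * q) \<omega>)\<^sup>2 / sqrt R) + (sqrt R + (mart G \<delta> (k * q) \<omega>)\<^sup>2 / sqrt R))
      + R * (1 + sigma_sq c \<mu>) * indicator (space M - E) \<omega> + 2 * \<delta>" for \<omega>
  \<comment> \<open>A weighted comparison of arithmetic and geometric mean trades the second
    moments, of order \<open>R\<close>, for first moments of order \<open>sqrt R\<close>.\<close>
  have am: "\<bar>x\<bar> \<le> sqrt R + x\<^sup>2 / sqrt R" for x
  proof -
    have "0 \<le> (\<bar>x\<bar> - sqrt R)\<^sup>2 + \<bar>x\<bar> * sqrt R" using sR by simp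
    also have "\<dots> = x\<^sup>2 + R - \<bar>x\<bar> * sqrt R" using R by (simp add: power2_diff)
    finally have "\<bar>x\<bar> * sqrt R \<le> x\<^sup>2 + R" by simp
    then have "\<bar>x\<bar> \<le> (x\<^sup>2 + R) / sqrt R" using sR by (simp add: le_divide_eq)
    also have "\<dots> = sqrt R + x\<^sup>2 / sqrt R" using R by (simp add: add_divide_distrib real_div_sqrt)
    finally show ?thesis .
  qed
  have bound: "\<bar>V \<omega>\<bar> + 2 * \<delta> \<le> H \<omega>" if w: "\<omega> \<in> space M" for \<omega>
  proof (cases "\<omega> \<in> E")
    case True
    have "\<bar>V \<omega>\<bar> \<le> 2 * C0 + \<bar>mart G \<delta> (Suc k * q) \<omega>\<bar> + \<bar>mart G \<delta> (k * q) \<omega>\<bar>"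
      using good[OF True le(1)] good[OF True le(2)] unfolding V_eq by linarith
    moreover have ind: "indicator (space M - E) \<omega> = (0 :: real)" using True by simp
    ultimately show ?thesis using am[of "mart G \<delta> (Suc k * q) \<omega>"] am[of "mart G \<delta> (k * q) \<omega>"]
      unfolding H_def ind by linarith
  next
    case False
    have u: "(F 1 (chain \<delta> \<omega> j))\<^sup>2 \<le> 1" for j using F1[of "chain \<delta> \<omega> j"] chain_bounds[of \<delta> \<omega> j] by (simp add: abs_square_le_1)
    have "(\<Sum>r<q. \<delta> * (F 1 (chain \<delta> \<omega> (k * q + r)))\<^sup>2) \<le> (\<Sum>r<q. \<delta> * 1)"
      using u dpos by (intro sum_mono mult_left_mono) auto
    also have "\<dots> = real q * \<delta>" by simp
    also have "\<dots> \<le> real (K * q) * \<delta>"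
    proof (rule mult_right_mono)
      have "1 * q \<le> K * q" using k by (intro mult_le_mono1) auto
      then show "real q \<le> real (K * q)" by (simp only: of_nat_le_iff mult_1)
    qed (use dpos in simp)
    finally have a1: "(\<Sum>r<q. \<delta> * (F 1 (chain \<delta> \<omega> (k * q + r)))\<^sup>2) \<le> R" unfolding KqR .
    have a2: "0 \<le> (\<Sum>r<q. \<delta> * (F 1 (chain \<delta> \<omega> (k * q + r)))\<^sup>2)" using dpos by (intro sum_nonneg) auto
    have "R / K \<le> R" using R k by (simp add: divide_le_eq)
    then have "sigma_sq c \<mu> * (R / K) \<le> sigma_sq c \<mu> * R" using s2 by (intro mult_left_mono) auto
    moreover have "0 \<le> sigma_sq c \<mu> * (R / K)" using s2 R by simp
    moreover have "0 \<le> sigma_sq c \<mu> * R" using s2 R by simp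
    ultimately have "\<bar>V \<omega>\<bar> \<le> R * (1 + sigma_sq c \<mu>)" using a1 a2 R unfolding V_def by (simp add: distrib_left mult.commute)
    moreover have "0 \<le> sqrt R + (mart G \<delta> (Suc k * q) \<omega>)\<^sup>2 / sqrt R" "0 \<le> sqrt R + (mart G \<delta> (k * q) \<omega>)\<^sup>2 / sqrt R"
      using sR by (auto intro!: add_nonneg_nonneg)
    ultimately show ?thesis using False w C0' unfolding H_def by (simp add: indicator_def)
  qed
  note ms = mart_sq[OF G dpos]
  have VM: "V \<in> borel_measurable M"
    unfolding V_def using corrector_chain_measurable[OF F, of 1 \<delta>] dpos
    by (intro borel_measurable_diff borel_measurable_sum borel_measurable_times borel_measurable_power) auto
  have iH: "integrable M H"
    unfolding H_def using ms(1)[of "Suc k * q"] ms(1)[of "k * q"] E(1)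
    by (intro Bochner_Integration.integrable_add integrable_mult_right integrable_divide integrable_const integrable_real_indicator) (auto simp: less_top[symmetric])
  show ?thesis
  proof -
    have "(\<integral>\<omega>. \<bar>V \<omega>\<bar> + 2 * \<delta> \<partial>M) \<le> (\<integral>\<omega>. H \<omega> \<partial>M)"
    proof (rule integral_mono[OF _ iH])
      show "integrable M (\<lambda>\<omega>. \<bar>V \<omega>\<bar> + 2 * \<delta>)"
      proof (rule Bochner_Integration.integrable_bound[OF iH])
        show "AE \<omega> in M. norm (\<bar>V \<omega>\<bar> + 2 * \<delta>) \<le> norm (H \<omega>)"
        proof (rule AE_I2)
          fix \<omega> assume w: "\<omega> \<in> space M"
          show "norm (\<bar>V \<omega>\<bar> + 2 * \<delta>) \<le> norm (H \<omega>)" using bound[OF w] dpos by simp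
        qed
      qed (use VM in measurable)
    qed (use bound in auto)
    also have "(\<integral>\<omega>. H \<omega> \<partial>M) = 2 * C0 + ((sqrt R + (\<integral>\<omega>. (mart G \<delta> (Suc k * q) \<omega>)\<^sup>2 \<partial>M) / sqrt R) + (sqrt R + (\<integral>\<omega>. (mart G \<delta> (k * q) \<omega>)\<^sup>2 \<partial>M) / sqrt R))
      + R * (1 + sigma_sq c \<mu>) * prob (space M - E) + 2 * \<delta>"
    proof -
      have i: "integrable M (\<lambda>\<omega>. (mart G \<delta> n \<omega>)\<^sup>2 / sqrt R)" for n using ms(1) by simp
      have ie: "integrable M (\<lambda>\<omega>. R * (1 + sigma_sq c \<mu>) * indicator (space M - E) \<omega>)"
        using E(1) by (intro integrable_mult_right integrable_real_indicator) (auto simp: less_top[symmetric])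
      have pe: "(\<integral>\<omega>. R * (1 + sigma_sq c \<mu>) * indicator (space M - E) \<omega> \<partial>M) = R * (1 + sigma_sq c \<mu>) * prob (space M - E)"
        using E(1) by (subst integral_mult_right_zero) simp
      show ?thesis
        unfolding H_def
        by (subst Bochner_Integration.integral_add | intro Bochner_Integration.integrable_add integrable_const i ie | simp only: pe integral_divide_zero)+
          (simp add: prob_space)
    qed
    also have "\<dots> \<le> 2 * C0 + ((sqrt R + C\<^sup>2 * sqrt R) + (sqrt R + C\<^sup>2 * sqrt R)) + R * (1 + sigma_sq c \<mu>) * \<eta> + 2 * \<delta>"
    proof -
      have mm: "(\<integral>\<omega>. (mart G \<delta> n \<omega>)\<^sup>2 \<partial>M) / sqrt R \<le> C\<^sup>2 * sqrt R" if "n \<le> K * q" for n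
      proof -
        have "(\<integral>\<omega>. (mart G \<delta> n \<omega>)\<^sup>2 \<partial>M) \<le> C\<^sup>2 * (real n * \<delta>)" by (rule ms(2))
        also have "real n * \<delta> \<le> real (K * q) * \<delta>" using that dpos by (intro mult_right_mono) (auto simp del: of_nat_mult)
        then have "C\<^sup>2 * (real n * \<delta>) \<le> C\<^sup>2 * R" unfolding KqR by (intro mult_left_mono) auto
        finally have "(\<integral>\<omega>. (mart G \<delta> n \<omega>)\<^sup>2 \<partial>M) / sqrt R \<le> C\<^sup>2 * R / sqrt R" using sR by (intro divide_right_mono) auto
        then show ?thesis using R by (simp add: real_div_sqrt flip: times_divide_eq_right)
      qed
      have "prob (space M - E) \<le> \<eta>" using E prob_compl[OF E(1)] by simp
      then have "R * (1 + sigma_sq c \<mu>) * prob (space M - E) \<le> R * (1 + sigma_sq c \<mu>) * \<eta>"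
        using R s2 by (intro mult_left_mono) auto
      then show ?thesis using mm[OF le(1)] mm[OF le(2)] by linarith
    qed
    also have "\<dots> = 2 * C0 + 2 * (1 + C\<^sup>2) * sqrt R + R * (1 + sigma_sq c \<mu>) * \<eta> + 2 * \<delta>" by (simp add: algebra_simps)
    finally show ?thesis unfolding V_def .
  qed
qed

section \<open>Choice of the parameters\<close>

definition near_gaussian_polygon :: "real \<Rightarrow> real \<Rightarrow> real \<Rightarrow> nat \<Rightarrow> nat \<Rightarrow> bool" where
  "near_gaussian_polygon T \<rho> \<eta> K n \<longleftrightarrow> (\<exists>G. \<exists>E\<in>events. 1 - \<eta> \<le> prob E \<and>
    (\<forall>k<K. G k \<in> borel_measurable M) \<and>
    distr M (\<Pi>\<^sub>M k\<in>{..<K}. borel) (\<lambda>\<omega>. \<lambda>k\<in>{..<K}. G k \<omega>) = (\<Pi>\<^sub>M k\<in>{..<K}. std_normal_distribution) \<and>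
    (\<forall>\<omega>\<in>E. \<forall>t\<in>{0..T}. \<bar>(tv c (path \<omega>) (real n * t) - m_const c \<mu> * (real n * t)) / (sigma_const c \<mu> * sqrt (real n))
      - polygon T K (\<lambda>k. sqrt (T / K) * G k \<omega>) t\<bar> \<le> \<rho>))"

text \<open>\<open>K\<close> is fixed first, so large that the exponential oscillation bound beats
  the union over the blocks; then \<open>n\<close>, so large that the clock errors of order
  \<open>sqrt n\<close> are negligible against \<open>n\<close>; last the mesh, through
  \<open>good_events\<close> for this \<open>n\<close>.\<close>

lemma coupling:
  assumes T: "0 < T" and rho: "0 < \<rho>" and eta: "0 < \<eta>"
  shows "\<exists>K0. \<forall>K\<ge>K0. \<exists>n0. \<forall>n\<ge>n0. near_gaussian_polygon T \<rho> \<eta> K n"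
proof -
  obtain F G C where F: "corrector c \<mu> 1 (\<lambda>_. m_const c \<mu>) F C"
    and G: "corrector c \<mu> 0 (\<lambda>x. (F 1 x)\<^sup>2 - sigma_sq c \<mu>) G C"
    and F1: "\<And>x. 0 \<le> x \<Longrightarrow> x \<le> c \<Longrightarrow> \<bar>F 1 x\<bar> \<le> 1"
    using correctors_exist[OF c] by metis
  have C: "0 \<le> C" using corrector_nonneg[OF F] c by simp
  define s2 where "s2 = sigma_sq c \<mu>"
  define \<sigma> where "\<sigma> = sigma_const c \<mu>"
  define m where "m = m_const c \<mu>"
  have s2: "0 < s2" unfolding s2_def by (rule sigma_sq_pos[OF c])
  have sig: "0 < \<sigma>" "\<sigma> = sqrt s2" using s2 by (auto simp: \<sigma>_def sigma_const_def s2_def)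
  \<comment> \<open>With \<open>l = \<Lambda> * sqrt n\<close> the total error \<open>4 * l\<close>
    becomes \<open>4 * \<rho> / 6\<close> after division by
    \<open>\<sigma> * sqrt n\<close>.\<close>
  define \<Lambda> where "\<Lambda> = \<rho> * \<sigma> / 6"
  have Lam: "0 < \<Lambda>" using rho sig by (simp add: \<Lambda>_def)
  define C0 where "C0 = c / 2 + 2 * C + 4"
  have C0: "0 \<le> C0" using c C by (simp add: C0_def)
  \<comment> \<open>The Gaussian exponent \<open>l\<^sup>2 / (2 * (R / K))\<close> of one block,
    with \<open>R = n * T\<close>, equals \<open>a * K\<close> independently of
    \<open>n\<close>.\<close>
  define a where "a = \<Lambda>\<^sup>2 / (2 * T)"
  have a: "0 < a" using Lam T by (simp add: a_def)
  have "(\<lambda>K. 2 * real K * exp (- (a * real K))) \<longlonglongrightarrow> 0" using a by real_asymp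
  then have "\<forall>\<^sub>F K in sequentially. 2 * real K * exp (- (a * real K)) < \<eta> / 3"
    by (rule order_tendstoD(2)) (use eta in simp)
  then obtain K0 where K0: "\<And>K. K \<ge> K0 \<Longrightarrow> 2 * real K * exp (- (a * real K)) < \<eta> / 3"
    by (auto simp: eventually_sequentially)
  show ?thesis
  proof (rule exI[of _ "Suc K0"], intro allI impI)
    fix K assume K: "Suc K0 \<le> K"
    then have Kpos: "0 < K" "K0 \<le> K" by auto
    \<comment> \<open>\<open>K\<close> applications of Markov's inequality at level
      \<open>l' = l / (K + 1)\<close> put this factor in front of the mean squared discrepancy
      divided by \<open>n\<close>. The part of it that does not vanish as \<open>n\<close> grows is
      \<open>T * (1 + s2) * \<eta>'\<close>, and \<open>\<eta>'\<close> is chosen to absorb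
      \<open>A\<close>.\<close>
    define A where "A = real K * (real K + 1)\<^sup>2 / \<Lambda>\<^sup>2"
    have A: "0 < A" using Kpos Lam by (simp add: A_def)
    define \<eta>' where "\<eta>' = min (\<eta> / 3) (\<eta> / (6 * A * T * (1 + s2)))"
    have eta': "0 < \<eta>'" "\<eta>' \<le> \<eta> / 3" using eta A T s2 by (auto simp: \<eta>'_def)
    have A3: "A * (T * (1 + s2) * \<eta>') \<le> \<eta> / 6"
    proof -
      have "\<eta>' \<le> \<eta> / (6 * A * T * (1 + s2))" by (simp add: \<eta>'_def)
      then have "(A * T * (1 + s2)) * \<eta>' \<le> (A * T * (1 + s2)) * (\<eta> / (6 * A * T * (1 + s2)))"
        using A T s2 by (intro mult_left_mono) auto
      also have "\<dots> = \<eta> / 6" using A T s2 by (simp add: divide_simps)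
      finally show ?thesis by (simp add: mult_ac)
    qed
    have l1: "(\<lambda>n. 1 / real n) \<longlonglongrightarrow> 0" by real_asymp
    have l2: "(\<lambda>n. sqrt (real n * T) / real n) \<longlonglongrightarrow> 0" using T by real_asymp
    have "(\<lambda>n. A * ((2 * C0 + 2) * (1 / real n) + 2 * (1 + C\<^sup>2) * (sqrt (real n * T) / real n) + T * (1 + s2) * \<eta>'))
        \<longlonglongrightarrow> A * ((2 * C0 + 2) * 0 + 2 * (1 + C\<^sup>2) * 0 + T * (1 + s2) * \<eta>')"
      by (intro tendsto_intros l1 l2)
    then have e1: "\<forall>\<^sub>F n in sequentially. A * ((2 * C0 + 2) * (1 / real n) + 2 * (1 + C\<^sup>2) * (sqrt (real n * T) / real n) + T * (1 + s2) * \<eta>') < \<eta> / 3"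
      by (rule order_tendstoD(2)) (use A3 eta in simp)
    have e2: "\<forall>\<^sub>F n in sequentially. C0 + \<bar>m\<bar> \<le> \<Lambda> * sqrt (real n)"
    proof -
      obtain n1 :: nat where n1: "((C0 + \<bar>m\<bar>) / \<Lambda>)\<^sup>2 < real n1" using reals_Archimedean2 by blast
      show ?thesis
      proof (rule eventually_sequentiallyI[of n1])
        fix n assume "n1 \<le> n"
        then have "((C0 + \<bar>m\<bar>) / \<Lambda>)\<^sup>2 \<le> real n" using n1 by linarith
        then have "(C0 + \<bar>m\<bar>) / \<Lambda> \<le> sqrt (real n)" by (rule real_le_rsqrt)
        then show "C0 + \<bar>m\<bar> \<le> \<Lambda> * sqrt (real n)" using Lam by (simp add: divide_le_eq mult.commute)
      qed
    qed
    from eventually_conj[OF e1 e2] obtain n0 where n0: "\<And>n. n \<ge> n0 \<Longrightarrow>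
        A * ((2 * C0 + 2) * (1 / real n) + 2 * (1 + C\<^sup>2) * (sqrt (real n * T) / real n) + T * (1 + s2) * \<eta>') < \<eta> / 3
        \<and> C0 + \<bar>m\<bar> \<le> \<Lambda> * sqrt (real n)"
      by (auto simp: eventually_sequentially)
    show "\<exists>n0. \<forall>n\<ge>n0. near_gaussian_polygon T \<rho> \<eta> K n"
    proof (rule exI[of _ "Suc n0"], intro allI impI)
      fix n assume "Suc n0 \<le> n"
      then have n: "0 < n" "n0 \<le> n" by auto
      note n0 = n0[OF n(2)]
      define R where "R = real n * T"
      have R: "0 < R" using n T by (simp add: R_def)
      have "\<forall>\<^sub>F L in sequentially. R / real L < 1" by real_asymp
      from eventually_conj[OF this good_events[OF F G R eta'(1)]]
      obtain L0 where L0: "\<And>L. L \<ge> L0 \<Longrightarrow> R / real L < 1 \<and> (\<exists>E\<in>events. 1 - \<eta>' \<le> prob E \<and>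
          (\<forall>\<omega>\<in>E. good C0 F G (R / real L) L \<omega>))"
        by (auto simp only: eventually_sequentially C0_def)
      \<comment> \<open>The number of grid steps has to be a multiple of \<open>K\<close>; this
        choice makes \<open>K * q\<close> exceed the threshold \<open>L0\<close>.\<close>
      define q where "q = Suc L0"
      have q: "0 < q" by (simp add: q_def)
      define \<delta> where "\<delta> = R / real (K * q)"
      have "1 * q \<le> K * q" using Kpos by (intro mult_le_mono1) auto
      then have "L0 \<le> K * q" by (simp add: q_def)
      from L0[OF this] obtain E1 where d1: "\<delta> < 1" and E1: "E1 \<in> events" "1 - \<eta>' \<le> prob E1"
        and g1: "\<And>\<omega> N. \<omega> \<in> E1 \<Longrightarrow> N \<le> K * q \<Longrightarrow> \<bar>tv c (path \<omega>) (real N * \<delta>) - m * (real N * \<delta>) - mart F \<delta> N \<omega>\<bar> \<le> C0"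
        and g2: "\<And>\<omega> N. \<omega> \<in> E1 \<Longrightarrow> N \<le> K * q \<Longrightarrow> \<bar>\<delta> * (\<Sum>j<N. (F 1 (chain \<delta> \<omega> j))\<^sup>2 - sigma_sq c \<mu>) + mart G \<delta> N \<omega>\<bar> \<le> C0"
        unfolding \<delta>_def[symmetric] m_def good_def by blast
      have d: "0 < \<delta>" using R q Kpos by (simp add: \<delta>_def)
      define v where "v = s2 * (R / K)"
      have v: "0 < v" using s2 R Kpos by (simp add: v_def)
      obtain Z where Z: "\<And>k. k < K \<Longrightarrow> Z k \<in> borel_measurable M"
        "distr M (\<Pi>\<^sub>M k\<in>{..<K}. borel) (\<lambda>\<omega>. \<lambda>k\<in>{..<K}. Z k \<omega>) = (\<Pi>\<^sub>M k\<in>{..<K}. std_normal_distribution)"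
        "\<And>k. k < K \<Longrightarrow> integrable M (\<lambda>\<omega>. (mart F \<delta> (Suc k * q) \<omega> - mart F \<delta> (k * q) \<omega> - sqrt v * Z k \<omega>)\<^sup>2)"
        "\<And>k. k < K \<Longrightarrow> (\<integral>\<omega>. (mart F \<delta> (Suc k * q) \<omega> - mart F \<delta> (k * q) \<omega> - sqrt v * Z k \<omega>)\<^sup>2 \<partial>M)
          \<le> (\<integral>\<omega>. \<bar>(\<Sum>r<q. \<delta> * (F 1 (chain \<delta> \<omega> (k * q + r)))\<^sup>2) - v\<bar> + 2 * \<delta> \<partial>M)"
        by (rule block_coupling[OF F F1 Kpos(1) q d v]) blast+
      \<comment> \<open>The last summand \<open>2\<close> bounds \<open>2 * \<delta>\<close>, as
        \<open>\<delta> < 1\<close>.\<close>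
      define Bn where "Bn = 2 * C0 + 2 * (1 + C\<^sup>2) * sqrt R + R * (1 + s2) * \<eta>' + 2"
      have var: "(\<integral>\<omega>. (mart F \<delta> (Suc k * q) \<omega> - mart F \<delta> (k * q) \<omega> - sqrt v * Z k \<omega>)\<^sup>2 \<partial>M) \<le> Bn" if k: "k < K" for k
        using Z(4)[OF k] clock_deviation[OF F G F1 k q R \<delta>_def E1 C0 g2] d1 
        unfolding Bn_def s2_def[symmetric] v_def by linarith
      define l where "l = \<Lambda> * sqrt (real n)"
      \<comment> \<open>\<open>K + 1\<close> block discrepancies of this size add up to
        \<open>l\<close>.\<close>
      define l' where "l' = l / (real K + 1)"
      have l: "0 < l" "0 < l'" using Lam n by (auto simp: l_def l'_def add_pos_pos)
      have l2: "l\<^sup>2 = \<Lambda>\<^sup>2 * real n" by (simp add: l_def power_mult_distrib)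
      define Osc where "Osc k = {\<omega> \<in> space M. \<exists>N\<in>{k * q..Suc k * q}. l \<le> \<bar>mart F \<delta> N \<omega> - mart F \<delta> (k * q) \<omega>\<bar>}" for k
      define Q where "Q k = {\<omega> \<in> space M. l'\<^sup>2 \<le> (mart F \<delta> (Suc k * q) \<omega> - mart F \<delta> (k * q) \<omega> - sqrt v * Z k \<omega>)\<^sup>2}" for k
      have qd: "real q * \<delta> = R / K" using q Kpos by (simp add: \<delta>_def)
      have Osc: "Osc k \<in> events" "prob (Osc k) \<le> 2 * exp (- (a * real K))" if k: "k < K" for k
      proof -
        have "prob (Osc k) \<le> 2 * exp (- l\<^sup>2 / (2 * (real q * \<delta>)))"
          unfolding Osc_def by (rule mart_oscillation(1)[OF F F1 d k q l(1)])
        also have "- l\<^sup>2 / (2 * (real q * \<delta>)) = - (a * real K)"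
          unfolding qd l2 a_def R_def using n T Kpos by (simp add: divide_simps)
        finally show "prob (Osc k) \<le> 2 * exp (- (a * real K))" .
        show "Osc k \<in> events" unfolding Osc_def by (rule mart_oscillation(2)[OF F F1 d k q l(1)])
      qed
      have Q: "Q k \<in> events" "prob (Q k) \<le> Bn / l'\<^sup>2" if k: "k < K" for k
      proof -
        note [measurable] = borel_measurable_integrable[OF Z(3)[OF k]]
        show "Q k \<in> events" unfolding Q_def by measurable
        have "prob (Q k) \<le> (\<integral>\<omega>. (mart F \<delta> (Suc k * q) \<omega> - mart F \<delta> (k * q) \<omega> - sqrt v * Z k \<omega>)\<^sup>2 \<partial>M) / l'\<^sup>2"
          unfolding Q_def by (rule integral_Markov_inequality_measure[OF Z(3)[OF k], where A = "{}"]) (use l in auto)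
        also have "\<dots> \<le> Bn / l'\<^sup>2" using var[OF k] by (intro divide_right_mono) auto
        finally show "prob (Q k) \<le> Bn / l'\<^sup>2" .
      qed
      define U where "U = (\<Union>k<K. Osc k) \<union> (\<Union>k<K. Q k)"
      have UO: "(\<Union>k<K. Osc k) \<in> events" "(\<Union>k<K. Q k) \<in> events" using Osc Q by auto
      have U: "U \<in> events" using UO by (auto simp: U_def)
      have "prob U \<le> prob (\<Union>k<K. Osc k) + prob (\<Union>k<K. Q k)" unfolding U_def by (rule measure_Un_le[OF UO])
      also have "prob (\<Union>k<K. Osc k) \<le> (\<Sum>k<K. prob (Osc k))" using Osc by (intro measure_UNION_le) auto
      also have "\<dots> \<le> (\<Sum>k<K. 2 * exp (- (a * real K)))" using Osc by (intro sum_mono) auto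
      also have "\<dots> = 2 * real K * exp (- (a * real K))" by simp
      also have "\<dots> \<le> \<eta> / 3" using K0[OF Kpos(2)] by simp
      also have "prob (\<Union>k<K. Q k) \<le> (\<Sum>k<K. prob (Q k))" using Q by (intro measure_UNION_le) auto
      also have "\<dots> \<le> (\<Sum>k<K. Bn / l'\<^sup>2)" using Q by (intro sum_mono) auto
      also have "\<dots> = A * (Bn / real n)"
        using n Lam by (simp add: l'_def l2 A_def power_divide divide_simps)
      also have "Bn / real n = (2 * C0 + 2) * (1 / real n) + 2 * (1 + C\<^sup>2) * (sqrt (real n * T) / real n) + T * (1 + s2) * \<eta>'"
        using n by (simp add: Bn_def R_def add_divide_distrib)
      also have "A * \<dots> \<le> \<eta> / 3" using n0 by simp
      finally have pU: "prob U \<le> \<eta> / 3 + \<eta> / 3" by simp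
      have "prob E1 \<le> prob ((E1 - U) \<union> U)" using E1(1) U by (intro finite_measure_mono) auto
      also have "\<dots> \<le> prob (E1 - U) + prob U" using E1(1) U by (intro measure_Un_le) auto
      finally have pE: "1 - \<eta> \<le> prob (E1 - U)" using pU E1(2) eta'(2) by linarith
      have path_bound: "\<bar>(tv c (path \<omega>) (real n * t) - m * (real n * t)) / (\<sigma> * sqrt (real n))
          - polygon T K (\<lambda>k. sqrt (T / K) * Z k \<omega>) t\<bar> \<le> \<rho>"
        if w: "\<omega> \<in> E1 - U" and t: "t \<in> {0..T}" for \<omega> t
      proof -
        have ws: "\<omega> \<in> space M" using w sets.sets_into_space[OF E1(1)] by auto
        note pc = path_continuous[OF ws]
        define s where "s = real n * t"
        have s: "0 \<le> s" "s \<le> R" using t n T by (auto simp: s_def R_def)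
        have "\<bar>tv c (path \<omega>) s - m * s - polygon R K (\<lambda>k. sqrt v * Z k \<omega>) s\<bar>
            \<le> C0 + \<bar>m\<bar> * \<delta> + 2 * l + real (Suc K) * l'"
        proof (rule path_polygon_bound[where a = "\<lambda>N. mart F \<delta> N \<omega>" and V = "tv c (path \<omega>)", OF Kpos(1) q d])
          show "R = real (K * q) * \<delta>" using q Kpos by (simp add: \<delta>_def)
          show "tv c (path \<omega>) x \<le> tv c (path \<omega>) y" if "0 \<le> x" "x \<le> y" for x y
            by (rule tv_mono[OF pc c that])
          show "\<bar>tv c (path \<omega>) (real N * \<delta>) - m * (real N * \<delta>) - mart F \<delta> N \<omega>\<bar> \<le> C0" if "N \<le> K * q" for N
            by (rule g1) (use w that in auto)
          show "\<bar>mart F \<delta> N \<omega> - mart F \<delta> (k * q) \<omega>\<bar> \<le> l" if "k < K" "k * q \<le> N" "N \<le> Suc k * q" for k N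
          proof -
            have "\<omega> \<notin> Osc k" using w that(1) by (auto simp: U_def)
            then have "\<not> l \<le> \<bar>mart F \<delta> N \<omega> - mart F \<delta> (k * q) \<omega>\<bar>"
              using ws that(2,3) unfolding Osc_def by (simp only: mem_Collect_eq Bex_def atLeastAtMost_iff) blast
            then show ?thesis by simp
          qed
          show "\<bar>mart F \<delta> (Suc k * q) \<omega> - mart F \<delta> (k * q) \<omega> - sqrt v * Z k \<omega>\<bar> \<le> l'" if "k < K" for k
          proof -
            have "\<omega> \<notin> Q k" using w that by (auto simp: U_def)
            then have "\<not> l'\<^sup>2 \<le> (mart F \<delta> (Suc k * q) \<omega> - mart F \<delta> (k * q) \<omega> - sqrt v * Z k \<omega>)\<^sup>2"
              using ws unfolding Q_def by blast
            then have "\<bar>mart F \<delta> (Suc k * q) \<omega> - mart F \<delta> (k * q) \<omega> - sqrt v * Z k \<omega>\<bar>\<^sup>2 \<le> l'\<^sup>2" by simp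
            then show ?thesis by (rule power2_le_imp_le) (use l in simp)
          qed
          show "mart F \<delta> 0 \<omega> = 0" by (simp add: mart_def)
        qed (use l s in auto)
        also have "\<dots> \<le> 4 * l"
        proof -
          have "\<bar>m\<bar> * \<delta> \<le> \<bar>m\<bar>" using d1 d by (simp add: mult_left_le)
          moreover have "real (Suc K) * l' = l" by (simp add: l'_def add.commute)
          moreover have "C0 + \<bar>m\<bar> \<le> l" using n0 by (simp add: l_def)
          ultimately show ?thesis by linarith
        qed
        finally have b: "\<bar>tv c (path \<omega>) s - m * s - polygon R K (\<lambda>k. sqrt v * Z k \<omega>) s\<bar> \<le> 4 * l" .
        have sn: "0 < \<sigma> * sqrt (real n)" using sig n by simp
        have "v = s2 * (real n * (T / K))" by (simp add: v_def R_def)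
        then have "sqrt v = \<sigma> * sqrt (real n) * sqrt (T / K)" unfolding sig(2) by (simp only: real_sqrt_mult mult.assoc)
        then have p: "polygon R K (\<lambda>k. sqrt v * Z k \<omega>) s = (\<sigma> * sqrt (real n)) * polygon T K (\<lambda>k. sqrt (T / K) * Z k \<omega>) t"
        proof -
          assume "sqrt v = \<sigma> * sqrt (real n) * sqrt (T / K)"
          then have "(\<lambda>k. sqrt v * Z k \<omega>) = (\<lambda>k. (\<sigma> * sqrt (real n)) * (sqrt (T / K) * Z k \<omega>))" by (simp add: mult.assoc)
          moreover have "s * K / R = t * K / T" using n T by (simp add: s_def R_def)
          then have "polygon R K g s = polygon T K g t" for g by (simp add: polygon_def)
          ultimately show ?thesis by (simp only: polygon_scale)
        qed
        have "(tv c (path \<omega>) s - m * s) / (\<sigma> * sqrt (real n)) - polygon T K (\<lambda>k. sqrt (T / K) * Z k \<omega>) t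
            = (tv c (path \<omega>) s - m * s - polygon R K (\<lambda>k. sqrt v * Z k \<omega>) s) / (\<sigma> * sqrt (real n))"
          unfolding p diff_divide_distrib using n sig(1) by simp
        also have "\<bar>\<dots>\<bar> \<le> 4 * l / (\<sigma> * sqrt (real n))"
          unfolding abs_divide using b sn by (simp only: abs_of_pos divide_right_mono less_imp_le)
        also have "\<dots> = 4 * \<rho> / 6" using sig n by (simp add: l_def \<Lambda>_def)
        also have "\<dots> \<le> \<rho>" using rho by simp
        finally show ?thesis by (simp add: s_def)
      qed
      show "near_gaussian_polygon T \<rho> \<eta> K n"
        unfolding near_gaussian_polygon_def
        using pE Z(1,2) E1(1) U path_bound unfolding m_def \<sigma>_def
        by (intro exI[of _ Z] bexI[of _ "E1 - U"] conjI) auto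
    qed
  qed
qed

end

section \<open>The functional central limit theorem\<close>

text \<open>The normalised increments of the limiting motion have exactly the joint law demanded in
  \<open>near_gaussian_polygon\<close>, so at the level of polygons no limit has to be
  taken.\<close>

lemma (in standard_brownian_motion) distr_increments:
  assumes I: "I = {0..T}" and T: "0 < T" and K: "0 < K"
  shows "distr M (\<Pi>\<^sub>M k\<in>{..<K}. borel) (\<lambda>\<omega>. \<lambda>k\<in>{..<K}. increments T K (\<lambda>t. W t \<omega>) k / sqrt (T / K)) = (\<Pi>\<^sub>M k\<in>{..<K}. std_normal_distribution)"
    and "k < K \<Longrightarrow> (\<lambda>\<omega>. increments T K (\<lambda>t. W t \<omega>) k / sqrt (T / K)) \<in> borel_measurable M"
proof -
  define t where "t k = real k * T / K" for k
  have tI: "t k \<in> I" if "k \<le> K" for k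
  proof -
    have "real k * T \<le> real K * T" using that T by (intro mult_right_mono) auto
    then show ?thesis using T K by (simp add: t_def I divide_le_eq mult.commute)
  qed
  have mono: "strict_mono_on {..K} t" using T K by (auto simp: strict_mono_on_def t_def intro!: divide_strict_right_mono)
  have step: "t (Suc k) - t k = T / K" for k by (simp add: t_def algebra_simps add_divide_distrib)
  have pos: "0 < sqrt (T / K)" using T K by simp
  have X: "increments T K (\<lambda>t. W t \<omega>) k = W (t (Suc k)) \<omega> - W (t k) \<omega>" for k \<omega> by (simp add: increments_def t_def)
  define D where "D k \<omega> = increments T K (\<lambda>t. W t \<omega>) k / sqrt (T / K)" for k \<omega>
  have "indep_vars (\<lambda>_. borel) (\<lambda>i \<omega>. W (t (i + 1)) \<omega> - W (t i) \<omega>) {..<K}"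
    using tI mono by (intro indep_increments) auto
  from indep_vars_compose2[OF this, of "\<lambda>i x. x / sqrt (T / K)" "\<lambda>_. borel"]
  have iv: "indep_vars (\<lambda>_. borel) D {..<K}" by (simp add: D_def[abs_def] X)
  have dm: "D k \<in> borel_measurable M" if "k < K" for k using iv that by (auto simp: indep_vars_def)
  show "k < K \<Longrightarrow> (\<lambda>\<omega>. increments T K (\<lambda>t. W t \<omega>) k / sqrt (T / K)) \<in> borel_measurable M"
    using dm by (simp add: D_def[abs_def])
  have dD: "distr M borel (D k) = std_normal_distribution" if k: "k < K" for k
  proof -
    have "distributed M lborel (\<lambda>\<omega>. W (t (Suc k)) \<omega> - W (t k) \<omega>) (normal_density 0 (sqrt (t (Suc k) - t k)))"
      using step[of k] pos k by (intro normal_increments tI) auto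
    then have "distributed M lborel (D k) std_normal_density"
      using normal_standard_normal_convert[OF pos, of "\<lambda>\<omega>. W (t (Suc k)) \<omega> - W (t k) \<omega>" 0] by (simp add: D_def[abs_def] X step)
    from distributed_distr_eq_density[OF this] show ?thesis
      by (metis distr_cong sets_lborel)
  qed
  have "distr M (\<Pi>\<^sub>M k\<in>{..<K}. borel) (\<lambda>\<omega>. \<lambda>k\<in>{..<K}. D k \<omega>) = (\<Pi>\<^sub>M k\<in>{..<K}. distr M borel (D k))"
    using iv indep_vars_iff_distr_eq_PiM'[of "{..<K}" D "\<lambda>_. borel"] K dm by auto
  also have "\<dots> = (\<Pi>\<^sub>M k\<in>{..<K}. std_normal_distribution)" by (intro PiM_cong) (auto simp: dD)
  finally show "distr M (\<Pi>\<^sub>M k\<in>{..<K}. borel) (\<lambda>\<omega>. \<lambda>k\<in>{..<K}. increments T K (\<lambda>t. W t \<omega>) k / sqrt (T / K)) = (\<Pi>\<^sub>M k\<in>{..<K}. std_normal_distribution)"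
    by (simp add: D_def)
qed

lemma polygon_cong: "(\<And>k. k < K \<Longrightarrow> g k = h k) \<Longrightarrow> polygon T K g = polygon T K h"
  unfolding polygon_def by (intro ext sum.cong) auto

text \<open>The coupling lives on \<open>M\<close> and the limit on \<open>N\<close>. A functional
  of a polygon depends only on the joint law of its finitely many increments, so both sides can be
  carried to one integral over the product measure.\<close>

lemma lipschitz_polygon_law:
  assumes T: "0 \<le> T" and F: "lipschitz_functional (C_metric T) L F"
    and X: "\<And>k. k < K \<Longrightarrow> X k \<in> borel_measurable M"
    and law: "distr M (\<Pi>\<^sub>M k\<in>{..<K}. borel) (\<lambda>\<omega>. \<lambda>k\<in>{..<K}. X k \<omega>) = P"
  shows "(\<integral>\<omega>. F (\<lambda>t\<in>{0..T}. polygon T K (\<lambda>k. a * X k \<omega>) t) \<partial>M) = (\<integral>x. F (\<lambda>t\<in>{0..T}. polygon T K (\<lambda>k. a * x k) t) \<partial>P)"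
    and "(\<lambda>\<omega>. F (\<lambda>t\<in>{0..T}. polygon T K (\<lambda>k. a * X k \<omega>) t)) \<in> borel_measurable M"
proof -
  define \<Phi> where "\<Phi> x = F (\<lambda>t\<in>{0..T}. polygon T K (\<lambda>k. a * x k) t)" for x :: "nat \<Rightarrow> real"
  \<comment> \<open>The increments are padded to a sequence whose coordinate \<open>0\<close>, the
    starting value, is \<open>0\<close>.\<close>
  define y where "y x i = (case i of 0 \<Rightarrow> 0 | Suc k \<Rightarrow> if k < K then a * x k else 0)" for x :: "nat \<Rightarrow> real" and i
  have "y \<in> measurable (\<Pi>\<^sub>M k\<in>{..<K}. borel) borel"
  proof (rule measurable_coordinatewise_then_product)
    fix i
    show "(\<lambda>x. y x i) \<in> borel_measurable (\<Pi>\<^sub>M k\<in>{..<K}. borel)"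
    proof (cases i)
      case (Suc k)
      have "(\<lambda>x. a * x k) \<in> borel_measurable (\<Pi>\<^sub>M k\<in>{..<K}. borel)" if "k < K"
        using that by (intro borel_measurable_times borel_measurable_const measurable_component_singleton) auto
      then show ?thesis by (cases "k < K") (simp_all add: y_def Suc)
    qed (simp add: y_def)
  qed
  from measurable_compose[OF this lipschitz_polygon_measurable[OF T F, of K]]
  have "(\<lambda>x. F (\<lambda>t\<in>{0..T}. y x 0 + polygon T K (\<lambda>k. y x (Suc k)) t)) \<in> borel_measurable (\<Pi>\<^sub>M k\<in>{..<K}. borel)" .
  moreover have "polygon T K (\<lambda>k. y x (Suc k)) = polygon T K (\<lambda>k. a * x k)" for x by (rule polygon_cong) (simp add: y_def)
  ultimately have PM: "\<Phi> \<in> borel_measurable (\<Pi>\<^sub>M k\<in>{..<K}. borel)"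
    by (simp add: \<Phi>_def[abs_def]) (simp add: y_def)
  have XM: "(\<lambda>\<omega>. \<lambda>k\<in>{..<K}. X k \<omega>) \<in> measurable M (\<Pi>\<^sub>M k\<in>{..<K}. borel)"
    using X by (intro measurable_restrict) auto
  have eq: "\<Phi> (\<lambda>k\<in>{..<K}. X k \<omega>) = F (\<lambda>t\<in>{0..T}. polygon T K (\<lambda>k. a * X k \<omega>) t)" for \<omega>
  proof -
    have "polygon T K (\<lambda>k. a * (\<lambda>k\<in>{..<K}. X k \<omega>) k) = polygon T K (\<lambda>k. a * X k \<omega>)" by (rule polygon_cong) simp
    then show ?thesis by (simp add: \<Phi>_def)
  qed
  have "(\<integral>x. \<Phi> x \<partial>P) = (\<integral>\<omega>. F (\<lambda>t\<in>{0..T}. polygon T K (\<lambda>k. a * X k \<omega>) t) \<partial>M)"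
    using integral_distr[OF XM PM] unfolding law eq .
  then show "(\<integral>\<omega>. F (\<lambda>t\<in>{0..T}. polygon T K (\<lambda>k. a * X k \<omega>) t) \<partial>M) = (\<integral>x. F (\<lambda>t\<in>{0..T}. polygon T K (\<lambda>k. a * x k) t) \<partial>P)"
    unfolding \<Phi>_def by (rule sym)
  from measurable_compose[OF XM PM]
  show "(\<lambda>\<omega>. F (\<lambda>t\<in>{0..T}. polygon T K (\<lambda>k. a * X k \<omega>) t)) \<in> borel_measurable M"
    unfolding eq .
qed

theorem theorem12:
  fixes M :: "'a measure" and N :: "'b measure"
    and W :: "real \<Rightarrow> 'a \<Rightarrow> real" and B :: "real \<Rightarrow> 'b \<Rightarrow> real"
    and \<mu> c T :: real
  assumes "standard_brownian_motion M {0..} W"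
    and "standard_brownian_motion N {0..T} B"
    and "T > 0" and "c > 0"
  shows "sigma_sq c \<mu> > 0 \<and>
    converges_in_distribution (C_space T)
      M (\<lambda>n \<omega>. \<lambda>t\<in>{0..T}.
          (enn2real (truncated_variation c (\<lambda>s. W s \<omega> + \<mu> * s) 0 (real n * t))
             - m_const c \<mu> * (real n * t))
          / (sigma_const c \<mu> * sqrt (real n)))
      N (\<lambda>\<omega>. \<lambda>t\<in>{0..T}. B t \<omega>)"
proof
  show "sigma_sq c \<mu> > 0" by (rule sigma_sq_pos[OF assms(4)])
  interpret W: standard_brownian_motion M "{0..}" W by (rule assms(1))
  interpret B: standard_brownian_motion N "{0..T}" B by (rule assms(2))
  interpret drifted_brownian_motion M W \<mu> c by unfold_locales (rule assms(4))
  note T = assms(3)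
  \<comment> \<open>For \<open>n = 0\<close> the divisor is \<open>0\<close> and \<open>Y 0\<close>
    is the zero function; measurability is required of it as well.\<close>
  define Y where "Y n \<omega> = (\<lambda>t\<in>{0..T}. (tv c (path \<omega>) (real n * t) - m_const c \<mu> * (real n * t)) / (sigma_const c \<mu> * sqrt (real n)))" for n \<omega>
  define Z where "Z \<omega> = (\<lambda>t\<in>{0..T}. B t \<omega>)" for \<omega>
  have Y_eq: "Y = (\<lambda>n \<omega>. \<lambda>t\<in>{0..T}.
          (enn2real (truncated_variation c (\<lambda>s. W s \<omega> + \<mu> * s) 0 (real n * t)) - m_const c \<mu> * (real n * t))
          / (sigma_const c \<mu> * sqrt (real n)))"
  proof (rule ext, rule ext)
    fix n \<omega>
    have "path \<omega> = (\<lambda>s. W s \<omega> + \<mu> * s)" by (rule ext) (simp add: path_def)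
    then show "Y n \<omega> = (\<lambda>t\<in>{0..T}. (enn2real (truncated_variation c (\<lambda>s. W s \<omega> + \<mu> * s) 0 (real n * t)) - m_const c \<mu> * (real n * t))
          / (sigma_const c \<mu> * sqrt (real n)))"
      by (simp only: Y_def tv_def)
  qed
  have Ym: "Y n \<omega> \<in> mspace (C_metric T)" if w: "\<omega> \<in> space M" for n \<omega>
    unfolding mspace_C_metric
  proof
    have "(\<lambda>t. real n * t) ` {0..T} \<subseteq> {0..real n * T}" using T by (auto intro!: mult_left_mono)
    then have "continuous_on {0..T} (\<lambda>t. tv c (path \<omega>) (real n * t))"
      by (intro continuous_on_compose2[OF continuous_on_tv[OF path_continuous[OF w] assms(4), of "real n * T"]] continuous_intros)
    then have "continuous_on {0..T} (\<lambda>t. (tv c (path \<omega>) (real n * t) - m_const c \<mu> * (real n * t)) / (sigma_const c \<mu> * sqrt (real n)))"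
      unfolding divide_inverse by (intro continuous_intros)
    then show "continuous_on {0..T} (Y n \<omega>)"
      by (subst continuous_on_cong[OF refl]) (auto simp: Y_def)
  qed (simp add: Y_def)
  have Zm: "Z \<omega> \<in> mspace (C_metric T)" if w: "\<omega> \<in> space N" for \<omega>
    unfolding mspace_C_metric
  proof
    show "continuous_on {0..T} (Z \<omega>)"
      using B.continuous_paths[OF w] by (subst continuous_on_cong[OF refl]) (auto simp: Z_def)
  qed (simp add: Z_def)
  have Yt: "Y n \<in> measurable M (borel_of_topology (C_space T))" for n
  proof (rule measurable_C_space[OF T Ym])
    fix t :: real assume t: "0 \<le> t" "t \<le> T"
    have "(\<lambda>\<omega>. (tv c (path \<omega>) (real n * t) - m_const c \<mu> * (real n * t)) / (sigma_const c \<mu> * sqrt (real n))) \<in> borel_measurable M"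
      by (intro borel_measurable_divide borel_measurable_diff borel_measurable_const tv_path_measurable mult_nonneg_nonneg)
        (use t in auto)
    then show "(\<lambda>\<omega>. Y n \<omega> t) \<in> borel_measurable M" using t by (simp add: Y_def)
  qed
  have Zt: "Z \<in> measurable N (borel_of_topology (C_space T))"
    by (rule measurable_C_space[OF T Zm]) (use B.measurable_at in \<open>auto simp: Z_def\<close>)
  have "converges_in_distribution (mtopology_of (C_metric T)) M Y N Z"
  proof (rule converges_in_distributionI[OF W.prob_space_axioms B.prob_space_axioms])
    show "Y n \<in> measurable M (borel_of_topology (mtopology_of (C_metric T)))" for n using Yt by (simp add: C_space_eq)
    show "Z \<in> measurable N (borel_of_topology (mtopology_of (C_metric T)))" using Zt by (simp add: C_space_eq)
    fix F :: "(real \<Rightarrow> real) \<Rightarrow> real" and L b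
    assume F: "lipschitz_functional (C_metric T) L F" and b: "\<And>x. x \<in> mspace (C_metric T) \<Longrightarrow> \<bar>F x\<bar> \<le> b"
    have L: "0 \<le> L" and Lip: "\<And>x y. x \<in> mspace (C_metric T) \<Longrightarrow> y \<in> mspace (C_metric T) \<Longrightarrow> \<bar>F x - F y\<bar> \<le> L * mdist (C_metric T) x y"
      using F by (auto simp: lipschitz_functional_def)
    have in_C: "(\<lambda>t\<in>{0..T}. polygon T K g t) \<in> mspace (C_metric T)" for K g
      using interpolation_in_C[of 0 T K g] by simp
    have b0: "0 \<le> b" using b[OF in_C, of 0 "\<lambda>_. 0"] by linarith
    have FY: "(\<lambda>\<omega>. F (Y n \<omega>)) \<in> borel_measurable M" for n
      using measurable_compose[OF Yt[unfolded C_space_eq] continuous_map_borel_measurable[OF lipschitz_functional_continuous[OF F]]] .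
    have FZ: "(\<lambda>\<omega>. F (Z \<omega>)) \<in> borel_measurable N"
      using measurable_compose[OF Zt[unfolded C_space_eq] continuous_map_borel_measurable[OF lipschitz_functional_continuous[OF F]]] .
    let ?P = "\<lambda>K. (\<Pi>\<^sub>M k\<in>{..<K}. std_normal_distribution)"
    \<comment> \<open>The common value: the mean of \<open>F\<close> over Gaussian polygons with
      \<open>K\<close> sides, reached from \<open>Z\<close> through its interpolations and from
      \<open>Y n\<close> through the coupling.\<close>
    let ?J = "\<lambda>K. (\<integral>x. F (\<lambda>t\<in>{0..T}. polygon T K (\<lambda>k. sqrt (T / K) * x k) t) \<partial>?P K)"
    have J: "(\<integral>\<omega>. F (interpolation T K (Z \<omega>)) \<partial>N) = ?J K" 
      and FI: "(\<lambda>\<omega>. F (interpolation T K (Z \<omega>))) \<in> borel_measurable N" if K: "0 < K" for K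
    proof -
      let ?D = "\<lambda>k \<omega>. increments T K (\<lambda>t. B t \<omega>) k / sqrt (T / K)"
      note D = B.distr_increments[OF refl T K]
      have Z_inc: "polygon T K (increments T K (Z \<omega>)) = polygon T K (\<lambda>k. sqrt (T / K) * ?D k \<omega>)" for \<omega>
      proof (rule polygon_cong)
        fix k assume k: "k < K"
        have *: "real j * T / K \<in> {0..T}" if "j \<le> K" for j
        proof -
          have "real j * T \<le> real K * T" using that T by (intro mult_right_mono) auto
          then show ?thesis using T K by (simp add: divide_le_eq mult.commute)
        qed
        show "increments T K (Z \<omega>) k = sqrt (T / K) * ?D k \<omega>"
          using *[of k] *[of "Suc k"] k T K by (simp add: increments_def Z_def del: of_nat_Suc)
      qed
      note LP = lipschitz_polygon_law[OF less_imp_le[OF T] F D(2) D(1), of "sqrt (T / K)"]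
      \<comment> \<open>The interpolation keeps the starting value, and \<open>B 0 = 0\<close> holds
        only almost everywhere. As \<open>N\<close> need not be complete, measurability of the
        interpolated functional is established directly.\<close>
      have "AE \<omega> in N. interpolation T K (Z \<omega>) = (\<lambda>t\<in>{0..T}. polygon T K (\<lambda>k. sqrt (T / K) * ?D k \<omega>) t)"
        using B.start
      proof eventually_elim
        case (elim \<omega>)
        then have "Z \<omega> 0 = 0" using T by (simp add: Z_def)
        then show ?case unfolding interpolation_def Z_inc by simp
      qed
      moreover show FI: "(\<lambda>\<omega>. F (interpolation T K (Z \<omega>))) \<in> borel_measurable N"
      proof -
        have "interpolation T K \<circ> Z \<in> measurable N (borel_of_topology (C_space T))"
        proof (rule measurable_C_space[OF T])
          show "(interpolation T K \<circ> Z) \<omega> \<in> mspace (C_metric T)" for \<omega> by (simp add: interpolation_def interpolation_in_C)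
          fix t :: real assume t: "0 \<le> t" "t \<le> T"
          have *: "(\<lambda>\<omega>. B 0 \<omega> + polygon T K (\<lambda>k. sqrt (T / K) * ?D k \<omega>) t) \<in> borel_measurable N"
            unfolding polygon_def using B.measurable_at[of 0] D(2) T
            by (intro borel_measurable_add borel_measurable_sum borel_measurable_times borel_measurable_const) auto
          have "(interpolation T K \<circ> Z) \<omega> t = B 0 \<omega> + polygon T K (\<lambda>k. sqrt (T / K) * ?D k \<omega>) t" for \<omega>
            unfolding comp_def interpolation_def Z_inc using t T by (simp add: Z_def)
          then show "(\<lambda>\<omega>. (interpolation T K \<circ> Z) \<omega> t) \<in> borel_measurable N" using * by simp
        qed
        from measurable_compose[OF this[unfolded C_space_eq] continuous_map_borel_measurable[OF lipschitz_functional_continuous[OF F]]]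
        show ?thesis by simp
      qed
      ultimately have "(\<integral>\<omega>. F (interpolation T K (Z \<omega>)) \<partial>N) = (\<integral>\<omega>. F (\<lambda>t\<in>{0..T}. polygon T K (\<lambda>k. sqrt (T / K) * ?D k \<omega>) t) \<partial>N)"
        using LP(2) by (intro integral_cong_AE) auto
      then show "(\<integral>\<omega>. F (interpolation T K (Z \<omega>)) \<partial>N) = ?J K" using LP(1) by simp
    qed
    \<comment> \<open>\<open>Suc K\<close> leaves out the polygon without sides, to which the law of
      the increments does not apply.\<close>
    have "(\<lambda>K. \<integral>\<omega>. F (interpolation T (Suc K) (Z \<omega>)) \<partial>N) \<longlonglongrightarrow> (\<integral>\<omega>. F (Z \<omega>) \<partial>N)"
    proof (rule integral_dominated_convergence[where w = "\<lambda>_. b"])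
      show "AE \<omega> in N. (\<lambda>K. F (interpolation T (Suc K) (Z \<omega>))) \<longlonglongrightarrow> F (Z \<omega>)"
        by (intro AE_I2 LIMSEQ_Suc interpolation_tendsto[OF T _ F] Zm)
      show "AE \<omega> in N. norm (F (interpolation T (Suc K) (Z \<omega>))) \<le> b" for K
        using b by (intro AE_I2) (simp add: interpolation_def interpolation_in_C)
    qed (use FZ FI in auto)
    then have limJ: "(\<lambda>K. ?J (Suc K)) \<longlonglongrightarrow> (\<integral>\<omega>. F (Z \<omega>) \<partial>N)" using J by simp
    show "(\<lambda>n. \<integral>\<omega>. F (Y n \<omega>) \<partial>M) \<longlonglongrightarrow> (\<integral>\<omega>. F (Z \<omega>) \<partial>N)"
    proof (rule LIMSEQ_I)
      fix e :: real assume e: "0 < e"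
      \<comment> \<open>A quarter of \<open>e\<close> each goes to the Lipschitz error on
        \<open>E\<close>, to the contribution off \<open>E\<close>, bounded through
        \<open>2 * b\<close>, and to the distance of \<open>?J K\<close> from its limit. The added
        \<open>1\<close> in the denominators covers \<open>L = 0\<close> and
        \<open>b = 0\<close>.\<close>
      define \<rho> where "\<rho> = e / (4 * (L + 1))"
      define \<eta> where "\<eta> = e / (8 * (b + 1))"
      have rho: "0 < \<rho>" "L * \<rho> \<le> e / 4"
      proof -
        show "0 < \<rho>" using e L by (simp add: \<rho>_def)
        have "L * \<rho> \<le> (L + 1) * \<rho>" using \<open>0 < \<rho>\<close> by simp
        also have "\<dots> = e / 4" using L by (simp add: \<rho>_def divide_simps)
        finally show "L * \<rho> \<le> e / 4" .
      qed
      have eta: "0 < \<eta>" "2 * b * \<eta> \<le> e / 4"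
      proof -
        show "0 < \<eta>" using e b0 by (simp add: \<eta>_def)
        have "2 * b * \<eta> \<le> 2 * (b + 1) * \<eta>" using \<open>0 < \<eta>\<close> by simp
        also have "\<dots> = e / 4" using b0 by (simp add: \<eta>_def divide_simps)
        finally show "2 * b * \<eta> \<le> e / 4" .
      qed
      obtain K0 where K0: "\<And>K. K0 \<le> K \<Longrightarrow> \<exists>n0. \<forall>n\<ge>n0. near_gaussian_polygon T \<rho> \<eta> K n"
        using coupling[OF T rho(1) eta(1)] by blast
      obtain K1 where K1: "\<And>K. K1 \<le> K \<Longrightarrow> \<bar>?J (Suc K) - (\<integral>\<omega>. F (Z \<omega>) \<partial>N)\<bar> < e / 4"
        using LIMSEQ_D[OF limJ, of "e / 4"] e by auto
      define K where "K = Suc (max K0 K1)"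
      have K: "K0 \<le> K" "0 < K" and JK: "\<bar>?J K - (\<integral>\<omega>. F (Z \<omega>) \<partial>N)\<bar> < e / 4"
        using K1[of "max K0 K1"] by (auto simp: K_def)
      obtain n0 where n0: "\<And>n. n0 \<le> n \<Longrightarrow> near_gaussian_polygon T \<rho> \<eta> K n"
        using K0[OF K(1)] by blast
      show "\<exists>no. \<forall>n\<ge>no. norm ((\<integral>\<omega>. F (Y n \<omega>) \<partial>M) - (\<integral>\<omega>. F (Z \<omega>) \<partial>N)) < e"
      proof (intro exI[of _ n0] allI impI)
        fix n assume "n0 \<le> n"
        from n0[OF this, unfolded near_gaussian_polygon_def] obtain G E where E: "E \<in> sets M" "1 - \<eta> \<le> W.prob E"
          and G: "\<And>k. k < K \<Longrightarrow> G k \<in> borel_measurable M"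
          and law: "distr M (\<Pi>\<^sub>M k\<in>{..<K}. borel) (\<lambda>\<omega>. \<lambda>k\<in>{..<K}. G k \<omega>) = ?P K"
          and close: "\<And>\<omega> t. \<omega> \<in> E \<Longrightarrow> t \<in> {0..T} \<Longrightarrow> \<bar>(tv c (path \<omega>) (real n * t) - m_const c \<mu> * (real n * t)) / (sigma_const c \<mu> * sqrt (real n))
            - polygon T K (\<lambda>k. sqrt (T / K) * G k \<omega>) t\<bar> \<le> \<rho>"
          by blast
        define Q where "Q \<omega> = (\<lambda>t\<in>{0..T}. polygon T K (\<lambda>k. sqrt (T / K) * G k \<omega>) t)" for \<omega>
        note LP = lipschitz_polygon_law[OF less_imp_le[OF T] F G law, of "sqrt (T / K)", folded Q_def]
        have iY: "integrable M (\<lambda>\<omega>. F (Y n \<omega>))" and iQ: "integrable M (\<lambda>\<omega>. F (Q \<omega>))"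
          using FY LP(2) b Ym in_C by (auto intro!: W.integrable_const_bound[where B=b] AE_I2 simp: Q_def)
        have "\<bar>(\<integral>\<omega>. F (Y n \<omega>) \<partial>M) - (\<integral>\<omega>. F (Q \<omega>) \<partial>M)\<bar> = \<bar>\<integral>\<omega>. F (Y n \<omega>) - F (Q \<omega>) \<partial>M\<bar>"
          using iY iQ by simp
        also have "\<dots> \<le> (\<integral>\<omega>. \<bar>F (Y n \<omega>) - F (Q \<omega>)\<bar> \<partial>M)" by (rule integral_abs_bound)
        also have "\<dots> \<le> (\<integral>\<omega>. L * \<rho> + 2 * b * indicator (space M - E) \<omega> \<partial>M)"
        proof (rule integral_mono)
          show "integrable M (\<lambda>\<omega>. L * \<rho> + 2 * b * indicator (space M - E) \<omega>)"
            using E(1) by (intro Bochner_Integration.integrable_add integrable_mult_right W.integrable_const integrable_real_indicator) (auto simp: less_top[symmetric])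
          fix \<omega> assume w: "\<omega> \<in> space M"
          have QC: "Q \<omega> \<in> mspace (C_metric T)" unfolding Q_def by (rule in_C)
          show "\<bar>F (Y n \<omega>) - F (Q \<omega>)\<bar> \<le> L * \<rho> + 2 * b * indicator (space M - E) \<omega>"
          proof (cases "\<omega> \<in> E")
            case True
            have "mdist (C_metric T) (Y n \<omega>) (Q \<omega>) \<le> \<rho>"
              unfolding mdist_C_metric_le[OF Ym[OF w] QC less_imp_le[OF T]] using close[OF True] by (simp add: Y_def Q_def)
            then have "L * mdist (C_metric T) (Y n \<omega>) (Q \<omega>) \<le> L * \<rho>" using L by (rule mult_left_mono)
            then show ?thesis using Lip[OF Ym[OF w, of n] QC] True by simp
          next
            case False
            have "0 \<le> L * \<rho>" using L rho by simp
            then show ?thesis using b[OF Ym[OF w, of n]] b[OF QC] False w by simp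
          qed
        qed (use iY iQ in auto)
        also have "\<dots> = L * \<rho> + 2 * b * W.prob (space M - E)"
          using E(1) by (subst Bochner_Integration.integral_add) (auto simp: W.prob_space less_top[symmetric] intro!: integrable_real_indicator)
        also have "\<dots> \<le> L * \<rho> + 2 * b * \<eta>"
          using E b0 W.prob_compl[OF E(1)] by (intro add_left_mono mult_left_mono) auto
        also have "\<dots> \<le> e / 4 + e / 4" using rho eta by linarith
        finally have "\<bar>(\<integral>\<omega>. F (Y n \<omega>) \<partial>M) - ?J K\<bar> \<le> e / 4 + e / 4" using LP(1) by simp
        then show "norm ((\<integral>\<omega>. F (Y n \<omega>) \<partial>M) - (\<integral>\<omega>. F (Z \<omega>) \<partial>N)) < e"
          using JK e unfolding real_norm_def by linarith
      qed
    qed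
  qed
  then show "converges_in_distribution (C_space T)
      M (\<lambda>n \<omega>. \<lambda>t\<in>{0..T}.
          (enn2real (truncated_variation c (\<lambda>s. W s \<omega> + \<mu> * s) 0 (real n * t))
             - m_const c \<mu> * (real n * t))
          / (sigma_const c \<mu> * sqrt (real n)))
      N (\<lambda>\<omega>. \<lambda>t\<in>{0..T}. B t \<omega>)"
    unfolding C_space_eq Y_eq Z_def[abs_def] .
qed

end
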